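(* Let $Q=(-1,0)\times(-1,1)$ and let $D$ be a fixed nonempty open rectangle with $D\subset\subset Q_{1/2}=(-1/4,0)\times(-1/2,1/2)$. Let $0<\kappa<1$ and $p=\frac{2}{1-\kappa}$. There exist a Borel function $a:Q\to[\kappa,\kappa^{-1}]$, a function $u\in W^{1,2}_2(Q)$, and a compact set $\Sigma\subset D$ of Lebesgue measure zero such that: (1) $a$ and $u$ are smooth in $Q\setminus\Sigma$; (2) $u_t-au_{xx}=0$ a.e. in $Q$, $u$ and $u_x$ are bounded and continuous in $Q$, and there are constants $c,N>0$ such that $c\,\tau^{-p}\le|\{(t,x)\in D:u_{xx}(t,x)>\tau\}|\le N\tau^{-p}$ for all sufficiently large $\tau>0$; in particular $u_t,u_{xx}\in L_{p,\infty}(D)$ and $u_t,u_{xx}\notin L_p(D)$; (3) there exist $\{\phi_j\}_{j\ge1}\subset C_0^\infty(Q)$ and constants $c,N>0$ independent of $j$ such that $\|\phi_j\|_{L_\infty}+\|\phi_{j,x}\|_{L_\infty}+\|\phi_{j,t}-a\phi_{j,xx}\|_{L_p(Q)}\le N$ and $\int_D|\phi_{j,xx}|^p\,dx\,dt\ge c\log j$.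
   Context: Points are written $(t,x)$ with $t$ time and $x$ space. Rectangles have sides parallel to the $t$- and $x$-axes. $W^{1,2}_2(Q)=\{u:u,u_x,u_t,u_{xx}\in L_2(Q)\}$ (weak derivatives). $L_{p,\infty}$ denotes the weak $L_p$ space, and $|\cdot|$ of a set is Lebesgue measure. $\phi_{j,t},\phi_{j,x},\phi_{j,xx}$ are partial derivatives of $\phi_j$. $D\subset\subset Q_{1/2}$ means that $\overline D$ is a compact subset of $Q_{1/2}$. *)

theory Defs
  imports "HOL-Analysis.Analysis" "HOL-Probability.Essential_Supremum"
begin

text \<open>Points of the plane are pairs \<open>(t, x)\<close>: the first coordinate is time, the second is space.\<close>

definition Q_cyl :: "(real \<times> real) set" where
  "Q_cyl = {-1<..<0} \<times> {-1<..<1}"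

definition Q_half :: "(real \<times> real) set" where
  "Q_half = {-1/4<..<0} \<times> {-1/2<..<1/2}"

definition compactly_inside :: "(real \<times> real) set \<Rightarrow> (real \<times> real) set \<Rightarrow> bool" where
  "compactly_inside A S \<longleftrightarrow> compact (closure A) \<and> closure A \<subseteq> S"


text \<open>Classical partial derivatives. The values are meaningful only where the derivative exists.\<close>

definition pd_t :: "(real \<times> real \<Rightarrow> real) \<Rightarrow> real \<times> real \<Rightarrow> real" where
  "pd_t f z = deriv (\<lambda>s. f (s, snd z)) (fst z)"

definition pd_x :: "(real \<times> real \<Rightarrow> real) \<Rightarrow> real \<times> real \<Rightarrow> real" where
  "pd_x f z = deriv (\<lambda>y. f (fst z, y)) (snd z)"

text \<open>\<open>C_on k S f\<close> says that \<open>f\<close> is of class \<open>C\<^sup>k\<close> on \<open>S\<close>; it is intended for open \<open>S\<close> only.\<close>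

fun C_on :: "nat \<Rightarrow> (real \<times> real) set \<Rightarrow> (real \<times> real \<Rightarrow> real) \<Rightarrow> bool" where
  "C_on 0 S f \<longleftrightarrow> continuous_on S f"
| "C_on (Suc k) S f \<longleftrightarrow>
     (\<forall>z\<in>S. f differentiable (at z)) \<and> C_on k S (pd_t f) \<and> C_on k S (pd_x f)"

definition smooth_on :: "(real \<times> real) set \<Rightarrow> (real \<times> real \<Rightarrow> real) \<Rightarrow> bool" where
  "smooth_on S f \<longleftrightarrow> (\<forall>k. C_on k S f)"

text \<open>\<open>C\<^sub>0\<^sup>\<infinity>(S)\<close>, its elements being extended by zero to the whole plane.\<close>

definition test_functions :: "(real \<times> real) set \<Rightarrow> (real \<times> real \<Rightarrow> real) set" where
  "test_functions S = {\<phi>. smooth_on UNIV \<phi> \<and> compactly_inside {z. \<phi> z \<noteq> 0} S}"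


definition Lp_on :: "real \<Rightarrow> (real \<times> real) set \<Rightarrow> (real \<times> real \<Rightarrow> real) \<Rightarrow> bool" where
  "Lp_on p S f \<longleftrightarrow>
     f \<in> borel_measurable (lebesgue_on S) \<and> integrable (lebesgue_on S) (\<lambda>z. \<bar>f z\<bar> powr p)"

definition Lp_norm :: "real \<Rightarrow> (real \<times> real) set \<Rightarrow> (real \<times> real \<Rightarrow> real) \<Rightarrow> ennreal" where
  "Lp_norm p S f =
     (if Lp_on p S f then ennreal ((\<integral>z. \<bar>f z\<bar> powr p \<partial>lebesgue_on S) powr (1 / p)) else \<infinity>)"

definition Linf_norm :: "(real \<times> real) set \<Rightarrow> (real \<times> real \<Rightarrow> real) \<Rightarrow> ennreal" where
  "Linf_norm S f = esssup (lebesgue_on S) (\<lambda>z. ennreal \<bar>f z\<bar>)"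

definition weak_Lp_on :: "real \<Rightarrow> (real \<times> real) set \<Rightarrow> (real \<times> real \<Rightarrow> real) \<Rightarrow> bool" where
  "weak_Lp_on p S f \<longleftrightarrow>
     f \<in> borel_measurable (lebesgue_on S) \<and>
     (\<exists>N\<ge>0. \<forall>\<tau>>0. emeasure lebesgue {z\<in>S. \<bar>f z\<bar> > \<tau>} \<le> ennreal (N * \<tau> powr (-p)))"


definition locally_integrable_on :: "(real \<times> real \<Rightarrow> real) \<Rightarrow> (real \<times> real) set \<Rightarrow> bool" where
  "locally_integrable_on f S \<longleftrightarrow>
     (\<forall>K. compact K \<and> K \<subseteq> S \<longrightarrow> f absolutely_integrable_on K)"

definition has_weak_pd_t ::
  "(real \<times> real) set \<Rightarrow> (real \<times> real \<Rightarrow> real) \<Rightarrow> (real \<times> real \<Rightarrow> real) \<Rightarrow> bool" where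
  "has_weak_pd_t S f g \<longleftrightarrow>
     locally_integrable_on f S \<and> locally_integrable_on g S \<and>
     (\<forall>\<psi>\<in>test_functions S.
        (\<integral>z. f z * pd_t \<psi> z \<partial>lebesgue_on S) = - (\<integral>z. g z * \<psi> z \<partial>lebesgue_on S))"

definition has_weak_pd_x ::
  "(real \<times> real) set \<Rightarrow> (real \<times> real \<Rightarrow> real) \<Rightarrow> (real \<times> real \<Rightarrow> real) \<Rightarrow> bool" where
  "has_weak_pd_x S f g \<longleftrightarrow>
     locally_integrable_on f S \<and> locally_integrable_on g S \<and>
     (\<forall>\<psi>\<in>test_functions S.
        (\<integral>z. f z * pd_x \<psi> z \<partial>lebesgue_on S) = - (\<integral>z. g z * \<psi> z \<partial>lebesgue_on S))"

text \<open>
  \<open>u\<close> belongs to \<open>W\<^sup>1\<^sup>,\<^sup>2\<^sub>2(S)\<close>, and \<open>ut\<close>, \<open>ux\<close>, \<open>uxx\<close> are representatives of its weak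
  derivatives (each of which is determined up to a null set).
\<close>

definition W122_on ::
  "(real \<times> real) set \<Rightarrow> (real \<times> real \<Rightarrow> real) \<Rightarrow> (real \<times> real \<Rightarrow> real) \<Rightarrow>
   (real \<times> real \<Rightarrow> real) \<Rightarrow> (real \<times> real \<Rightarrow> real) \<Rightarrow> bool" where
  "W122_on S u ut ux uxx \<longleftrightarrow>
     has_weak_pd_t S u ut \<and> has_weak_pd_x S u ux \<and> has_weak_pd_x S ux uxx \<and>
     Lp_on 2 S u \<and> Lp_on 2 S ut \<and> Lp_on 2 S ux \<and> Lp_on 2 S uxx"

end

theory Submission
  imports Defs
begin

text \<open>
  For functions \<open>w(t, x)\<close> the product \<open>w\<^sub>t w\<^sub>x\<^sub>x\<close> is a null Lagrangian, so the pair \<open>(w\<^sub>t, w\<^sub>x\<^sub>x)\<close> can be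
  modified by oscillations in \<open>x\<close>, which change \<open>w\<^sub>x\<^sub>x\<close> only, and by oscillations in \<open>t\<close>, which change
  \<open>w\<^sub>t\<close> only. Starting from the pair \<open>(v, v)\<close> on \<open>A \<times> B\<close>, an oscillation in \<open>x\<close> followed by one in \<open>t\<close>
  produces the pair \<open>(v + 1, v + 1)\<close> on a subset of relative measure about \<open>1 - p / v\<close>, while the
  ratio \<open>w\<^sub>t / w\<^sub>x\<^sub>x\<close> stays in \<open>[\<kappa>, 1 / \<kappa>]\<close>. Iterating this staircase laminate gives nested sets
  \<open>A\<^sub>n \<times> B\<^sub>n\<close> of measure comparable to \<open>n\<^sup>-\<^sup>p\<close> on which \<open>u\<^sub>x\<^sub>x\<close> is at least of order \<open>n\<close>, and \<open>\<Sigma>\<close> is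
  their intersection. All rectangles of a stage are treated alike, so every correction is a product
  of functions of one variable. The functions \<open>\<phi>\<^sub>j\<close> are cutoffs of the stage functions:
  \<open>\<phi>\<^sub>t - a \<phi>\<^sub>x\<^sub>x\<close> is bounded except on \<open>A\<^sub>j \<times> B\<^sub>j\<close>, where it is of order \<open>j\<close>.
\<close>

section \<open>Smooth functions\<close>

text \<open>The exponent: an oscillation of height 1 retained on a fraction \<theta> has mean zero,
  so it must descend to about -\<theta>/(1 - \<theta>) on the rest. From the pair
  \<open>(v, v)\<close> the ratio bound permits a descent of at most (1 - \<kappa>) v, so 1 -
  \<theta> is about 1/((1 - \<kappa>) v). Each stage pays this once in x and once in t, which gives
  1 - p/v. The obstacle: an oscillation has to be cut off smoothly in the other variable. The
  product \<open>h * \<rho>\<close> creates the error \<open>h * deriv \<rho>\<close> in the time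
  derivative, and \<open>g * \<xi>\<close> creates \<open>g * deriv (deriv \<xi>)\<close> in the
  second space derivative. Derivatives of cutoffs are not controlled, so each cutoff is fixed first
  and the frequency of the oscillation is chosen afterwards. The measure lost in the cutoff layers
  must be only a bounded factor over all stages. The ratio bound has to hold with \<kappa> itself,
  so the staircase starts at the offset \<open>V = 4 / (1 - \<kappa>)\<close>, which leaves room for
  the errors. They do not accumulate: on the n-th box both derivatives equal \<open>v n\<close>
  exactly, and off it later stages change nothing.\<close>

lemma C_on_cong:
  assumes "open S" "\<And>z. z \<in> S \<Longrightarrow> f z = g z"
  shows "C_on k S f \<longleftrightarrow> C_on k S g"
  using assms
proof (induction k arbitrary: f g)
  case 0
  then show ?case by (simp cong: continuous_on_cong)
next
  case (Suc k)
  have t: "pd_t f z = pd_t g z" and x: "pd_x f z = pd_x g z" if z: "z \<in> S" for z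
  proof -
    obtain A B where AB: "open A" "open B" "z \<in> A \<times> B" "A \<times> B \<subseteq> S"
      using open_prod_elim[OF Suc.prems(1) z] by metis
    have "\<forall>\<^sub>F s in nhds (fst z). s \<in> A" "\<forall>\<^sub>F y in nhds (snd z). y \<in> B"
      using AB by (auto intro!: eventually_nhds_in_open simp: mem_Times_iff)
    then have "\<forall>\<^sub>F s in nhds (fst z). f (s, snd z) = g (s, snd z)"
      "\<forall>\<^sub>F y in nhds (snd z). f (fst z, y) = g (fst z, y)"
      using AB Suc.prems(2) by (auto elim!: eventually_mono simp: mem_Times_iff subset_iff)
    then show "pd_t f z = pd_t g z" "pd_x f z = pd_x g z"
      unfolding pd_t_def pd_x_def by (auto intro: deriv_cong_ev)
  qed
  have d: "f differentiable (at z) \<longleftrightarrow> g differentiable (at z)" if "z \<in> S" for z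
    unfolding differentiable_def
    using that Suc.prems has_derivative_transform_within_open[of f _ z UNIV S g]
      has_derivative_transform_within_open[of g _ z UNIV S f]
    by metis
  show ?case
    using Suc.IH[OF Suc.prems(1) t] Suc.IH[OF Suc.prems(1) x] d by auto
qed

lemma C_on_subset: "C_on k S f \<Longrightarrow> T \<subseteq> S \<Longrightarrow> C_on k T f"
  by (induction k arbitrary: f) (auto intro: continuous_on_subset)

lemma C_on_local:
  assumes "\<And>z. z \<in> S \<Longrightarrow> \<exists>U. open U \<and> z \<in> U \<and> C_on k U f"
  shows "C_on k S f"
  using assms
proof (induction k arbitrary: f)
  case 0
  show ?case
    unfolding C_on.simps continuous_on_eq_continuous_within
  proof
    fix z assume "z \<in> S"
    then obtain U where "open U" "z \<in> U" "continuous_on U f" using 0[of z] by auto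
    then show "continuous (at z within S) f"
      using continuous_on_eq_continuous_at continuous_at_imp_continuous_at_within by blast
  qed
next
  case (Suc k)
  show ?case
    unfolding C_on.simps
  proof (intro conjI ballI)
    fix z assume "z \<in> S" then show "f differentiable at z" using Suc.prems[of z] by auto
  next
    show "C_on k S (pd_t f)" "C_on k S (pd_x f)"
      using Suc.prems by (auto intro!: Suc.IH) meson+
  qed
qed

lemma C_on_imp_continuous: "C_on k S f \<Longrightarrow> continuous_on S f"
  by (cases k) (auto intro!: continuous_at_imp_continuous_on differentiable_imp_continuous_within)

lemma C_on_Suc_imp: "C_on (Suc k) S f \<Longrightarrow> C_on k S f"
proof (induction k arbitrary: f)
  case 0 then show ?case by (auto intro: C_on_imp_continuous[of "Suc 0"])
next
  case (Suc k) then show ?case by (metis C_on.simps(2))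
qed

lemma pd_derivs:
  assumes "f differentiable (at z)"
  shows "((\<lambda>s. f (s, snd z)) has_real_derivative pd_t f z) (at (fst z))"
    and "((\<lambda>y. f (fst z, y)) has_real_derivative pd_x f z) (at (snd z))"
proof -
  have f: "f differentiable (at (fst z, snd z))" using assms by simp
  have "(f \<circ> (\<lambda>s. (s, snd z))) differentiable (at (fst z))"
    by (rule differentiable_chain_at) (use f in \<open>auto intro: differentiable_Pair\<close>)
  moreover have "(f \<circ> (\<lambda>y. (fst z, y))) differentiable (at (snd z))"
    by (rule differentiable_chain_at) (use f in \<open>auto intro: differentiable_Pair\<close>)
  ultimately show "((\<lambda>s. f (s, snd z)) has_real_derivative pd_t f z) (at (fst z))"
    "((\<lambda>y. f (fst z, y)) has_real_derivative pd_x f z) (at (snd z))"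
    unfolding pd_t_def pd_x_def
    by (auto simp: o_def real_differentiable_def DERIV_imp_deriv)
qed

lemma pd_add:
  assumes "f differentiable (at z)" "g differentiable (at z)"
  shows "pd_t (\<lambda>z. f z + g z) z = pd_t f z + pd_t g z"
    and "pd_x (\<lambda>z. f z + g z) z = pd_x f z + pd_x g z"
  using pd_derivs[OF assms(1)] pd_derivs[OF assms(2)]
  unfolding pd_t_def[of "\<lambda>z. f z + g z"] pd_x_def[of "\<lambda>z. f z + g z"]
  by (auto intro!: DERIV_imp_deriv derivative_eq_intros)

lemma pd_mult:
  assumes "f differentiable (at z)" "g differentiable (at z)"
  shows "pd_t (\<lambda>z. f z * g z) z = pd_t f z * g z + f z * pd_t g z"
    and "pd_x (\<lambda>z. f z * g z) z = pd_x f z * g z + f z * pd_x g z"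
  using pd_derivs[OF assms(1)] pd_derivs[OF assms(2)]
  unfolding pd_t_def[of "\<lambda>z. f z * g z"] pd_x_def[of "\<lambda>z. f z * g z"]
  by (auto intro!: DERIV_imp_deriv derivative_eq_intros)

text \<open>The derivatives are written with products only, so that \<open>C_on_mult\<close> and
  \<open>C_on_const\<close> apply to them directly in the induction of
  \<open>C_on_inverse\<close>.\<close>

lemma pd_inverse:
  assumes "f differentiable (at z)" "f z \<noteq> 0"
  shows "pd_t (\<lambda>z. inverse (f z)) z = - 1 * (pd_t f z * (inverse (f z) * inverse (f z)))"
    and "pd_x (\<lambda>z. inverse (f z)) z = - 1 * (pd_x f z * (inverse (f z) * inverse (f z)))"
  using pd_derivs[OF assms(1)] assms(2)
  unfolding pd_t_def[of "\<lambda>z. inverse (f z)"] pd_x_def[of "\<lambda>z. inverse (f z)"]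
  by (auto intro!: DERIV_imp_deriv derivative_eq_intros)

lemma C_on_const: "C_on k S (\<lambda>z. c)"
  by (induction k arbitrary: c) (auto simp: pd_t_def[abs_def] pd_x_def[abs_def])

lemma C_on_add:
  assumes "open S" "C_on k S f" "C_on k S g"
  shows "C_on k S (\<lambda>z. f z + g z)"
  using assms(2,3)
proof (induction k arbitrary: f g)
  case 0 then show ?case by (auto intro: continuous_intros)
next
  case (Suc k)
  have "C_on k S (pd_t (\<lambda>z. f z + g z)) \<longleftrightarrow> C_on k S (\<lambda>z. pd_t f z + pd_t g z)"
    "C_on k S (pd_x (\<lambda>z. f z + g z)) \<longleftrightarrow> C_on k S (\<lambda>z. pd_x f z + pd_x g z)"
    using Suc.prems by (auto intro!: C_on_cong assms(1) simp: pd_add)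
  then show ?case using Suc by auto
qed

lemma C_on_mult:
  assumes "open S" "C_on k S f" "C_on k S g"
  shows "C_on k S (\<lambda>z. f z * g z)"
  using assms(2,3)
proof (induction k arbitrary: f g)
  case 0 then show ?case by (auto intro: continuous_intros)
next
  case (Suc k)
  have "C_on k S (pd_t (\<lambda>z. f z * g z)) \<longleftrightarrow> C_on k S (\<lambda>z. pd_t f z * g z + f z * pd_t g z)"
    "C_on k S (pd_x (\<lambda>z. f z * g z)) \<longleftrightarrow> C_on k S (\<lambda>z. pd_x f z * g z + f z * pd_x g z)"
    using Suc.prems by (auto intro!: C_on_cong assms(1) simp: pd_mult)
  moreover have "C_on k S f" "C_on k S g" using Suc.prems by (auto intro: C_on_Suc_imp)
  ultimately show ?case using Suc by (auto intro!: C_on_add assms(1))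
qed

text \<open>Bootstrapping in \<open>k\<close>: the derivative of the inverse involves only the
  inverse itself and one derivative of \<open>f\<close>, both already of the lower class.\<close>

lemma C_on_inverse:
  assumes "open S" "C_on k S f" "\<And>z. z \<in> S \<Longrightarrow> f z \<noteq> 0"
  shows "C_on k S (\<lambda>z. inverse (f z))"
  using assms(2)
proof (induction k)
  case 0 then show ?case using assms(3) by (auto intro!: continuous_on_inverse)
next
  case (Suc k)
  have e: "C_on k S (pd_t (\<lambda>z. inverse (f z))) \<longleftrightarrow>
      C_on k S (\<lambda>z. - 1 * (pd_t f z * (inverse (f z) * inverse (f z))))"
    "C_on k S (pd_x (\<lambda>z. inverse (f z))) \<longleftrightarrow>
      C_on k S (\<lambda>z. - 1 * (pd_x f z * (inverse (f z) * inverse (f z))))"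
    using Suc.prems assms(3) by (auto intro!: C_on_cong assms(1) simp: pd_inverse)
  have k: "C_on k S (\<lambda>z. inverse (f z))" using Suc.IH C_on_Suc_imp[OF Suc.prems] .
  then have "C_on k S (\<lambda>z. - 1 * (pd_t f z * (inverse (f z) * inverse (f z))))"
    "C_on k S (\<lambda>z. - 1 * (pd_x f z * (inverse (f z) * inverse (f z))))"
    using Suc.prems by (intro C_on_mult[OF assms(1)] C_on_const; simp)+
  then show ?case
    using e Suc.prems assms(3) by (auto intro!: differentiable_inverse)
qed

lemma smooth_on_cong:
  "open S \<Longrightarrow> (\<And>z. z \<in> S \<Longrightarrow> f z = g z) \<Longrightarrow> smooth_on S f \<longleftrightarrow> smooth_on S g"
  unfolding smooth_on_def using C_on_cong[of S f g] by blast

lemma smooth_on_subset: "smooth_on S f \<Longrightarrow> T \<subseteq> S \<Longrightarrow> smooth_on T f"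
  unfolding smooth_on_def using C_on_subset by blast

lemma smooth_on_local:
  "(\<And>z. z \<in> S \<Longrightarrow> \<exists>U. open U \<and> z \<in> U \<and> smooth_on U f) \<Longrightarrow> smooth_on S f"
  unfolding smooth_on_def by (meson C_on_local)

lemma smooth_on_const: "smooth_on S (\<lambda>z. c)"
  by (simp add: smooth_on_def C_on_const)

lemma smooth_on_add:
  "open S \<Longrightarrow> smooth_on S f \<Longrightarrow> smooth_on S g \<Longrightarrow> smooth_on S (\<lambda>z. f z + g z)"
  by (simp add: smooth_on_def C_on_add)

lemma smooth_on_mult:
  "open S \<Longrightarrow> smooth_on S f \<Longrightarrow> smooth_on S g \<Longrightarrow> smooth_on S (\<lambda>z. f z * g z)"
  by (simp add: smooth_on_def C_on_mult)

lemma smooth_on_divide: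
  "open S \<Longrightarrow> smooth_on S f \<Longrightarrow> smooth_on S g \<Longrightarrow> (\<And>z. z \<in> S \<Longrightarrow> g z \<noteq> 0) \<Longrightarrow>
   smooth_on S (\<lambda>z. f z / g z)"
  unfolding divide_inverse smooth_on_def by (simp add: C_on_mult C_on_inverse)

lemma smooth_on_sum:
  "open S \<Longrightarrow> (\<And>i. i \<in> I \<Longrightarrow> smooth_on S (f i)) \<Longrightarrow> smooth_on S (\<lambda>z. \<Sum>i\<in>I. f i z)"
  by (induction I rule: infinite_finite_induct) (auto simp: smooth_on_const smooth_on_add)

lemma smooth_on_pd:
  assumes "smooth_on S f"
  shows "smooth_on S (pd_t f)" "smooth_on S (pd_x f)"
  using assms unfolding smooth_on_def by (metis C_on.simps(2))+

lemma smooth_on_differentiable: "smooth_on S f \<Longrightarrow> z \<in> S \<Longrightarrow> f differentiable (at z)"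
  unfolding smooth_on_def by (metis C_on.simps(2))

lemma smooth_on_continuous: "smooth_on S f \<Longrightarrow> continuous_on S f"
  unfolding smooth_on_def using C_on_imp_continuous by blast


subsection \<open>Smooth functions of one variable\<close>

text \<open>One-variable smoothness is read off a function of the plane that is constant in time, so
  that the closure properties are inherited from \<open>smooth_on\<close>.\<close>

definition smooth1 :: "(real \<Rightarrow> real) \<Rightarrow> bool" where
  "smooth1 f \<longleftrightarrow> smooth_on UNIV (\<lambda>z. f (snd z))"

lemma smooth1_DERIV: "smooth1 f \<Longrightarrow> (f has_real_derivative deriv f x) (at x)"
  using pd_derivs(2)[of "\<lambda>z. f (snd z)" "(0, x)"] smooth_on_differentiable[of UNIV "\<lambda>z. f (snd z)" "(0, x)"]
  by (simp add: smooth1_def pd_x_def)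

lemma smooth1_deriv: "smooth1 f \<Longrightarrow> smooth1 (deriv f)"
  unfolding smooth1_def using smooth_on_pd(2)[of UNIV "\<lambda>z. f (snd z)"]
  by (simp add: pd_x_def[abs_def])

lemma C_on_snd_I:
  assumes "\<And>x. (f has_real_derivative f' x) (at x)" "C_on k UNIV (\<lambda>z. f' (snd z))"
  shows "C_on (Suc k) UNIV (\<lambda>z. f (snd z))"
proof -
  have "(f \<circ> snd) differentiable at z" for z :: "real \<times> real"
    using assms(1)[of "snd z"]
    by (intro differentiable_chain_at)
       (auto simp: real_differentiable_def intro: bounded_linear_imp_differentiable bounded_linear_snd)
  moreover have "deriv f = f'" using assms(1) DERIV_imp_deriv by blast
  ultimately show ?thesis
    using assms(2) by (auto simp: pd_t_def[abs_def] pd_x_def[abs_def] C_on_const o_def)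
qed

lemma C_on_fst_I:
  assumes "\<And>x. (f has_real_derivative f' x) (at x)" "C_on k UNIV (\<lambda>z. f' (fst z))"
  shows "C_on (Suc k) UNIV (\<lambda>z. f (fst z))"
proof -
  have "(f \<circ> fst) differentiable at z" for z :: "real \<times> real"
    using assms(1)[of "fst z"]
    by (intro differentiable_chain_at)
       (auto simp: real_differentiable_def intro: bounded_linear_imp_differentiable bounded_linear_fst)
  moreover have "deriv f = f'" using assms(1) DERIV_imp_deriv by blast
  ultimately show ?thesis
    using assms(2) by (auto simp: pd_t_def[abs_def] pd_x_def[abs_def] C_on_const o_def)
qed

lemma smooth1_I:
  assumes "\<And>x. (f has_real_derivative f' x) (at x)" "smooth1 f'"
  shows "smooth1 f"
  unfolding smooth1_def smooth_on_def
proof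
  fix k show "C_on k UNIV (\<lambda>z. f (snd z))"
    using assms(2) unfolding smooth1_def smooth_on_def
    by (blast intro: C_on_Suc_imp[OF C_on_snd_I[OF assms(1)]])
qed

text \<open>A class of functions closed under differentiation consists of smooth functions; no
  formula for the higher derivatives is needed. It serves for linear combinations of the
  \<open>exp_inv\<close> and for affine substitutions.\<close>

lemma smooth1_coinduct:
  assumes "P f" and "\<And>f. P f \<Longrightarrow> \<exists>f'. P f' \<and> (\<forall>x. (f has_real_derivative f' x) (at x))"
  shows "smooth1 f"
proof -
  have "C_on k UNIV (\<lambda>z. f (snd z))" if "P f" for k f
    using that
  proof (induction k arbitrary: f)
    case 0
    then obtain f' where "\<And>x. (f has_real_derivative f' x) (at x)" using assms(2) by blast
    then have "continuous_on UNIV f"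
      using DERIV_isCont continuous_at_imp_continuous_on by blast
    then show ?case by (auto intro!: continuous_on_compose2[of UNIV f] continuous_intros)
  next
    case (Suc k)
    then show ?case using assms(2) by (metis C_on_snd_I)
  qed
  then show ?thesis using assms(1) by (simp add: smooth1_def smooth_on_def)
qed

lemma smooth1_fst: "smooth1 f \<Longrightarrow> smooth_on UNIV (\<lambda>z. f (fst z))"
proof -
  assume f: "smooth1 f"
  have "C_on k UNIV (\<lambda>z. g (fst z))" if "smooth1 g" for k g
    using that
  proof (induction k arbitrary: g)
    case 0
    then have "continuous_on UNIV g"
      using DERIV_isCont continuous_at_imp_continuous_on smooth1_DERIV by blast
    then show ?case by (auto intro!: continuous_on_compose2[of UNIV g] continuous_intros)
  next
    case (Suc k)
    then show ?case using smooth1_DERIV smooth1_deriv by (metis C_on_fst_I)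
  qed
  then show ?thesis using f by (simp add: smooth_on_def)
qed

lemma smooth1_snd: "smooth1 f \<Longrightarrow> smooth_on UNIV (\<lambda>z. f (snd z))"
  by (simp add: smooth1_def)

lemma smooth1_const: "smooth1 (\<lambda>x. c)"
  by (simp add: smooth1_def smooth_on_const)

lemma smooth1_add: "smooth1 f \<Longrightarrow> smooth1 g \<Longrightarrow> smooth1 (\<lambda>x. f x + g x)"
  by (simp add: smooth1_def smooth_on_add)

lemma smooth1_mult: "smooth1 f \<Longrightarrow> smooth1 g \<Longrightarrow> smooth1 (\<lambda>x. f x * g x)"
  by (simp add: smooth1_def smooth_on_mult)

lemma smooth1_divide:
  "smooth1 f \<Longrightarrow> smooth1 g \<Longrightarrow> (\<And>x. g x \<noteq> 0) \<Longrightarrow> smooth1 (\<lambda>x. f x / g x)"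
  by (simp add: smooth1_def smooth_on_divide)

lemma smooth1_sum: "(\<And>i. i \<in> I \<Longrightarrow> smooth1 (f i)) \<Longrightarrow> smooth1 (\<lambda>x. \<Sum>i\<in>I. f i x)"
  by (simp add: smooth1_def smooth_on_sum)

lemma smooth1_ident: "smooth1 (\<lambda>x. x)"
  by (rule smooth1_I[where f' = "\<lambda>x. 1"]) (auto simp: smooth1_const)

lemma smooth1_affine: "smooth1 f \<Longrightarrow> smooth1 (\<lambda>x. f (c * x + d))"
proof (rule smooth1_coinduct[where P = "\<lambda>f. \<exists>g e. smooth1 g \<and> f = (\<lambda>x. e * g (c * x + d))"])
  assume "smooth1 f"
  then show "\<exists>g e. smooth1 g \<and> (\<lambda>x. f (c * x + d)) = (\<lambda>x. e * g (c * x + d))"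
    by (intro exI[of _ f] exI[of _ 1]) auto
next
  fix f :: "real \<Rightarrow> real"
  assume "\<exists>g e. smooth1 g \<and> f = (\<lambda>x. e * g (c * x + d))"
  then obtain g e where g: "smooth1 g" "f = (\<lambda>x. e * g (c * x + d))" by blast
  have "((\<lambda>x. g (c * x + d)) has_real_derivative deriv g (c * x + d) * c) (at x)" for x
    by (rule DERIV_chain2[OF smooth1_DERIV[OF g(1)]]) (auto intro!: derivative_eq_intros)
  then have "(f has_real_derivative (e * c) * deriv g (c * x + d)) (at x)" for x
    unfolding g(2) by (auto intro!: derivative_eq_intros)
  then show "\<exists>f'. (\<exists>g e. smooth1 g \<and> f' = (\<lambda>x. e * g (c * x + d))) \<and> (\<forall>x. (f has_real_derivative f' x) (at x))"
    using smooth1_deriv[OF g(1)] by blast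
qed

lemma smooth1_isCont: "smooth1 f \<Longrightarrow> isCont f x"
  using DERIV_isCont smooth1_DERIV by blast

lemma smooth1_continuous: "smooth1 f \<Longrightarrow> continuous_on S f"
  by (simp add: continuous_at_imp_continuous_on smooth1_isCont)

lemma smooth1_bounded:
  assumes "smooth1 f" "compact K" "\<And>x. x \<notin> K \<Longrightarrow> f x = 0"
  shows "\<exists>M\<ge>0. \<forall>x. \<bar>f x\<bar> \<le> M"
proof -
  have "bounded (f ` K)"
    using assms by (intro compact_imp_bounded compact_continuous_image smooth1_continuous)
  then obtain M where "\<forall>x\<in>K. \<bar>f x\<bar> \<le> M" by (auto simp: bounded_real)
  then have "\<bar>f x\<bar> \<le> max M 0" for x using assms(3)[of x] by (cases "x \<in> K") auto
  then show ?thesis by (intro exI[of _ "max M 0"]) auto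
qed

lemma deriv_zero_outside:
  assumes "closed K" "\<And>x. x \<notin> K \<Longrightarrow> f x = 0" "x \<notin> K"
  shows "deriv f x = 0"
proof -
  have "\<forall>\<^sub>F y in nhds x. f y = (\<lambda>_. 0) y"
    using eventually_nhds_in_open[of "- K" x] assms by (force elim!: eventually_mono)
  then show ?thesis by (subst deriv_cong_ev[where g = "\<lambda>_. 0"]) auto
qed


section \<open>Cutoffs and lamination profiles on the unit interval\<close>

text \<open>The case \<open>k = 0\<close> is the standard flat function; the powers of 1/x are
  carried along because the span of the whole family is closed under differentiation.\<close>

definition exp_inv :: "nat \<Rightarrow> real \<Rightarrow> real" where
  "exp_inv k x = (if x > 0 then inverse x ^ k * exp (- inverse x) else 0)"

lemma exp_inv_tendsto_0: "(exp_inv k \<longlongrightarrow> 0) (at 0)"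
proof -
  have "((\<lambda>x::real. x ^ k / exp x) \<longlongrightarrow> 0) at_top"
    by (rule tendsto_power_div_exp_0)
  then have "((\<lambda>x::real. inverse x ^ k / exp (inverse x)) \<longlongrightarrow> 0) (at_right 0)"
    by (rule filterlim_compose[OF _ filterlim_inverse_at_top_right])
  moreover have "\<forall>\<^sub>F x in at_right 0. inverse x ^ k / exp (inverse x) = exp_inv k x"
    using eventually_at_right_less[of "0::real"]
    by eventually_elim (simp add: exp_inv_def exp_minus divide_inverse)
  ultimately have r: "(exp_inv k \<longlongrightarrow> 0) (at_right 0)"
    by (rule Lim_transform_eventually)
  have "\<forall>\<^sub>F x in at_left (0::real). 0 = exp_inv k x"
    unfolding eventually_at_left_field by (intro exI[of _ "-1"]) (auto simp: exp_inv_def)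
  then have l: "(exp_inv k \<longlongrightarrow> 0) (at_left 0)"
    by (intro Lim_transform_eventually[OF tendsto_const])
  show ?thesis using l r filterlim_split_at by blast
qed

text \<open>At 0 the difference quotient of \<open>exp_inv k\<close> is
  \<open>exp_inv (Suc k)\<close>, which tends to 0, so the formula remains valid there.\<close>

lemma exp_inv_DERIV:
  "(exp_inv k has_real_derivative exp_inv (k + 2) x - real k * exp_inv (Suc k) x) (at x)"
proof -
  consider "x > 0" | "x < 0" | "x = 0" by linarith
  then show ?thesis
  proof cases
    case 1
    have "((\<lambda>x. inverse x ^ k * exp (- inverse x)) has_real_derivative
        exp_inv (k + 2) x - real k * exp_inv (Suc k) x) (at x)"
    proof (cases k)
      case 0
      show ?thesis unfolding 0 using 1
        by (auto intro!: derivative_eq_intros simp: exp_inv_def power2_eq_square)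
    next
      case (Suc m)
      have "((\<lambda>x. inverse x ^ Suc m * exp (- inverse x)) has_real_derivative
          (1 + real m) * (- (inverse x * 1 * inverse x) * inverse x ^ m) * exp (- inverse x) +
          exp (- inverse x) * (inverse x * 1 * inverse x) * inverse x ^ Suc m) (at x)"
        using 1 by (intro DERIV_mult DERIV_power_Suc) (auto intro!: derivative_eq_intros)
      then show ?thesis unfolding Suc using 1
        by (simp add: exp_inv_def algebra_simps)
    qed
    then show ?thesis
      by (rule has_field_derivative_transform_within_open[where S = "{0<..}"])
         (use 1 in \<open>auto simp: exp_inv_def\<close>)
  next
    case 2
    have "((\<lambda>_. 0) has_real_derivative 0) (at x)" by simp
    then have "(exp_inv k has_real_derivative 0) (at x)"
      by (rule has_field_derivative_transform_within_open[where S = "{..<0}"])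
         (use 2 in \<open>auto simp: exp_inv_def\<close>)
    then show ?thesis using 2 by (simp add: exp_inv_def)
  next
    case 3
    have "\<forall>\<^sub>F h in at 0. exp_inv (Suc k) h = (exp_inv k (0 + h) - exp_inv k 0) / h"
      by (auto simp: exp_inv_def divide_inverse intro!: always_eventually)
    then have "((\<lambda>h. (exp_inv k (0 + h) - exp_inv k 0) / h) \<longlongrightarrow> 0) (at 0)"
      by (rule Lim_transform_eventually[OF exp_inv_tendsto_0])
    then have "(exp_inv k has_real_derivative 0) (at 0)" by (simp add: DERIV_def)
    then show ?thesis using 3 by (simp add: exp_inv_def)
  qed
qed

lemma smooth1_exp_inv: "smooth1 (exp_inv k)"
proof (rule smooth1_coinduct[where P = "\<lambda>f. \<exists>N c. f = (\<lambda>x. \<Sum>i<N. c i * exp_inv i x)"])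
  show "\<exists>N c. exp_inv k = (\<lambda>x. \<Sum>i<N. c i * exp_inv i x)"
    by (intro exI[of _ "Suc k"] exI[of _ "\<lambda>i. if i = k then 1 else 0"])
       (auto simp: if_distrib[of "\<lambda>c. c * _"] cong: if_cong)
next
  fix f :: "real \<Rightarrow> real"
  assume "\<exists>N c. f = (\<lambda>x. \<Sum>i<N. c i * exp_inv i x)"
  then obtain N c where f: "f = (\<lambda>x. \<Sum>i<N. c i * exp_inv i x)" by blast
  have "(f has_real_derivative (\<Sum>i<N. c i * (exp_inv (i + 2) x - real i * exp_inv (Suc i) x))) (at x)" for x
    unfolding f by (rule DERIV_sum) (intro DERIV_cmult exp_inv_DERIV)
  moreover have "\<exists>M d. (\<lambda>x. \<Sum>i<N. c i * (exp_inv (i + 2) x - real i * exp_inv (Suc i) x)) =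
      (\<lambda>x. \<Sum>i<M. d i * exp_inv i x)"
  proof (induction N)
    case 0 show ?case by (intro exI[of _ 0]) auto
  next
    case (Suc N)
    then obtain M d where
      e: "(\<lambda>x. \<Sum>i<N. c i * (exp_inv (i + 2) x - real i * exp_inv (Suc i) x)) = (\<lambda>x. \<Sum>i<M. d i * exp_inv i x)"
      by blast
    \<comment> \<open>Large enough to contain the old indices and the shifted ones
      \<open>N + 1\<close> and \<open>N + 2\<close>.\<close>
    let ?K = "M + N + 3"
    let ?d = "\<lambda>i. (if i < M then d i else 0) + (if i = N + 2 then c N else 0) -
        (if i = Suc N then c N * real N else 0)"
    have "(\<Sum>i<?K. ?d i * exp_inv i x) =
        (\<Sum>i<M. d i * exp_inv i x) + c N * exp_inv (N + 2) x - c N * real N * exp_inv (Suc N) x" for x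
    proof -
      have "(\<Sum>i<?K. (if i < M then d i else 0) * exp_inv i x) = (\<Sum>i<M. d i * exp_inv i x)"
        by (rule sum.mono_neutral_cong_right) auto
      moreover have "(\<Sum>i<?K. (if i = m then w else 0) * exp_inv i x) = w * exp_inv m x" if "m < ?K" for m w
        using that by (simp add: if_distrib[of "\<lambda>c. c * _"] cong: if_cong)
      ultimately show ?thesis
        by (simp add: algebra_simps sum.distrib sum_subtractf)
    qed
    then show ?case
      using fun_cong[OF e]
      by (intro exI[of _ ?K] exI[of _ ?d]) (simp add: algebra_simps fun_eq_iff)
  qed
  ultimately show "\<exists>f'. (\<exists>N c. f' = (\<lambda>x. \<Sum>i<N. c i * exp_inv i x)) \<and> (\<forall>x. (f has_real_derivative f' x) (at x))"
    by blast
qed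

definition smooth_step :: "real \<Rightarrow> real" where
  "smooth_step x = exp_inv 0 x / (exp_inv 0 x + exp_inv 0 (1 - x))"

text \<open>The denominator never vanishes, since x or 1 - x is positive.\<close>

lemma smooth1_smooth_step: "smooth1 smooth_step"
proof -
  have "smooth1 (\<lambda>x. exp_inv 0 x / (exp_inv 0 x + exp_inv 0 ((-1) * x + 1)))"
  proof (intro smooth1_divide smooth1_add smooth1_exp_inv smooth1_affine)
    show "exp_inv 0 x + exp_inv 0 ((-1) * x + 1) \<noteq> 0" for x
      using add_pos_pos[of "exp (- inverse x)" "exp (- inverse (1 - x))"] by (auto simp: exp_inv_def)
  qed
  then show ?thesis by (simp add: smooth_step_def[abs_def] algebra_simps)
qed

lemma smooth_step_simps:
  "x \<le> 0 \<Longrightarrow> smooth_step x = 0" "1 \<le> x \<Longrightarrow> smooth_step x = 1"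
  by (auto simp: smooth_step_def exp_inv_def)

lemma smooth_step_bounds: "0 \<le> smooth_step x" "smooth_step x \<le> 1"
proof -
  have p: "0 \<le> exp_inv 0 x" "0 \<le> exp_inv 0 (1 - x)" by (auto simp: exp_inv_def)
  show "0 \<le> smooth_step x" unfolding smooth_step_def using p by simp
  show "smooth_step x \<le> 1" unfolding smooth_step_def using p
    by (auto simp: divide_le_eq)
qed

text \<open>The product of a rising and a falling \<open>smooth_step\<close>. The reflection
  symmetry is what makes a first moment vanish in \<open>lamination_profile\<close>.\<close>

lemma smooth1_cutoff:
  assumes "a < b" "b \<le> c" "c < d"
  shows "\<exists>f. smooth1 f \<and> (\<forall>x. 0 \<le> f x \<and> f x \<le> 1) \<and> (\<forall>x. x \<notin> {a<..<d} \<longrightarrow> f x = 0) \<and>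
    (\<forall>x\<in>{b..c}. f x = 1) \<and> (b - a = d - c \<longrightarrow> (\<forall>x. f (a + d - x) = f x))"
proof -
  define f where "f x = smooth_step ((x - a) / (b - a)) * smooth_step ((d - x) / (d - c))" for x
  have "f = (\<lambda>x. smooth_step (inverse (b - a) * x + (- a / (b - a))) *
      smooth_step ((- inverse (d - c)) * x + d / (d - c)))"
    by (rule ext) (simp add: f_def divide_inverse algebra_simps)
  then have "smooth1 f"
    by (simp only:) (intro smooth1_mult smooth1_affine smooth1_smooth_step)
  moreover have "0 \<le> f x \<and> f x \<le> 1" for x
    unfolding f_def by (simp add: smooth_step_bounds mult_le_one)
  moreover have "f x = 0" if "x \<notin> {a<..<d}" for x
  proof (cases "x \<le> a")
    case True
    then have "(x - a) / (b - a) \<le> 0" using assms by (simp add: divide_le_0_iff)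
    then show ?thesis by (simp add: f_def smooth_step_simps)
  next
    case False
    then have "(d - x) / (d - c) \<le> 0" using assms that by (simp add: divide_le_0_iff)
    then show ?thesis by (simp add: f_def smooth_step_simps)
  qed
  moreover have "f x = 1" if "x \<in> {b..c}" for x
    using that assms by (simp add: f_def smooth_step_simps le_divide_eq)
  moreover have "f (a + d - x) = f x" if "b - a = d - c" for x
    unfolding f_def that by (simp add: algebra_simps)
  ultimately show ?thesis by (intro exI[of _ f]) auto
qed

lemma antiderivative_real:
  assumes "\<And>x. isCont f x"
  shows "\<exists>F. F c = 0 \<and> (\<forall>x. (F has_real_derivative f x) (at x))"
proof -
  obtain G where G: "\<And>x. (G has_vector_derivative f x) (at x)"
    using einterval_antiderivative[of "-\<infinity>" "\<infinity>" f] assms by auto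
  show ?thesis
    using G by (intro exI[of _ "\<lambda>x. G x - G c"])
      (auto simp: has_real_derivative_iff_has_vector_derivative intro!: derivative_eq_intros)
qed

lemma DERIV_zero_eq:
  fixes f :: "real \<Rightarrow> real"
  assumes "\<And>x. (f has_real_derivative f' x) (at x)" "\<And>x. x \<in> {a..b} \<Longrightarrow> f' x = 0" "a \<le> b"
  shows "f a = f b"
proof (cases "a = b")
  case False
  then have "a < b" using assms(3) by simp
  from MVT2[OF this, of f f'] obtain z where "a < z" "z < b" "f b - f a = (b - a) * f' z"
    using assms(1) by blast
  then show ?thesis using assms(2)[of z] by simp
qed simp

text \<open>The second derivative has mean zero, so a plateau of height 1 on a fraction \<theta>
  forces values of about -\<theta>/(1 - \<theta>) elsewhere. The bound -1/(1 - \<theta>) is lower by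
  exactly 1, and this room pays for the smoothing.\<close>

lemma lamination_profile:
  fixes \<theta> :: real
  assumes "0 < \<theta>" "\<theta> < 1"
  shows "\<exists>H. smooth1 H \<and>
    (\<forall>x. x \<notin> {0<..<1} \<longrightarrow> H x = 0 \<and> deriv H x = 0 \<and> deriv (deriv H) x = 0) \<and>
    (\<forall>x. - (1 / (1 - \<theta>)) \<le> deriv (deriv H) x \<and> deriv (deriv H) x \<le> 1) \<and>
    (\<forall>x\<in>{(1 - \<theta>) / 2..(1 + \<theta>) / 2}. deriv (deriv H) x = 1)"
proof -
  define s where "s = (1 - \<theta>) / 2"
  \<comment> \<open>The smoothing width satisfies \<open>2 * \<eta> = s * s\<close>; this quadratic
    smallness keeps \<open>c\<close> below \<open>1 / (1 - \<theta>)\<close>.\<close>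
  define \<eta> where "\<eta> = (1 - \<theta>)\<^sup>2 / 8"
  have s: "0 < s" "s < 1/2" "\<theta> = 1 - 2 * s" using assms by (auto simp: s_def field_simps)
  have \<eta>: "\<eta> = s * s / 2" by (simp add: \<eta>_def s(3) power2_eq_square)
  have \<eta>0: "0 < \<eta>" using s by (simp add: \<eta>)
  have \<eta>s: "3 * \<eta> < s" using s mult_strict_left_mono[of s "1/2" s] by (simp add: \<eta>)
  obtain B where B: "smooth1 B" "\<And>x. 0 \<le> B x" "\<And>x. B x \<le> 1" "\<And>x. x \<notin> {s - \<eta><..<1 - s + \<eta>} \<Longrightarrow> B x = 0"
    "\<And>x. x \<in> {s..1 - s} \<Longrightarrow> B x = 1" "\<And>x. B (1 - x) = B x"
    using smooth1_cutoff[of "s - \<eta>" s "1 - s" "1 - s + \<eta>"] s \<eta>0 by auto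
  obtain R where R: "smooth1 R" "\<And>x. 0 \<le> R x" "\<And>x. R x \<le> 1" "\<And>x. x \<notin> {\<eta><..<1 - \<eta>} \<Longrightarrow> R x = 0"
    "\<And>x. x \<in> {2 * \<eta>..1 - 2 * \<eta>} \<Longrightarrow> R x = 1" "\<And>x. R (1 - x) = R x"
    using smooth1_cutoff[of \<eta> "2 * \<eta>" "1 - 2 * \<eta>" "1 - \<eta>"] s \<eta>0 \<eta>s by auto
  obtain IB where IB: "IB 0 = 0" "\<And>x. (IB has_real_derivative B x) (at x)"
    using antiderivative_real[of B 0] smooth1_isCont[OF B(1)] by blast
  obtain IR where IR: "IR 0 = 0" "\<And>x. (IR has_real_derivative R x) (at x)"
    using antiderivative_real[of R 0] smooth1_isCont[OF R(1)] by blast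
  have mono: "f a \<le> f b" if "\<And>x. (f has_real_derivative f' x) (at x)" "\<And>x. 0 \<le> f' x" "a \<le> b"
    for f f' :: "real \<Rightarrow> real" and a b
    using DERIV_nonneg_imp_nondecreasing[of a b f] that by blast
  have b0: "0 \<le> IB 1" using mono[OF IB(2) B(2), of 0 1] IB(1) by simp
  have b1: "IB 1 \<le> \<theta> + 2 * \<eta>"
  proof -
    have "IB 0 = IB (s - \<eta>)" using s \<eta>s \<eta>0
      by (intro DERIV_zero_eq[OF IB(2)] B(4)) auto
    moreover have "IB (1 - s + \<eta>) = IB 1" using s \<eta>s \<eta>0
      by (intro DERIV_zero_eq[OF IB(2)] B(4)) auto
    moreover have "(\<lambda>x. x - IB x) (s - \<eta>) \<le> (\<lambda>x. x - IB x) (1 - s + \<eta>)"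
      by (rule mono[where f' = "\<lambda>x. 1 - B x"])
         (use IB(2) B(3) s \<eta>0 in \<open>auto intro!: derivative_eq_intros\<close>)
    ultimately show ?thesis using IB(1) by (simp add: s(3))
  qed
  have r1: "1 - 4 * \<eta> \<le> IR 1"
  proof -
    have "IR 0 \<le> IR (2 * \<eta>)" "IR (1 - 2 * \<eta>) \<le> IR 1"
      using \<eta>0 s by (auto intro!: mono[OF IR(2) R(2)])
    moreover have "(\<lambda>x. x - IR x) (2 * \<eta>) = (\<lambda>x. x - IR x) (1 - 2 * \<eta>)"
      by (rule DERIV_zero_eq[where f' = "\<lambda>x. 1 - R x"])
         (use IR(2) R(5) s \<eta>s in \<open>auto intro!: derivative_eq_intros\<close>)
    ultimately show ?thesis using IR(1) by simp
  qed
  \<comment> \<open>The solution of \<open>(1 + c) * IB 1 = c * IR 1\<close>, which makes the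
    integral of \<open>P\<close> vanish.\<close>
  define c where "c = IB 1 / (IR 1 - IB 1)"
  have d: "0 < 2 * s - 6 * \<eta>" "2 * s - 6 * \<eta> \<le> IR 1 - IB 1" using b1 r1 \<eta>s by (auto simp: s(3))
  have c: "0 \<le> c" using b0 d by (simp add: c_def)
  have c1: "c \<le> 1 / (1 - \<theta>)"
  proof -
    have "c \<le> (\<theta> + 2 * \<eta>) / (2 * s - 6 * \<eta>)"
      unfolding c_def using b0 b1 d by (intro frac_le) auto
    also have "\<dots> \<le> 1 / (1 - \<theta>)"
    proof -
      have "4 * \<eta> * s \<le> 2 * \<eta>" using s \<eta>0 by simp
      then have "(1 - 2 * s + 2 * \<eta>) * (2 * s) \<le> 2 * s - 6 * \<eta>"
        using \<eta> by (simp add: algebra_simps)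
      then show ?thesis using d s by (simp add: divide_le_eq le_divide_eq)
    qed
    finally show ?thesis .
  qed
  \<comment> \<open>\<open>P\<close> has integral zero and is symmetric about \<open>1 / 2\<close>, so its first moment vanishes too and
    its second antiderivative is supported in the unit interval.\<close>
  define P where "P x = (1 + c) * B x - c * R x" for x
  define G where "G x = (1 + c) * IB x - c * IR x" for x
  have G: "(G has_real_derivative P x) (at x)" for x
    unfolding G_def P_def using IB(2) IR(2) by (auto intro!: derivative_eq_intros)
  have P0: "P x = 0" if "x \<notin> {0<..<1}" for x
    using B(4)[of x] R(4)[of x] that s \<eta>s \<eta>0 unfolding P_def by force
  have Psym: "P (1 - x) = P x" for x by (simp add: P_def B(6) R(6))
  have Ple: "P x \<le> 1 \<and> - c \<le> P x" for x
  proof (cases "x \<in> {2 * \<eta>..1 - 2 * \<eta>}")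
    case True
    have "(1 + c) * B x \<le> (1 + c) * 1" "0 \<le> (1 + c) * B x"
      using c B(2,3) by (auto intro!: mult_left_mono)
    then show ?thesis using R(5)[OF True] by (simp add: P_def)
  next
    case False
    then have "B x = 0" using \<eta>s by (intro B(4)) auto
    moreover have "c * R x \<le> c * 1" "0 \<le> c * R x"
      using c R(2)[of x] R(3)[of x] by (simp_all add: mult_left_le)
    ultimately show ?thesis by (simp add: P_def)
  qed
  have P1: "P x = 1" if "x \<in> {s..1 - s}" for x
    using that \<eta>s \<eta>0 by (simp add: P_def B(5) R(5) algebra_simps)
  have G01: "G 0 = 0" "G 1 = 0"
  proof -
    show "G 0 = 0" by (simp add: G_def IB(1) IR(1))
    have "c * (IR 1 - IB 1) = IB 1" using d by (simp add: c_def)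
    then show "G 1 = 0" by (simp add: G_def algebra_simps)
  qed
  have ext0: "f x = 0" if "\<And>x. (f has_real_derivative f' x) (at x)" "\<And>x. x \<notin> {0<..<1} \<Longrightarrow> f' x = 0"
    "f 0 = 0" "f 1 = 0" "x \<notin> {0<..<1}" for f f' :: "real \<Rightarrow> real" and x
  proof (cases "x \<le> 0")
    case True then show ?thesis using DERIV_zero_eq[OF that(1), where a = x and b = 0] that(2,3) by auto
  next
    case False then show ?thesis using DERIV_zero_eq[OF that(1), where a = 1 and b = x] that(2,4,5) by auto
  qed
  have const: "f x = f y" if "\<And>x. (f has_real_derivative 0) (at x)" for f :: "real \<Rightarrow> real" and x y
    using DERIV_isconst_all[of f x y] that by blast
  have refl: "((\<lambda>x. f (1 - x)) has_real_derivative - f' (1 - x)) (at x)"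
    if "\<And>x. (f has_real_derivative f' x) (at x)" for f f' :: "real \<Rightarrow> real" and x
  proof -
    have "((\<lambda>x. 1 - x) has_real_derivative - 1) (at x)" for x :: real
      by (auto intro!: derivative_eq_intros)
    from DERIV_chain2[OF that this] show ?thesis by simp
  qed
  have Gsym: "G (1 - x) = - G x" for x
  proof -
    have "(\<lambda>x. G (1 - x) + G x) x = (\<lambda>x. G (1 - x) + G x) 0"
      by (rule const) (use refl[OF G] G Psym in \<open>auto intro!: derivative_eq_intros\<close>)
    then show ?thesis using G01 by simp
  qed
  obtain H where H: "H 0 = 0" "\<And>x. (H has_real_derivative G x) (at x)"
    using antiderivative_real[of G 0] DERIV_isCont[OF G] by blast
  \<comment> \<open>The difference is constant because \<open>G\<close> is odd about 1/2, and at 1/2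
    it is trivially zero.\<close>
  have "(\<lambda>x. H (1 - x) - H x) 0 = (\<lambda>x. H (1 - x) - H x) (1/2)"
    by (rule const) (use refl[OF H(2)] H(2) Gsym in \<open>auto intro!: derivative_eq_intros\<close>)
  then have H1: "H 1 = 0" using H(1) by simp
  have G0: "G x = 0" if "x \<notin> {0<..<1}" for x using ext0[OF G P0 G01 that] .
  have H0: "H x = 0" if "x \<notin> {0<..<1}" for x using ext0[OF H(2) G0 H(1) H1 that] .
  have dd: "deriv H = G" "deriv G = P" using H(2) G DERIV_imp_deriv by blast+
  have "smooth1 (\<lambda>x. (1 + c) * B x + (- c) * R x)"
    by (intro smooth1_add smooth1_mult smooth1_const B(1) R(1))
  then have "smooth1 P" by (simp add: P_def[abs_def])
  then have "smooth1 H" using smooth1_I[OF G] smooth1_I[OF H(2)] by blast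
  moreover have "s = (1 - \<theta>) / 2" "1 - s = (1 + \<theta>) / 2" by (auto simp: s_def field_simps)
  ultimately show ?thesis
    using P0 G0 H0 P1 Ple c1 by (intro exI[of _ H]) (auto simp: dd intro: order_trans[OF _ conjunct2[OF Ple]])
qed

section \<open>Finite unions of cells\<close>

text \<open>Adjacent cells may share an endpoint; bisecting a cell produces such neighbours.\<close>

definition separated_by :: "real \<Rightarrow> real set \<Rightarrow> bool" where
  "separated_by l F \<longleftrightarrow> finite F \<and> 0 < l \<and> (\<forall>c\<in>F. \<forall>d\<in>F. c < d \<longrightarrow> c + l \<le> d)"

definition cells :: "real \<Rightarrow> real set \<Rightarrow> real set" where
  "cells l F = (\<Union>c\<in>F. {c..c + l})"

definition cellset :: "real set \<Rightarrow> bool" where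
  "cellset A \<longleftrightarrow> (\<exists>l F. separated_by l F \<and> A = cells l F)"

lemma cellset_compact: "cellset A \<Longrightarrow> compact A"
  by (auto simp: cellset_def cells_def separated_by_def intro!: compact_UN)

lemma cellset_Icc: "a < b \<Longrightarrow> cellset {a..b}"
  unfolding cellset_def
  by (intro exI[of _ "b - a"] exI[of _ "{a}"]) (auto simp: separated_by_def cells_def)

lemma measure_cells:
  assumes "separated_by l F"
  shows "measure lebesgue (cells l F) = real (card F) * l"
proof -
  have "negligible ({c..c + l} \<inter> {d..d + l})" if "c \<in> F" "d \<in> F" "c \<noteq> d" for c d
  proof (rule negligible_subset)
    show "{c..c + l} \<inter> {d..d + l} \<subseteq> {c, d}"
      using assms that unfolding separated_by_def by (cases "c < d") fastforce+
  qed simp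
  then have "measure lebesgue (\<Union>((\<lambda>c. {c..c + l}) ` F)) = (\<Sum>c\<in>F. measure lebesgue {c..c + l})"
    using assms by (intro measure_negligible_finite_Union_image) (auto simp: pairwise_def separated_by_def)
  then show ?thesis using assms by (simp add: cells_def separated_by_def)
qed

lemma cells_halve:
  assumes "separated_by l F"
  shows "separated_by (l / 2) (F \<union> (\<lambda>c. c + l / 2) ` F)"
    and "cells (l / 2) (F \<union> (\<lambda>c. c + l / 2) ` F) = cells l F"
proof -
  show "separated_by (l / 2) (F \<union> (\<lambda>c. c + l / 2) ` F)"
    using assms unfolding separated_by_def
  proof (intro conjI ballI impI)
    fix c d assume F: "finite F \<and> 0 < l \<and> (\<forall>c\<in>F. \<forall>d\<in>F. c < d \<longrightarrow> c + l \<le> d)"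
      and cd: "c \<in> F \<union> (\<lambda>c. c + l / 2) ` F" "d \<in> F \<union> (\<lambda>c. c + l / 2) ` F" "c < d"
    obtain c' i where c: "c' \<in> F" "c = c' + i" "i = 0 \<or> i = l/2" using cd(1) by force
    obtain d' j where d: "d' \<in> F" "d = d' + j" "j = 0 \<or> j = l/2" using cd(2) by force
    consider "c' = d'" | "c' + l \<le> d'" | "d' + l \<le> c'" using F c(1) d(1) by (meson linorder_less_linear)
    then show "c + l / 2 \<le> d" using c d cd(3) F by cases auto
  qed auto
  have "{c..c + l} = {c..c + l / 2} \<union> {c + l / 2..c + l / 2 + l / 2}" for c
    using assms by (auto simp: separated_by_def)
  then show "cells (l / 2) (F \<union> (\<lambda>c. c + l / 2) ` F) = cells l F"
    unfolding cells_def by auto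
qed

text \<open>Repeated bisection leaves the set unchanged while the mesh tends to 0, so the frequency
  of an oscillation on a given set can be chosen at will.\<close>

lemma cellset_fine:
  assumes "cellset A" "0 < \<delta>"
  shows "\<exists>l F. separated_by l F \<and> A = cells l F \<and> l \<le> \<delta>"
proof -
  obtain l F where lF: "separated_by l F" "A = cells l F" using assms(1) by (auto simp: cellset_def)
  have "\<exists>G. separated_by (l / 2 ^ n) G \<and> A = cells (l / 2 ^ n) G" for n
  proof (induction n)
    case 0 then show ?case using lF by auto
  next
    case (Suc n)
    then show ?case using cells_halve by (metis divide_divide_eq_left power_Suc2)
  qed
  moreover obtain n where "l / \<delta> < 2 ^ n" using real_arch_pow[of 2 "l / \<delta>"] by auto
  then have "l / 2 ^ n \<le> \<delta>" using assms(2) by (simp add: field_simps)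
  ultimately show ?thesis by blast
qed

text \<open>The last claim places a kept point in the unit coordinate of its cell, which is the form
  in which the plateaus of the unit profiles are stated.\<close>

lemma cells_middle:
  assumes "separated_by l F" "0 < \<theta>" "\<theta> < 1"
  defines "G \<equiv> (\<lambda>c. c + (1 - \<theta>) / 2 * l) ` F"
  shows "cellset (cells (\<theta> * l) G)" "cells (\<theta> * l) G \<subseteq> cells l F"
    and "measure lebesgue (cells (\<theta> * l) G) = \<theta> * measure lebesgue (cells l F)"
    and "x \<in> cells (\<theta> * l) G \<Longrightarrow> \<exists>c\<in>F. x \<in> {c..c + l} \<and> (x - c) / l \<in> {(1 - \<theta>) / 2..(1 + \<theta>) / 2}"
proof -
  have l: "0 < l" using assms(1) by (simp add: separated_by_def)
  have tl: "\<theta> * l \<le> l" using assms l by simp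
  have "c + \<theta> * l \<le> d" if "c + l \<le> d" for c d using that tl by simp
  then have sep: "separated_by (\<theta> * l) G"
    using assms(1,2) l unfolding separated_by_def G_def by (force simp: algebra_simps)
  then show "cellset (cells (\<theta> * l) G)" by (auto simp: cellset_def)
  have "card G = card F" unfolding G_def by (intro card_image) (auto simp: inj_on_def)
  then show "measure lebesgue (cells (\<theta> * l) G) = \<theta> * measure lebesgue (cells l F)"
    by (simp add: measure_cells[OF sep] measure_cells[OF assms(1)])
  have mid: "\<exists>c\<in>F. x \<in> {c..c + l} \<and> (x - c) / l \<in> {(1 - \<theta>) / 2..(1 + \<theta>) / 2}"
    if "x \<in> cells (\<theta> * l) G" for x
  proof -
    obtain c where c: "c \<in> F" "c + (1 - \<theta>) / 2 * l \<le> x" "x \<le> c + (1 - \<theta>) / 2 * l + \<theta> * l"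
      using \<open>x \<in> cells (\<theta> * l) G\<close> by (auto simp: cells_def G_def)
    have i: "(x - c) / l \<in> {(1 - \<theta>) / 2..(1 + \<theta>) / 2}"
      using c l by (auto simp: field_simps)
    have "(1 - \<theta>) / 2 \<ge> 0" "(1 + \<theta>) / 2 \<le> 1" using assms(2,3) by auto
    then have "0 \<le> (x - c) / l" "(x - c) / l \<le> 1" using i[unfolded atLeastAtMost_iff] by linarith+
    then have "x \<in> {c..c + l}" using l by (auto simp: field_simps zero_le_divide_iff)
    then show ?thesis using c(1) i by blast
  qed
  then show "x \<in> cells (\<theta> * l) G \<Longrightarrow> \<exists>c\<in>F. x \<in> {c..c + l} \<and> (x - c) / l \<in> {(1 - \<theta>) / 2..(1 + \<theta>) / 2}" .
  show "cells (\<theta> * l) G \<subseteq> cells l F" using mid by (force simp: cells_def)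
qed

text \<open>As \<open>f\<close> vanishes outside the open unit interval, at most one summand is
  nonzero, even at a shared endpoint. The third claim transfers every pointwise bound on
  \<open>f\<close> to the sum.\<close>

lemma sum_cells:
  fixes f :: "real \<Rightarrow> real"
  assumes "separated_by l F" "\<And>y. y \<notin> {0<..<1} \<Longrightarrow> f y = 0"
  shows "c \<in> F \<Longrightarrow> x \<in> {c..c + l} \<Longrightarrow> (\<Sum>d\<in>F. f ((x - d) / l)) = f ((x - c) / l)"
    and "x \<notin> cells l F \<Longrightarrow> (\<Sum>d\<in>F. f ((x - d) / l)) = 0"
    and "\<exists>y. (\<Sum>d\<in>F. f ((x - d) / l)) = f y"
proof -
  have l: "0 < l" and fin: "finite F" using assms(1) by (auto simp: separated_by_def)
  show one: "(\<Sum>d\<in>F. f ((x - d) / l)) = f ((x - c) / l)" if c: "c \<in> F" "x \<in> {c..c + l}" for c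
  proof -
    have "f ((x - d) / l) = 0" if "d \<in> F - {c}" for d
    proof -
      have "c + l \<le> d \<or> d + l \<le> c"
        using assms(1) that c unfolding separated_by_def by (metis DiffE insertI1 linorder_less_linear)
      then have "(x - d) / l \<notin> {0<..<1}" using c l by (auto simp: field_simps)
      then show ?thesis by (rule assms(2))
    qed
    then show ?thesis using fin c by (simp add: sum.remove)
  qed
  show zero: "(\<Sum>d\<in>F. f ((x - d) / l)) = 0" if "x \<notin> cells l F"
  proof (intro sum.neutral ballI assms(2))
    fix d assume "d \<in> F"
    then have "x \<notin> {d..d + l}" using that by (auto simp: cells_def)
    then show "(x - d) / l \<notin> {0<..<1}" using l by (auto simp: field_simps)
  qed
  show "\<exists>y. (\<Sum>d\<in>F. f ((x - d) / l)) = f y"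
  proof (cases "x \<in> cells l F")
    case True
    then obtain d where "d \<in> F" "x \<in> {d..d + l}" by (auto simp: cells_def)
    then show ?thesis using one by blast
  next
    case False
    then show ?thesis using zero assms(2)[of 0] by (intro exI[of _ 0]) simp
  qed
qed


lemma scaled_sum_DERIV:
  assumes "smooth1 f"
  shows "((\<lambda>x. \<Sum>d\<in>F. e * f ((x - d) / l)) has_real_derivative (\<Sum>d\<in>F. (e / l) * deriv f ((x - d) / l))) (at x)"
proof (intro DERIV_sum)
  fix d
  have "((\<lambda>x. f ((x - d) / l)) has_real_derivative deriv f ((x - d) / l) * (1 / l)) (at x)"
    by (intro DERIV_chain2[OF smooth1_DERIV[OF assms]] DERIV_cdivide) (auto intro!: derivative_eq_intros)
  then have "((\<lambda>x. e * f ((x - d) / l)) has_real_derivative e * (deriv f ((x - d) / l) * (1 / l))) (at x)"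
    by (rule DERIV_cmult)
  then show "((\<lambda>x. e * f ((x - d) / l)) has_real_derivative (e / l) * deriv f ((x - d) / l)) (at x)"
    by (simp add: mult.commute)
qed

lemma scaled_sum_smooth1:
  assumes "smooth1 f"
  shows "smooth1 (\<lambda>x. \<Sum>d\<in>F. e * f ((x - d) / l))"
proof (intro smooth1_sum smooth1_mult smooth1_const)
  fix d
  have "smooth1 (\<lambda>x. f (inverse l * x + (- d / l)))" by (rule smooth1_affine[OF assms])
  then show "smooth1 (\<lambda>x. f ((x - d) / l))" by (simp add: divide_inverse algebra_simps)
qed

text \<open>Copies \<open>l^2 * H ((x - d) / l)\<close> of the profile on cells of length
  \<open>l\<close>: the second derivative is invariant under this scaling, while the function and
  its first derivative are of order \<open>l^2\<close> and \<open>l\<close>. Fine cells make these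
  small at no cost for the second derivative.\<close>

lemma lamination_step:
  assumes "cellset A" "0 < \<theta>" "\<theta> < 1" "0 < \<epsilon>"
  shows "\<exists>h A'. smooth1 h \<and> cellset A' \<and> A' \<subseteq> A \<and> measure lebesgue A' = \<theta> * measure lebesgue A \<and>
    (\<forall>x. x \<notin> A \<longrightarrow> h x = 0) \<and> (\<forall>x. \<bar>h x\<bar> \<le> \<epsilon>) \<and> (\<forall>x. \<bar>deriv h x\<bar> \<le> \<epsilon>) \<and>
    (\<forall>x. - (1 / (1 - \<theta>)) \<le> deriv (deriv h) x \<and> deriv (deriv h) x \<le> 1) \<and>
    (\<forall>x\<in>A'. deriv (deriv h) x = 1)"
proof -
  obtain H where H: "smooth1 H"
    and H0: "\<And>x. x \<notin> {0<..<1} \<Longrightarrow> H x = 0" "\<And>x. x \<notin> {0<..<1} \<Longrightarrow> deriv H x = 0"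
      "\<And>x. x \<notin> {0<..<1} \<Longrightarrow> deriv (deriv H) x = 0"
    and Hb: "\<And>x. - (1 / (1 - \<theta>)) \<le> deriv (deriv H) x" "\<And>x. deriv (deriv H) x \<le> 1"
    and H1: "\<And>x. x \<in> {(1 - \<theta>) / 2..(1 + \<theta>) / 2} \<Longrightarrow> deriv (deriv H) x = 1"
    using lamination_profile[OF assms(2,3)] by blast
  obtain M0 where M0: "0 \<le> M0" "\<And>x. \<bar>H x\<bar> \<le> M0"
    using smooth1_bounded[OF H(1), of "{0..1}"] H0(1) by force
  obtain M1 where M1: "0 \<le> M1" "\<And>x. \<bar>deriv H x\<bar> \<le> M1"
    using smooth1_bounded[OF smooth1_deriv[OF H(1)], of "{0..1}"] H0(2) by force
  \<comment> \<open>For \<open>l\<close> up to this size \<open>l * M0\<close> and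
    \<open>l * M1\<close> are at most \<epsilon>, and \<open>l \<le> 1\<close> reduces
    \<open>l^2 * M0\<close> to the former.\<close>
  define \<delta> where "\<delta> = min 1 (\<epsilon> / (1 + M0 + M1))"
  have \<delta>: "0 < \<delta>" using assms(4) M0(1) M1(1) by (simp add: \<delta>_def)
  obtain l F where lF: "separated_by l F" "A = cells l F" "l \<le> \<delta>"
    using cellset_fine[OF assms(1) \<delta>] by blast
  have l: "0 < l" "l \<le> 1" using lF by (auto simp: separated_by_def \<delta>_def)
  have "l * (1 + M0 + M1) \<le> \<epsilon>"
    using lF(3) M0(1) M1(1) by (simp add: \<delta>_def pos_le_divide_eq)
  moreover have "l * M0 \<le> l * (1 + M0 + M1)" "l * M1 \<le> l * (1 + M0 + M1)"
    using l M0(1) M1(1) by (intro mult_left_mono; simp)+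
  moreover have "l\<^sup>2 * M0 \<le> l * M0" using l M0(1)
    by (intro mult_right_mono) (auto simp: power2_eq_square mult_le_one)
  ultimately have small: "l\<^sup>2 * M0 \<le> \<epsilon>" "l * M1 \<le> \<epsilon>" by linarith+
  define h where "h = (\<lambda>x. \<Sum>d\<in>F. l\<^sup>2 * H ((x - d) / l))"
  have "(h has_real_derivative (\<Sum>d\<in>F. l * deriv H ((x - d) / l))) (at x)" for x
    unfolding h_def using scaled_sum_DERIV[OF H(1), where e = "l\<^sup>2" and l = l and F = F and x = x] l
    by (simp add: power2_eq_square)
  then have d1: "deriv h = (\<lambda>x. \<Sum>d\<in>F. l * deriv H ((x - d) / l))"
    using DERIV_imp_deriv by blast
  have "(deriv h has_real_derivative (\<Sum>d\<in>F. deriv (deriv H) ((x - d) / l))) (at x)" for x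
    unfolding d1 using scaled_sum_DERIV[OF smooth1_deriv[OF H(1)], where e = l and l = l and F = F and x = x] l
    by simp
  then have d2: "deriv (deriv h) = (\<lambda>x. \<Sum>d\<in>F. deriv (deriv H) ((x - d) / l))"
    using DERIV_imp_deriv by blast
  define A' where "A' = cells (\<theta> * l) ((\<lambda>c. c + (1 - \<theta>) / 2 * l) ` F)"
  note mid = cells_middle[OF lF(1) assms(2,3), folded A'_def lF(2)]
  have hs: "h x = l\<^sup>2 * (\<Sum>d\<in>F. H ((x - d) / l))" "deriv h x = l * (\<Sum>d\<in>F. deriv H ((x - d) / l))" for x
    by (simp_all only: d1 sum_distrib_left) (simp add: h_def)
  note sums = sum_cells[OF lF(1)]
  have "smooth1 h" unfolding h_def by (rule scaled_sum_smooth1[OF H(1)])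
  moreover have "h x = 0" if "x \<notin> A" for x
    using that sums(2)[of H x] H0 by (simp add: hs lF(2))
  moreover have "\<bar>h x\<bar> \<le> \<epsilon>" for x
  proof -
    obtain y where "h x = l\<^sup>2 * H y" using sums(3)[of H x] H0 by (auto simp: hs)
    then have "\<bar>h x\<bar> \<le> l\<^sup>2 * M0" using M0(2) by (simp add: abs_mult mult_left_mono)
    then show ?thesis using small by simp
  qed
  moreover have "\<bar>deriv h x\<bar> \<le> \<epsilon>" for x
  proof -
    obtain y where "deriv h x = l * deriv H y" using sums(3)[of "deriv H" x] H0 by (auto simp: hs)
    then have "\<bar>deriv h x\<bar> \<le> l * M1" using M1(2) l by (simp add: abs_mult mult_left_mono)
    then show ?thesis using small by simp
  qed
  moreover have "- (1 / (1 - \<theta>)) \<le> deriv (deriv h) x \<and> deriv (deriv h) x \<le> 1" for x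
    using sums(3)[of "deriv (deriv H)" x] H0 Hb unfolding d2 by fastforce
  moreover have "deriv (deriv h) x = 1" if x: "x \<in> A'" for x
  proof -
    obtain c where "c \<in> F" "x \<in> {c..c + l}" "(x - c) / l \<in> {(1 - \<theta>) / 2..(1 + \<theta>) / 2}"
      using mid(4)[OF x] by blast
    then show ?thesis using sums(1)[of "deriv (deriv H)" c x] H0 H1 unfolding d2 by simp
  qed
  ultimately show ?thesis using mid(1-3) by blast
qed

text \<open>\<open>M\<close> depends on the cell length and on \<omega> and may be huge. It is
  returned explicitly so that the oscillation to be multiplied by this cutoff can afterwards be
  chosen small relative to it.\<close>

lemma cutoff_step:
  assumes "cellset A" "0 < \<omega>" "\<omega> < 1"
  shows "\<exists>\<rho> A' M. smooth1 \<rho> \<and> cellset A' \<and> A' \<subseteq> A \<and> measure lebesgue A' = \<omega> * measure lebesgue A \<and>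
    (\<forall>x. x \<notin> A \<longrightarrow> \<rho> x = 0) \<and> (\<forall>x. 0 \<le> \<rho> x \<and> \<rho> x \<le> 1) \<and>
    0 \<le> M \<and> (\<forall>x. \<bar>deriv \<rho> x\<bar> \<le> M) \<and> (\<forall>x. \<bar>deriv (deriv \<rho>) x\<bar> \<le> M) \<and>
    (\<forall>x\<in>A'. \<rho> x = 1 \<and> deriv \<rho> x = 0 \<and> deriv (deriv \<rho>) x = 0)"
proof -
  \<comment> \<open>The cutoff reaches 1 already at \<open>s / 2\<close>, so the kept part
    \<open>{s..1 - s}\<close> of a unit cell lies in an open set on which the cutoff is constant,
    and the derivatives vanish up to its endpoints.\<close>
  define s where "s = (1 - \<omega>) / 2"
  have s: "0 < s" "s < 1/2" using assms by (auto simp: s_def)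
  obtain f where f: "smooth1 f" "\<And>x. 0 \<le> f x" "\<And>x. f x \<le> 1"
    and f0: "\<And>x. x \<notin> {s/4<..<1 - s/4} \<Longrightarrow> f x = 0"
    and f1: "\<And>x. x \<in> {s/2..1 - s/2} \<Longrightarrow> f x = 1"
    using smooth1_cutoff[of "s/4" "s/2" "1 - s/2" "1 - s/4"] s by auto
  have f0': "x \<notin> {s/4..1 - s/4} \<Longrightarrow> f x = 0" for x using f0[of x] by force
  note df0 = deriv_zero_outside[where K = "{s/4..1 - s/4}" and f = f, OF _ f0', simplified]
  note ddf0 = deriv_zero_outside[where K = "{s/4..1 - s/4}" and f = "deriv f", OF _ df0, simplified]
  have F0: "f x = 0" "deriv f x = 0" "deriv (deriv f) x = 0" if "x \<notin> {0<..<1}" for x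
    using that s by (auto intro!: f0' df0 ddf0)
  have df1: "deriv f x = 0" if "x \<in> {s/2<..<1 - s/2}" for x
    using DERIV_imp_deriv[OF has_field_derivative_transform_within_open[of "\<lambda>_. 1" 0 x "{s/2<..<1 - s/2}" f]]
      that f1 by auto
  have ddf1: "deriv (deriv f) x = 0" if "x \<in> {s/2<..<1 - s/2}" for x
    using DERIV_imp_deriv[OF has_field_derivative_transform_within_open[of "\<lambda>_. 0" 0 x "{s/2<..<1 - s/2}" "deriv f"]]
      that df1 by auto
  have F1: "f x = 1" "deriv f x = 0" "deriv (deriv f) x = 0" if "x \<in> {(1 - \<omega>) / 2..(1 + \<omega>) / 2}" for x
  proof -
    have "x \<in> {s/2<..<1 - s/2}" using that s by (auto simp: s_def field_simps)
    then show "f x = 1" "deriv f x = 0" "deriv (deriv f) x = 0" using f1[of x] df1 ddf1 by auto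
  qed
  obtain M1 where M1: "0 \<le> M1" "\<And>x. \<bar>deriv f x\<bar> \<le> M1"
    using smooth1_bounded[OF smooth1_deriv[OF f(1)], of "{0..1}"] F0(2) by force
  obtain M2 where M2: "0 \<le> M2" "\<And>x. \<bar>deriv (deriv f) x\<bar> \<le> M2"
    using smooth1_bounded[OF smooth1_deriv[OF smooth1_deriv[OF f(1)]], of "{0..1}"] F0(3) by force
  obtain l F where lF: "separated_by l F" "A = cells l F"
    using assms(1) by (auto simp: cellset_def)
  have l: "0 < l" using lF by (auto simp: separated_by_def)
  define \<rho> where "\<rho> = (\<lambda>x. \<Sum>d\<in>F. 1 * f ((x - d) / l))"
  have d1: "deriv \<rho> = (\<lambda>x. \<Sum>d\<in>F. (1 / l) * deriv f ((x - d) / l))"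
    unfolding \<rho>_def using DERIV_imp_deriv[OF scaled_sum_DERIV[OF f(1)]] by blast
  have d2: "deriv (deriv \<rho>) = (\<lambda>x. \<Sum>d\<in>F. (1 / l / l) * deriv (deriv f) ((x - d) / l))"
    unfolding d1 using DERIV_imp_deriv[OF scaled_sum_DERIV[OF smooth1_deriv[OF f(1)]]] by blast
  define A' where "A' = cells (\<omega> * l) ((\<lambda>c. c + (1 - \<omega>) / 2 * l) ` F)"
  note mid = cells_middle[OF lF(1) assms(2,3), folded A'_def lF(2)]
  have cs0: "\<rho> x = (\<Sum>d\<in>F. f ((x - d) / l))" for x by (simp add: \<rho>_def)
  have cs: "\<rho> x = (\<Sum>d\<in>F. f ((x - d) / l))" "deriv \<rho> x = (1 / l) * (\<Sum>d\<in>F. deriv f ((x - d) / l))"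
    "deriv (deriv \<rho>) x = (1 / l / l) * (\<Sum>d\<in>F. deriv (deriv f) ((x - d) / l))" for x
    by (simp add: cs0, simp only: d1 sum_distrib_left, simp only: d2 sum_distrib_left)
  note sums = sum_cells[OF lF(1)]
  define M where "M = (1 / l) * M1 + (1 / l / l) * M2"
  have "smooth1 \<rho>" unfolding \<rho>_def by (rule scaled_sum_smooth1[OF f(1)])
  moreover have "0 \<le> M" using l M1 M2 by (simp add: M_def)
  moreover have "\<rho> x = 0" if "x \<notin> A" for x
    using that sums(2)[of f x] F0 by (simp add: cs lF(2))
  moreover have "0 \<le> \<rho> x \<and> \<rho> x \<le> 1" for x
    using sums(3)[of f x] F0 f(2,3) unfolding cs by fastforce
  moreover have "\<bar>deriv \<rho> x\<bar> \<le> M" for x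
  proof -
    obtain y where "deriv \<rho> x = (1 / l) * deriv f y" using sums(3)[of "deriv f" x] F0 by (auto simp: cs)
    then have "\<bar>deriv \<rho> x\<bar> = (1 / l) * \<bar>deriv f y\<bar>" using l by (simp add: abs_mult)
    also have "\<dots> \<le> (1 / l) * M1" using M1(2) l by (intro mult_left_mono) auto
    finally show ?thesis using l M2(1) by (auto simp: M_def intro: order_trans)
  qed
  moreover have "\<bar>deriv (deriv \<rho>) x\<bar> \<le> M" for x
  proof -
    obtain y where "deriv (deriv \<rho>) x = (1 / l / l) * deriv (deriv f) y"
      using sums(3)[of "deriv (deriv f)" x] F0 by (auto simp: cs)
    then have "\<bar>deriv (deriv \<rho>) x\<bar> = (1 / l / l) * \<bar>deriv (deriv f) y\<bar>" using l by (simp add: abs_mult)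
    also have "\<dots> \<le> (1 / l / l) * M2" using M2(2) l by (intro mult_left_mono) auto
    finally show ?thesis using l M1(1) by (auto simp: M_def intro: order_trans)
  qed
  moreover have "\<rho> x = 1 \<and> deriv \<rho> x = 0 \<and> deriv (deriv \<rho>) x = 0" if x: "x \<in> A'" for x
  proof -
    obtain c where c: "c \<in> F" "x \<in> {c..c + l}" and m: "(x - c) / l \<in> {(1 - \<omega>) / 2..(1 + \<omega>) / 2}"
      using mid(4)[OF x] by blast
    show ?thesis
      using sums(1)[of f c x] sums(1)[of "deriv f" c x] sums(1)[of "deriv (deriv f)" c x] F0 F1[OF m] c
      unfolding cs by auto
  qed
  ultimately show ?thesis using mid(1-3) by blast
qed


section \<open>The stages of the staircase\<close>

text \<open>The correction of a stage is \<open>h(x) \<rho>(t) + g(t) \<xi>(x)\<close>: an oscillation in \<open>x\<close> on \<open>A \<times> B\<close>, which raises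
  \<open>u\<^sub>x\<^sub>x\<close> by 1 on \<open>A1 \<times> B1\<close>, then one in \<open>t\<close> on \<open>A1 \<times> B1\<close>, which raises \<open>u\<^sub>t\<close> by 1 on \<open>A' \<times> B'\<close>.\<close>

definition stage ::
  "real \<Rightarrow> real \<Rightarrow> real \<Rightarrow> real set \<Rightarrow> real set \<Rightarrow> real set \<Rightarrow> real set \<Rightarrow> real set \<Rightarrow> real set \<Rightarrow>
   (real \<Rightarrow> real) \<Rightarrow> (real \<Rightarrow> real) \<Rightarrow> (real \<Rightarrow> real) \<Rightarrow> (real \<Rightarrow> real) \<Rightarrow> bool" where
  "stage \<mu> c \<epsilon> A B A1 B1 A' B' \<rho> h \<xi> g \<longleftrightarrow>
     smooth1 \<rho> \<and> smooth1 h \<and> smooth1 \<xi> \<and> smooth1 g \<and>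
     cellset A1 \<and> cellset B1 \<and> cellset A' \<and> cellset B' \<and>
     A' \<subseteq> A1 \<and> A1 \<subseteq> A \<and> B' \<subseteq> B1 \<and> B1 \<subseteq> B \<and>
     measure lebesgue A' = \<mu> * measure lebesgue A \<and> measure lebesgue B' = \<mu> * measure lebesgue B \<and>
     (\<forall>t. t \<notin> A \<longrightarrow> \<rho> t = 0) \<and> (\<forall>x. x \<notin> B \<longrightarrow> h x = 0) \<and>
     (\<forall>t. t \<notin> A1 \<longrightarrow> g t = 0) \<and> (\<forall>x. x \<notin> B1 \<longrightarrow> \<xi> x = 0) \<and>
     (\<forall>t. 0 \<le> \<rho> t \<and> \<rho> t \<le> 1) \<and> (\<forall>x. 0 \<le> \<xi> x \<and> \<xi> x \<le> 1) \<and>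
     (\<forall>x. - c \<le> deriv (deriv h) x \<and> deriv (deriv h) x \<le> 1) \<and>
     (\<forall>t. - c \<le> deriv g t \<and> deriv g t \<le> 1) \<and>
     (\<forall>t\<in>A1. \<rho> t = 1 \<and> deriv \<rho> t = 0) \<and> (\<forall>x\<in>B1. deriv (deriv h) x = 1) \<and>
     (\<forall>t\<in>A'. deriv g t = 1) \<and> (\<forall>x\<in>B'. \<xi> x = 1 \<and> deriv (deriv \<xi>) x = 0) \<and>
     (\<forall>x. \<bar>h x\<bar> \<le> \<epsilon>) \<and> (\<forall>x. \<bar>deriv h x\<bar> \<le> \<epsilon>) \<and> (\<forall>t. \<bar>g t\<bar> \<le> \<epsilon>) \<and>
     (\<forall>t x. \<bar>h x * deriv \<rho> t\<bar> \<le> \<epsilon>) \<and> (\<forall>t x. \<bar>g t * deriv \<xi> x\<bar> \<le> \<epsilon>) \<and>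
     (\<forall>t x. \<bar>g t * deriv (deriv \<xi>) x\<bar> \<le> \<epsilon>)"

text \<open>\<rho> is fixed before \<open>h\<close>, and \<xi> before \<open>k\<close>, so the
  oscillations can be scaled against the derivative bounds \<open>M\<close> and \<open>N\<close>.
  The equation is of first order in time, so the oscillation used there is \<open>deriv k\<close>,
  whose derivative has the lamination profile.\<close>

lemma stage_exists:
  assumes AB: "cellset A" "cellset B" and "0 < \<theta>" "\<theta> < 1" "0 < \<omega>" "\<omega> < 1" "0 < \<epsilon>"
  shows "\<exists>A1 B1 A' B' \<rho> h \<xi> g. stage (\<theta> * \<omega>) (1 / (1 - \<theta>)) \<epsilon> A B A1 B1 A' B' \<rho> h \<xi> g"
proof -
  have prod_small: "\<bar>f x * k y\<bar> \<le> \<epsilon>"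
    if "\<And>x. \<bar>f x\<bar> \<le> \<epsilon> / (1 + M)" "\<And>y. \<bar>k y\<bar> \<le> M" "0 \<le> M" for f k :: "real \<Rightarrow> real" and M x y
  proof -
    have "\<bar>f x * k y\<bar> \<le> \<epsilon> / (1 + M) * M"
      unfolding abs_mult using that \<open>0 < \<epsilon>\<close> by (intro mult_mono) auto
    also have "\<dots> \<le> \<epsilon>" using that(3) \<open>0 < \<epsilon>\<close> by (simp add: field_simps)
    finally show ?thesis .
  qed
  have small: "\<epsilon> / (1 + M) \<le> \<epsilon>" if "0 \<le> M" for M
    using that \<open>0 < \<epsilon>\<close> by (simp add: divide_le_eq)
  obtain \<rho> A1 M where \<rho>: "smooth1 \<rho>" "cellset A1" "A1 \<subseteq> A" "measure lebesgue A1 = \<omega> * measure lebesgue A"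
    "\<And>x. x \<notin> A \<Longrightarrow> \<rho> x = 0" "\<And>x. 0 \<le> \<rho> x \<and> \<rho> x \<le> 1" "0 \<le> M" "\<And>x. \<bar>deriv \<rho> x\<bar> \<le> M"
    "\<And>x. x \<in> A1 \<Longrightarrow> \<rho> x = 1 \<and> deriv \<rho> x = 0"
    using cutoff_step[OF AB(1) assms(5,6)] by blast
  have "0 < \<epsilon> / (1 + M)" using \<open>0 < \<epsilon>\<close> \<rho>(7) by simp
  from lamination_step[OF AB(2) assms(3,4) this]
  obtain h B1 where h: "smooth1 h" "cellset B1" "B1 \<subseteq> B" "measure lebesgue B1 = \<theta> * measure lebesgue B"
    "\<And>x. x \<notin> B \<Longrightarrow> h x = 0" "\<And>x. \<bar>h x\<bar> \<le> \<epsilon> / (1 + M)" "\<And>x. \<bar>deriv h x\<bar> \<le> \<epsilon> / (1 + M)"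
    "\<And>x. - (1 / (1 - \<theta>)) \<le> deriv (deriv h) x \<and> deriv (deriv h) x \<le> 1"
    "\<And>x. x \<in> B1 \<Longrightarrow> deriv (deriv h) x = 1"
    by metis
  obtain \<xi> B' N where \<xi>: "smooth1 \<xi>" "cellset B'" "B' \<subseteq> B1" "measure lebesgue B' = \<omega> * measure lebesgue B1"
    "\<And>x. x \<notin> B1 \<Longrightarrow> \<xi> x = 0" "\<And>x. 0 \<le> \<xi> x \<and> \<xi> x \<le> 1" "0 \<le> N"
    "\<And>x. \<bar>deriv \<xi> x\<bar> \<le> N" "\<And>x. \<bar>deriv (deriv \<xi>) x\<bar> \<le> N"
    "\<And>x. x \<in> B' \<Longrightarrow> \<xi> x = 1 \<and> deriv (deriv \<xi>) x = 0"
    using cutoff_step[OF h(2) assms(5,6)] by blast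
  have "0 < \<epsilon> / (1 + N)" using \<open>0 < \<epsilon>\<close> \<xi>(7) by simp
  from lamination_step[OF \<rho>(2) assms(3,4) this]
  obtain k A' where k: "smooth1 k" "cellset A'" "A' \<subseteq> A1" "measure lebesgue A' = \<theta> * measure lebesgue A1"
    "\<And>x. x \<notin> A1 \<Longrightarrow> k x = 0" "\<And>x. \<bar>deriv k x\<bar> \<le> \<epsilon> / (1 + N)"
    "\<And>x. - (1 / (1 - \<theta>)) \<le> deriv (deriv k) x \<and> deriv (deriv k) x \<le> 1"
    "\<And>x. x \<in> A' \<Longrightarrow> deriv (deriv k) x = 1"
    by metis
  have k0: "deriv k x = 0" if "x \<notin> A1" for x
    using deriv_zero_outside[OF compact_imp_closed[OF cellset_compact[OF \<rho>(2)]] k(5) that] .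
  have s: "\<bar>h x\<bar> \<le> \<epsilon>" "\<bar>deriv h x\<bar> \<le> \<epsilon>" "\<bar>deriv k x\<bar> \<le> \<epsilon>" for x
    using h(6,7)[of x] k(6)[of x] small[OF \<rho>(7)] small[OF \<xi>(7)] by linarith+
  have ps: "\<bar>h x * deriv \<rho> t\<bar> \<le> \<epsilon>" "\<bar>deriv k t * deriv \<xi> x\<bar> \<le> \<epsilon>"
    "\<bar>deriv k t * deriv (deriv \<xi>) x\<bar> \<le> \<epsilon>" for t x
    using prod_small[where f = h and k = "deriv \<rho>"] prod_small[where f = "deriv k" and k = "deriv \<xi>"]
      prod_small[where f = "deriv k" and k = "deriv (deriv \<xi>)"] h(6) \<rho>(7,8) k(6) \<xi>(7-9) by blast+
  \<comment> \<open>In \<open>A\<close> the cutoff comes before the lamination, in \<open>B\<close>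
    after it; both sets shrink by the same factor.\<close>
  have mult: "\<omega> * (\<theta> * m) = \<theta> * \<omega> * m" "\<theta> * (\<omega> * m) = \<theta> * \<omega> * m" for m by simp_all
  have "stage (\<theta> * \<omega>) (1 / (1 - \<theta>)) \<epsilon> A B A1 B1 A' B' \<rho> h \<xi> (deriv k)"
    unfolding stage_def
    using \<rho> h \<xi> k s k0 smooth1_deriv[OF k(1)] ps by (simp add: mult)
  then show ?thesis by blast
qed

text \<open>Bernoulli's inequality for a real exponent: the difference vanishes at 0 and its
  derivative is nonnegative.\<close>

lemma one_plus_powr_ge:
  fixes r x :: real
  assumes "1 \<le> r" "0 \<le> x"
  shows "1 + r * x \<le> (1 + x) powr r"
proof -
  have "(\<lambda>x. (1 + x) powr r - (1 + r * x)) 0 \<le> (\<lambda>x. (1 + x) powr r - (1 + r * x)) x"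
  proof (rule DERIV_nonneg_imp_nondecreasing[OF assms(2)])
    fix y :: real assume "0 \<le> y"
    have "((\<lambda>x. (1 + x) powr r - (1 + r * x)) has_real_derivative r * (1 + y) powr (r - 1) - r) (at y)"
      using \<open>0 \<le> y\<close> by (auto intro!: derivative_eq_intros)
    moreover have "0 \<le> r * (1 + y) powr (r - 1) - r"
      using assms(1) \<open>0 \<le> y\<close> ge_one_powr_ge_zero[of "1 + y" "r - 1"] by simp
    ultimately show "\<exists>z. ((\<lambda>x. (1 + x) powr r - (1 + r * x)) has_real_derivative z) (at y) \<and> 0 \<le> z" by blast
  qed
  then show ?thesis by simp
qed

text \<open>The profile of stage \<open>n\<close> takes values down to \<open>- 1 / (1 - \<theta>)\<close>; this is where \<open>p = 2 / (1 - \<kappa>)\<close> enters.\<close>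

lemma retained_fraction_bound:
  fixes \<kappa> :: real and n :: nat
  assumes "0 < \<kappa>" "\<kappa> < 1"
  defines "\<theta> \<equiv> ((real n + 1) / (real n + 2)) powr (1 / (1 - \<kappa>))"
  shows "0 < \<theta>" "\<theta> < 1" "1 / (1 - \<theta>) \<le> (1 - \<kappa>) * (real n + 4 / (1 - \<kappa>)) - 2"
proof -
  define r where "r = 1 / (1 - \<kappa>)"
  define y where "y = real n + 1"
  have r: "1 \<le> r" and y: "0 < y" using assms(1,2) by (auto simp: r_def y_def)
  show "0 < \<theta>" by (simp add: \<theta>_def)
  have \<theta>: "\<theta> = 1 / (1 + 1 / y) powr r"
  proof -
    have "(real n + 1) / (real n + 2) = 1 / (1 + 1 / y)" using y by (simp add: y_def field_simps)
    then show ?thesis unfolding \<theta>_def r_def[symmetric] using y by (simp add: powr_divide)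
  qed
  \<comment> \<open>Bernoulli replaces the power by a rational bound, so that
    \<open>1 / (1 - \<theta>)\<close> is at most \<open>(y + r) / r\<close>, which is affine in
    \<open>n\<close> with slope \<open>1 - \<kappa>\<close>.\<close>
  have "\<theta> \<le> 1 / (1 + r * (1 / y))"
  proof -
    have "0 < 1 + r * (1 / y)" "0 < 1 + 1 / y" using r y by (simp_all add: add_pos_pos)
    then have "0 < 1 + r * (1 / y)" "0 < (1 + 1 / y) powr r" by simp_all
    then show ?thesis
      unfolding \<theta> using one_plus_powr_ge[OF r, of "1 / y"] y by (intro divide_left_mono) auto
  qed
  also have "\<dots> = 1 - r / (y + r)" using r y by (simp add: field_simps)
  finally have le: "r / (y + r) \<le> 1 - \<theta>" by simp
  moreover have "0 < r / (y + r)" using r y by simp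
  ultimately show "\<theta> < 1" by linarith
  have "1 / (1 - \<theta>) \<le> 1 / (r / (y + r))"
    using le \<open>0 < r / (y + r)\<close> \<open>\<theta> < 1\<close> by (intro divide_left_mono mult_pos_pos) simp_all
  also have "\<dots> = (1 - \<kappa>) * y + 1" using r assms(1,2) by (simp add: r_def field_simps)
  \<comment> \<open>The right side is \<open>(1 - \<kappa>) * n + 2\<close>, the left side
    \<open>(1 - \<kappa>) * n + (1 - \<kappa>) + 1\<close>.\<close>
  also have "\<dots> \<le> (1 - \<kappa>) * (real n + 4 / (1 - \<kappa>)) - 2"
    using assms(1,2) by (simp add: y_def field_simps)
  finally show "1 / (1 - \<theta>) \<le> (1 - \<kappa>) * (real n + 4 / (1 - \<kappa>)) - 2" .
qed

text \<open>Each of the two sets shrinks like \<open>n powr - (1 / (1 - \<kappa>))\<close>, with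
  half of the exponent \<open>p\<close> of their product.\<close>

lemma stages_exist:
  assumes "cellset A0" "cellset B0" "0 < \<kappa>" "\<kappa> < 1"
  shows "\<exists>A B A1 B1 \<rho> h \<xi> g \<mu> c. A 0 = A0 \<and> B 0 = B0 \<and>
    (\<forall>n. stage (\<mu> n) (c n) (1 / 2 ^ n) (A n) (B n) (A1 n) (B1 n) (A (Suc n)) (B (Suc n)) (\<rho> n) (h n) (\<xi> n) (g n)) \<and>
    (\<forall>n. cellset (A n) \<and> cellset (B n)) \<and>
    (\<forall>n. c n \<le> (1 - \<kappa>) * (real n + 4 / (1 - \<kappa>)) - 2) \<and>
    (\<forall>n. measure lebesgue (A n) = measure lebesgue A0 / 2 * (real n + 1) powr - (1 / (1 - \<kappa>)) * (1 + 1 / (real n + 1))) \<and>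
    (\<forall>n. measure lebesgue (B n) = measure lebesgue B0 / 2 * (real n + 1) powr - (1 / (1 - \<kappa>)) * (1 + 1 / (real n + 1)))"
proof -
  define r where "r = 1 / (1 - \<kappa>)"
  \<comment> \<open>Both factors are quotients of consecutive terms, so the measures telescope to an explicit formula.\<close>
  define \<theta> where "\<theta> n = ((real n + 1) / (real n + 2)) powr r" for n
  \<comment> \<open>\<open>w\<close> decreases from 2 to 1, so all cutoffs together cost at most a
    factor 2 in each variable; the power law of the measures comes from \<theta> alone.\<close>
  define w where "w n = 1 + 1 / (real n + 1)" for n
  define \<omega> where "\<omega> n = w (Suc n) / w n" for n
  have \<theta>: "0 < \<theta> n" "\<theta> n < 1" "1 / (1 - \<theta> n) \<le> (1 - \<kappa>) * (real n + 4 / (1 - \<kappa>)) - 2" for n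
    using retained_fraction_bound[OF assms(3,4), of n] by (auto simp: \<theta>_def r_def)
  have wpos: "0 < w n" for n by (simp add: w_def add_pos_pos)
  have \<omega>: "0 < \<omega> n" "\<omega> n < 1" for n
    using wpos by (auto simp: \<omega>_def divide_less_eq_1) (auto simp: w_def intro!: divide_strict_left_mono)
  \<comment> \<open>\<open>w 0 = 2\<close> cancels the division by 2, so that
    \<open>m M 0 = M\<close>.\<close>
  define m where "m M n = M / 2 * (real n + 1) powr - r * w n" for M n
  have mS: "\<theta> n * \<omega> n * m M n = m M (Suc n)" for M n
  proof -
    have "\<theta> n * (real n + 1) powr - r = (real (Suc n) + 1) powr - r"
      by (simp add: \<theta>_def powr_divide powr_minus_divide add.commute)
    moreover have "\<omega> n * w n = w (Suc n)" using wpos[of n] by (simp add: \<omega>_def)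
    ultimately show ?thesis unfolding m_def by (metis (no_types, opaque_lifting) mult.assoc mult.commute)
  qed
  \<comment> \<open>The exact measures are part of the induction hypothesis, and the clause for
    \<open>n = 0\<close> pins down the initial pair, so that dependent choice delivers both.\<close>
  define P where "P n = (\<lambda>(A, B). (n = 0 \<longrightarrow> A = A0 \<and> B = B0) \<and> cellset A \<and> cellset B \<and>
      measure lebesgue A = m (measure lebesgue A0) n \<and> measure lebesgue B = m (measure lebesgue B0) n)" for n :: nat
  define Q where "Q n = (\<lambda>(A, B) (A', B'). \<exists>A1 B1 \<rho> h \<xi> g.
      stage (\<theta> n * \<omega> n) (1 / (1 - \<theta> n)) (1 / 2 ^ n) A B A1 B1 A' B' \<rho> h \<xi> g)" for n
  have "\<exists>f. \<forall>n. P n (f n) \<and> Q n (f n) (f (Suc n))"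
  proof (rule dependent_nat_choice)
    show "\<exists>x. P 0 x" using assms by (intro exI[of _ "(A0, B0)"]) (auto simp: P_def m_def w_def)
  next
    fix x n assume x: "P n x"
    obtain A B where AB: "x = (A, B)" by force
    have c: "cellset A" "cellset B" using x by (auto simp: P_def AB)
    obtain A1 B1 A' B' \<rho> h \<xi> g where
      st: "stage (\<theta> n * \<omega> n) (1 / (1 - \<theta> n)) (1 / 2 ^ n) A B A1 B1 A' B' \<rho> h \<xi> g"
      using stage_exists[OF c \<theta>(1,2) \<omega>, of "1 / 2 ^ n" n n] by auto
    have "P (Suc n) (A', B')"
      using st x unfolding P_def AB stage_def by (simp add: mS)
    moreover have "Q n x (A', B')" using st unfolding Q_def AB by blast
    ultimately show "\<exists>y. P (Suc n) y \<and> Q n x y" by blast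
  qed
  then obtain f where f: "\<And>n. P n (f n)" "\<And>n. Q n (f n) (f (Suc n))" by blast
  define A where "A n = fst (f n)" for n
  define B where "B n = snd (f n)" for n
  have fAB: "f n = (A n, B n)" for n by (simp add: A_def B_def)
  have "\<forall>n. \<exists>A1 B1 \<rho> h \<xi> g. stage (\<theta> n * \<omega> n) (1 / (1 - \<theta> n)) (1 / 2 ^ n)
      (A n) (B n) A1 B1 (A (Suc n)) (B (Suc n)) \<rho> h \<xi> g"
    using f(2) unfolding Q_def fAB by simp
  then obtain A1 B1 \<rho> h \<xi> g where st: "\<And>n. stage (\<theta> n * \<omega> n) (1 / (1 - \<theta> n)) (1 / 2 ^ n)
      (A n) (B n) (A1 n) (B1 n) (A (Suc n)) (B (Suc n)) (\<rho> n) (h n) (\<xi> n) (g n)"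
    by metis
  have P: "A 0 = A0" "B 0 = B0" "cellset (A n)" "cellset (B n)"
    "measure lebesgue (A n) = m (measure lebesgue A0) n" "measure lebesgue (B n) = m (measure lebesgue B0) n" for n
    using f(1)[of n] f(1)[of 0] unfolding P_def fAB by simp_all
  show ?thesis
    by (rule exI[of _ A], rule exI[of _ B], rule exI[of _ A1], rule exI[of _ B1], rule exI[of _ \<rho>],
        rule exI[of _ h], rule exI[of _ \<xi>], rule exI[of _ g], rule exI[of _ "\<lambda>n. \<theta> n * \<omega> n"],
        rule exI[of _ "\<lambda>n. 1 / (1 - \<theta> n)"], intro conjI allI)
       (fact P(1) P(2) st P(3) P(4) \<theta>(3) P(5,6)[unfolded m_def w_def r_def])+
qed


section \<open>The limit of the staircase\<close>

locale staircase =
  fixes \<kappa> :: real and A B A1 B1 :: "nat \<Rightarrow> real set" and \<rho> h \<xi> g :: "nat \<Rightarrow> real \<Rightarrow> real"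
    and \<mu> c :: "nat \<Rightarrow> real"
  assumes kappa: "0 < \<kappa>" "\<kappa> < 1"
    and stage: "\<And>n. stage (\<mu> n) (c n) (1 / 2 ^ n) (A n) (B n) (A1 n) (B1 n) (A (Suc n)) (B (Suc n)) (\<rho> n) (h n) (\<xi> n) (g n)"
    and cellsets: "\<And>n. cellset (A n)" "\<And>n. cellset (B n)"
    and c_le: "\<And>n. c n \<le> (1 - \<kappa>) * (real n + 4 / (1 - \<kappa>)) - 2"
begin

lemma smooths: "smooth1 (\<rho> n)" "smooth1 (h n)" "smooth1 (\<xi> n)" "smooth1 (g n)"
  using stage[of n] by (simp_all add: stage_def)

lemma nested: "A (Suc n) \<subseteq> A1 n" "A1 n \<subseteq> A n" "B (Suc n) \<subseteq> B1 n" "B1 n \<subseteq> B n"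
  using stage[of n] by (simp_all add: stage_def)

lemma closeds: "closed (A n)" "closed (B n)" "closed (A1 n)" "closed (B1 n)"
  using stage[of n] cellsets by (auto simp: stage_def intro!: compact_imp_closed cellset_compact)

lemma zero_off:
  "t \<notin> A n \<Longrightarrow> \<rho> n t = 0" "x \<notin> B n \<Longrightarrow> h n x = 0" "t \<notin> A1 n \<Longrightarrow> g n t = 0" "x \<notin> B1 n \<Longrightarrow> \<xi> n x = 0"
  using stage[of n] by (simp_all add: stage_def)

lemma deriv_zero_off:
  "t \<notin> A n \<Longrightarrow> deriv (\<rho> n) t = 0" "x \<notin> B n \<Longrightarrow> deriv (h n) x = 0"
  "t \<notin> A1 n \<Longrightarrow> deriv (g n) t = 0" "x \<notin> B1 n \<Longrightarrow> deriv (\<xi> n) x = 0"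
  using deriv_zero_outside[where K = "A n" and f = "\<rho> n"] deriv_zero_outside[where K = "B n" and f = "h n"]
    deriv_zero_outside[where K = "A1 n" and f = "g n"] deriv_zero_outside[where K = "B1 n" and f = "\<xi> n"]
    closeds[of n] zero_off by blast+

lemma deriv2_zero_off:
  "x \<notin> B n \<Longrightarrow> deriv (deriv (h n)) x = 0" "x \<notin> B1 n \<Longrightarrow> deriv (deriv (\<xi> n)) x = 0"
  using deriv_zero_outside[where K = "B n" and f = "deriv (h n)"]
    deriv_zero_outside[where K = "B1 n" and f = "deriv (\<xi> n)"] closeds[of n] deriv_zero_off by blast+

text \<open>Since \<open>(1 - \<kappa>) * V = 4\<close>, one has
  \<open>\<kappa> * v n + 2 \<le> v n - 2\<close> at every stage: room for a perturbation of size 2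
  in each derivative.\<close>

definition V :: real where "V = 4 / (1 - \<kappa>)"
definition v :: "nat \<Rightarrow> real" where "v n = real n + V"
definition Box :: "nat \<Rightarrow> (real \<times> real) set" where "Box n = A n \<times> B n"
definition Sing :: "(real \<times> real) set" where "Sing = (\<Inter>n. Box n)"

definition term_u where "term_u n z = h n (snd z) * \<rho> n (fst z) + g n (fst z) * \<xi> n (snd z)"
definition term_t where "term_t n z = h n (snd z) * deriv (\<rho> n) (fst z) + deriv (g n) (fst z) * \<xi> n (snd z)"
definition term_x where "term_x n z = deriv (h n) (snd z) * \<rho> n (fst z) + g n (fst z) * deriv (\<xi> n) (snd z)"
definition term_xx where
  "term_xx n z = deriv (deriv (h n)) (snd z) * \<rho> n (fst z) + g n (fst z) * deriv (deriv (\<xi> n)) (snd z)"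

text \<open>The polynomial \<open>V * (t + x^2 / 2)\<close> has time derivative and second space
  derivative \<open>V\<close>, so stage 0 is the pair \<open>(v 0, v 0)\<close> on the whole plane;
  all corrections take place inside \<open>Box 0\<close>.\<close>

definition us where "us m z = V * (fst z + (snd z)\<^sup>2 / 2) + (\<Sum>n<m. term_u n z)"
definition ts where "ts m z = V + (\<Sum>n<m. term_t n z)"
definition xs where "xs m z = V * snd z + (\<Sum>n<m. term_x n z)"
definition xxs where "xxs m z = V + (\<Sum>n<m. term_xx n z)"

lemma V_pos: "4 < V" using kappa by (simp add: V_def field_simps)

lemma v_pos: "4 < v n" using V_pos by (simp add: v_def)

lemma kappa_v: "4 \<le> (1 - \<kappa>) * v n"
proof -
  have "(1 - \<kappa>) * V = 4" unfolding V_def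
    using kappa by (metis diff_gt_0_iff_gt less_irrefl nonzero_mult_div_cancel_left times_divide_eq_right)
  then have "(1 - \<kappa>) * v n = (1 - \<kappa>) * real n + 4" by (simp add: v_def distrib_left)
  then show ?thesis using kappa by simp
qed

lemma smooth_us: "smooth_on UNIV (us m)"
proof -
  have "smooth_on UNIV (\<lambda>z. V * (fst z + snd z * snd z * (1/2)) + (\<Sum>n<m. h n (snd z) * \<rho> n (fst z) + g n (fst z) * \<xi> n (snd z)))"
    by (intro smooth_on_add smooth_on_mult smooth_on_sum smooth_on_const open_UNIV
        smooth1_fst smooth1_snd smooths smooth1_fst[OF smooth1_ident] smooth1_snd[OF smooth1_ident])
  then show ?thesis by (simp add: us_def[abs_def] term_u_def power2_eq_square)
qed

lemma us_DERIV:
  "((\<lambda>s. us m (s, x)) has_real_derivative ts m (t, x)) (at t)"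
  "((\<lambda>y. us m (t, y)) has_real_derivative xs m (t, x)) (at x)"
  "((\<lambda>y. xs m (t, y)) has_real_derivative xxs m (t, x)) (at x)"
proof -
  note D = smooth1_DERIV[OF smooths(1)] smooth1_DERIV[OF smooths(2)] smooth1_DERIV[OF smooths(3)] smooth1_DERIV[OF smooths(4)]
    smooth1_DERIV[OF smooth1_deriv[OF smooths(2)]] smooth1_DERIV[OF smooth1_deriv[OF smooths(3)]]
  show "((\<lambda>s. us m (s, x)) has_real_derivative ts m (t, x)) (at t)"
    unfolding us_def ts_def term_u_def term_t_def fst_conv snd_conv
    by (rule derivative_eq_intros D refl | simp add: algebra_simps)+
  show "((\<lambda>y. us m (t, y)) has_real_derivative xs m (t, x)) (at x)"
    unfolding us_def xs_def term_u_def term_x_def fst_conv snd_conv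
    by (rule derivative_eq_intros D refl | simp add: algebra_simps)+
  show "((\<lambda>y. xs m (t, y)) has_real_derivative xxs m (t, x)) (at x)"
    unfolding xs_def xxs_def term_x_def term_xx_def fst_conv snd_conv
    by (rule derivative_eq_intros D refl | simp add: algebra_simps)+
qed

lemma pd_us: "pd_t (us m) = ts m" "pd_x (us m) = xs m" "pd_x (xs m) = xxs m"
  unfolding pd_t_def[abs_def] pd_x_def[abs_def]
  using DERIV_imp_deriv[OF us_DERIV(1)] DERIV_imp_deriv[OF us_DERIV(2)] DERIV_imp_deriv[OF us_DERIV(3)]
  by auto

lemma smooth_ts: "smooth_on UNIV (ts m)" and smooth_xs: "smooth_on UNIV (xs m)"
  and smooth_xxs: "smooth_on UNIV (xxs m)"
  using smooth_on_pd[OF smooth_us[of m]] smooth_on_pd(2)[of UNIV "xs m"] by (auto simp: pd_us)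

lemma Box_Suc: "Box (Suc n) \<subseteq> Box n"
  using nested[of n] by (auto simp: Box_def)

lemma Box_mono: "m \<le> n \<Longrightarrow> Box n \<subseteq> Box m"
  using Box_Suc lift_Suc_antimono_le[of Box] by (simp add: antimono_def)

lemma compact_Box: "compact (Box n)"
  unfolding Box_def using cellsets cellset_compact by (intro compact_Times) auto

lemma compact_Sing: "compact Sing"
  unfolding Sing_def using compact_Box by (intro compact_Inter) auto

lemma Sing_subset: "Sing \<subseteq> Box n" by (auto simp: Sing_def)

lemma off_Box:
  assumes "z \<notin> Box n"
  shows "term_u n z = 0" "term_t n z = 0" "term_x n z = 0" "term_xx n z = 0"
proof -
  consider "fst z \<notin> A n" | "snd z \<notin> B n" using assms by (auto simp: Box_def mem_Times_iff)
  then have "term_u n z = 0 \<and> term_t n z = 0 \<and> term_x n z = 0 \<and> term_xx n z = 0"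
  proof cases
    case 1
    then have "fst z \<notin> A1 n" using nested by blast
    with 1 show ?thesis
      by (simp add: term_u_def term_t_def term_x_def term_xx_def zero_off deriv_zero_off)
  next
    case 2
    then have "snd z \<notin> B1 n" using nested by blast
    with 2 show ?thesis
      by (simp add: term_u_def term_t_def term_x_def term_xx_def zero_off deriv_zero_off deriv2_zero_off)
  qed
  then show "term_u n z = 0" "term_t n z = 0" "term_x n z = 0" "term_xx n z = 0" by auto
qed

text \<open>The error terms containing \<open>deriv \<rho>\<close> and
  \<open>deriv (deriv \<xi>)\<close> vanish because the cutoffs are flat on the next box. Hence
  every stage starts from exactly equal derivatives.\<close>

lemma in_next_Box:
  assumes "z \<in> Box (Suc n)"
  shows "term_t n z = 1" "term_xx n z = 1"
proof -
  have z: "fst z \<in> A (Suc n)" "snd z \<in> B (Suc n)" using assms by (auto simp: Box_def)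
  then have "fst z \<in> A1 n" "snd z \<in> B1 n" using nested by blast+
  then show "term_t n z = 1" "term_xx n z = 1"
    using z stage[of n] by (simp_all add: term_t_def term_xx_def stage_def)
qed

section \<open>Pointwise bounds on the stage functions and the ratio of their derivatives\<close>

lemma scale_bounds:
  fixes a b C :: real
  assumes "0 \<le> b" "b \<le> 1" "- C \<le> a" "a \<le> 1" "0 \<le> C"
  shows "- C \<le> a * b" "a * b \<le> 1"
proof -
  have "- C * 1 \<le> - C * b" using assms by (intro mult_left_mono_neg) auto
  also have "\<dots> \<le> a * b" using assms by (intro mult_right_mono) auto
  finally show "- C \<le> a * b" by simp
  have "a * b \<le> 1 * b" using assms by (intro mult_right_mono) auto
  then show "a * b \<le> 1" using assms by simp
qed

text \<open>The two oscillations never compete. On the product of \<open>A1 n\<close> and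
  \<open>B1 n\<close> the one in x contributes exactly 1 to the second derivative and the one in t
  acts; elsewhere only the one in x acts. So one derivative drops by at most \<open>C\<close> while
  the other changes by an amount in [-1, 2], and \<open>v n - C = \<kappa> * v n + 2\<close> keeps
  both ratios admissible.\<close>

lemma term_bounds:
  "\<kappa> * (v n + term_xx n z) \<le> v n + term_t n z" "\<kappa> * (v n + term_t n z) \<le> v n + term_xx n z"
  "\<kappa> * v n \<le> v n + term_t n z" "\<kappa> * v n \<le> v n + term_xx n z"
  "term_t n z \<le> 2" "term_xx n z \<le> 2"
proof -
  obtain t x where z: "z = (t, x)" by force
  define C where "C = (1 - \<kappa>) * v n - 2"
  have C: "c n \<le> C" "2 \<le> C" using c_le[of n] kappa_v[of n] by (auto simp: C_def v_def V_def)
  have C': "v n - C = \<kappa> * v n + 2" by (simp add: C_def algebra_simps)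
  have p: "(1::real) / 2 ^ n \<le> 1" by simp
  have st: "0 \<le> \<rho> n t" "\<rho> n t \<le> 1" "0 \<le> \<xi> n x" "\<xi> n x \<le> 1"
    "- c n \<le> deriv (deriv (h n)) x" "deriv (deriv (h n)) x \<le> 1" "- c n \<le> deriv (g n) t" "deriv (g n) t \<le> 1"
    "\<bar>h n x * deriv (\<rho> n) t\<bar> \<le> 1 / 2 ^ n" "\<bar>g n t * deriv (deriv (\<xi> n)) x\<bar> \<le> 1 / 2 ^ n"
    using stage[of n] by (simp_all add: stage_def)
  have e: "\<bar>h n x * deriv (\<rho> n) t\<bar> \<le> 1" "\<bar>g n t * deriv (deriv (\<xi> n)) x\<bar> \<le> 1"
    using st(9,10) p by linarith+
  have s: "- C \<le> deriv (deriv (h n)) x * \<rho> n t" "deriv (deriv (h n)) x * \<rho> n t \<le> 1"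
    "- C \<le> deriv (g n) t * \<xi> n x" "deriv (g n) t * \<xi> n x \<le> 1"
    by (rule scale_bounds[where C = C]; use st C in linarith)+
  have k: "\<kappa> * (v n + y) \<le> \<kappa> * v n + 2" if "y \<le> 2" for y
  proof -
    have "\<kappa> * y \<le> \<kappa> * 2" using kappa that by (intro mult_left_mono) auto
    then show ?thesis using kappa unfolding distrib_left by linarith
  qed
  have k1: "\<kappa> * (v n + y) \<le> v n - 2" if "y \<le> 2" for y
    using k[OF that] kappa_v[of n] by (simp add: algebra_simps)
  have k2: "\<kappa> * v n \<le> v n - 4" using kappa_v[of n] by (simp add: algebra_simps)
  consider "t \<in> A1 n" "x \<in> B1 n" | "t \<notin> A1 n \<or> x \<notin> B1 n" by blast
  then have "\<kappa> * (v n + term_xx n z) \<le> v n + term_t n z \<and> \<kappa> * (v n + term_t n z) \<le> v n + term_xx n z \<and>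
    \<kappa> * v n \<le> v n + term_t n z \<and> \<kappa> * v n \<le> v n + term_xx n z \<and> term_t n z \<le> 2 \<and> term_xx n z \<le> 2"
  proof cases
    case 1
    then have "\<rho> n t = 1" "deriv (\<rho> n) t = 0" "deriv (deriv (h n)) x = 1"
      using stage[of n] by (simp_all add: stage_def)
    then have tt: "term_t n z = deriv (g n) t * \<xi> n x" and xx: "term_xx n z = 1 + g n t * deriv (deriv (\<xi> n)) x"
      by (simp_all add: z term_t_def term_xx_def)
    have b: "- C \<le> term_t n z" "term_t n z \<le> 1" "0 \<le> term_xx n z" "term_xx n z \<le> 2"
      using s(3,4) e(2) unfolding tt xx by linarith+
    show ?thesis using b k[of "term_xx n z"] k1[of "term_t n z"] k2 C' by auto
  next
    case 2
    then have "g n t = 0 \<and> deriv (g n) t = 0 \<or> \<xi> n x = 0 \<and> deriv (deriv (\<xi> n)) x = 0"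
      using zero_off deriv_zero_off deriv2_zero_off by blast
    then have tt: "term_t n z = h n x * deriv (\<rho> n) t" and xx: "term_xx n z = deriv (deriv (h n)) x * \<rho> n t"
      by (auto simp: z term_t_def term_xx_def)
    have b: "- C \<le> term_xx n z" "term_xx n z \<le> 1" "- 1 \<le> term_t n z" "term_t n z \<le> 1"
      using s(1,2) e(1) unfolding tt xx by linarith+
    show ?thesis using b k[of "term_t n z"] k1[of "term_xx n z"] k2 C' by auto
  qed
  then show "\<kappa> * (v n + term_xx n z) \<le> v n + term_t n z" "\<kappa> * (v n + term_t n z) \<le> v n + term_xx n z"
    "\<kappa> * v n \<le> v n + term_t n z" "\<kappa> * v n \<le> v n + term_xx n z"
    "term_t n z \<le> 2" "term_xx n z \<le> 2" by auto
qed

lemma term_small: "\<bar>term_u n z\<bar> \<le> 2 / 2 ^ n" "\<bar>term_x n z\<bar> \<le> 2 / 2 ^ n"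
proof -
  obtain t x where z: "z = (t, x)" by force
  have st: "0 \<le> \<rho> n t" "\<rho> n t \<le> 1" "0 \<le> \<xi> n x" "\<xi> n x \<le> 1" "\<bar>h n x\<bar> \<le> 1 / 2 ^ n" "\<bar>deriv (h n) x\<bar> \<le> 1 / 2 ^ n"
    "\<bar>g n t\<bar> \<le> 1 / 2 ^ n" "\<bar>g n t * deriv (\<xi> n) x\<bar> \<le> 1 / 2 ^ n"
    using stage[of n] by (simp_all add: stage_def)
  have m: "\<bar>a * b\<bar> \<le> 1 / 2 ^ n" if "\<bar>a\<bar> \<le> 1 / 2 ^ n" "0 \<le> b" "b \<le> 1" for a b :: real
    using mult_mono[of "\<bar>a\<bar>" "1 / 2 ^ n" "\<bar>b\<bar>" 1] that by (simp add: abs_mult)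
  have "\<bar>h n x * \<rho> n t\<bar> \<le> 1 / 2 ^ n" "\<bar>deriv (h n) x * \<rho> n t\<bar> \<le> 1 / 2 ^ n" "\<bar>g n t * \<xi> n x\<bar> \<le> 1 / 2 ^ n"
    using m st by blast+
  then show "\<bar>term_u n z\<bar> \<le> 2 / 2 ^ n" "\<bar>term_x n z\<bar> \<le> 2 / 2 ^ n"
    using st(8) by (auto simp: z term_u_def term_x_def)
qed

lemma stage_Suc:
  "us (Suc m) z = us m z + term_u m z" "ts (Suc m) z = ts m z + term_t m z"
  "xs (Suc m) z = xs m z + term_x m z" "xxs (Suc m) z = xxs m z + term_xx m z"
  by (simp_all add: us_def ts_def xs_def xxs_def)

lemma in_Box: "z \<in> Box m \<Longrightarrow> ts m z = v m" "z \<in> Box m \<Longrightarrow> xxs m z = v m"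
proof -
  have "z \<in> Box m \<longrightarrow> ts m z = v m \<and> xxs m z = v m"
  proof (induction m)
    case 0 show ?case by (simp add: ts_def xxs_def v_def)
  next
    case (Suc m)
    then show ?case using Box_Suc[of m] in_next_Box[of z m] by (auto simp: stage_Suc v_def)
  qed
  then show "z \<in> Box m \<Longrightarrow> ts m z = v m" "z \<in> Box m \<Longrightarrow> xxs m z = v m" by auto
qed

lemma stable:
  assumes "z \<notin> Box n" "n \<le> m"
  shows "us m z = us n z" "ts m z = ts n z" "xs m z = xs n z" "xxs m z = xxs n z"
proof -
  have "us m z = us n z \<and> ts m z = ts n z \<and> xs m z = xs n z \<and> xxs m z = xxs n z"
    using assms(2)
  proof (induction m rule: dec_induct)
    case (step m)
    then have "z \<notin> Box m" using assms(1) Box_mono by blast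
    then show ?case using step by (simp add: stage_Suc off_Box)
  qed simp
  then show "us m z = us n z" "ts m z = ts n z" "xs m z = xs n z" "xxs m z = xxs n z" by auto
qed

text \<open>A stage either leaves a point alone or acts on the exact pair \<open>(v m, v m)\<close>;
  this dichotomy drives the inductions below.\<close>

lemma step_cases:
  obtains "z \<notin> Box m" "ts (Suc m) z = ts m z" "xxs (Suc m) z = xxs m z"
  | "z \<in> Box m" "ts (Suc m) z = v m + term_t m z" "xxs (Suc m) z = v m + term_xx m z"
  using in_Box[of z m] off_Box[of z m] by (cases "z \<in> Box m") (auto simp: stage_Suc)

lemma ratio: "\<kappa> * xxs m z \<le> ts m z" "\<kappa> * ts m z \<le> xxs m z"
proof -
  have "\<kappa> * xxs m z \<le> ts m z \<and> \<kappa> * ts m z \<le> xxs m z"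
  proof (induction m)
    case 0 show ?case using kappa V_pos by (simp add: ts_def xxs_def mult_left_le_one_le)
  next
    case (Suc m)
    show ?case by (rule step_cases[of z m]) (use Suc term_bounds in auto)
  qed
  then show "\<kappa> * xxs m z \<le> ts m z" "\<kappa> * ts m z \<le> xxs m z" by auto
qed

text \<open>At each later stage the point is either frozen or starts from \<open>v m\<close>, which
  is at least \<open>v k\<close>, and is lowered to no less than
  \<open>\<kappa> * v m\<close>.\<close>

lemma lower:
  assumes "z \<in> Box k" "k \<le> m"
  shows "\<kappa> * v k \<le> ts m z" "\<kappa> * v k \<le> xxs m z"
proof -
  have "\<kappa> * v k \<le> ts m z \<and> \<kappa> * v k \<le> xxs m z"
    using assms(2)
  proof (induction m rule: dec_induct)
    case base
    then show ?case using in_Box[OF assms(1)] v_pos[of k] kappa by (simp add: mult_left_le_one_le)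
  next
    case (step m)
    have "\<kappa> * v k \<le> \<kappa> * v m" using step kappa by (intro mult_left_mono) (auto simp: v_def)
    then show ?case
      using step term_bounds(3,4)[of m z] by (cases rule: step_cases[of z m]) auto
  qed
  then show "\<kappa> * v k \<le> ts m z" "\<kappa> * v k \<le> xxs m z" by auto
qed

text \<open>A stage raises \<open>v m\<close> by at most 2, and
  \<open>v m + 2 = v (Suc m) + 1\<close>; outside \<open>Box k\<close> the values are frozen from
  stage \<open>k\<close> on.\<close>

lemma upper:
  assumes "z \<notin> Box k"
  shows "ts m z \<le> v k + 1" "xxs m z \<le> v k + 1"
proof -
  have u: "ts m z \<le> v m + 1 \<and> xxs m z \<le> v m + 1" for m
  proof (induction m)
    case 0 show ?case by (simp add: ts_def xxs_def v_def)
  next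
    case (Suc m)
    then show ?case using term_bounds(5,6)[of m z] by (cases rule: step_cases[of z m]) (auto simp: v_def)
  qed
  show "ts m z \<le> v k + 1" "xxs m z \<le> v k + 1"
    using u[of m] u[of k] stable[OF assms, of m] by (cases "k \<le> m"; auto simp: v_def)+
qed

lemma pos: "\<kappa> * V \<le> ts m z" "\<kappa> * V \<le> xxs m z" "0 < ts m z" "0 < xxs m z"
proof -
  show a: "\<kappa> * V \<le> ts m z" "\<kappa> * V \<le> xxs m z"
    using lower[of z 0 m] stable[of z 0 m] kappa V_pos
    by (cases "z \<in> Box 0"; auto simp: v_def ts_def xxs_def mult_left_le_one_le)+
  have "0 < \<kappa> * V" using kappa V_pos by simp
  then show "0 < ts m z" "0 < xxs m z" using a by linarith+
qed

section \<open>The limit functions and the coefficient\<close>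

definition u where "u z = V * (fst z + (snd z)\<^sup>2 / 2) + (\<Sum>n. term_u n z)"
definition ux where "ux z = V * snd z + (\<Sum>n. term_x n z)"
definition exit :: "real \<times> real \<Rightarrow> nat" where "exit z = (LEAST n. z \<notin> Box n)"
definition ut where "ut z = (if z \<in> Sing then 0 else ts (exit z) z)"
definition uxx where "uxx z = (if z \<in> Sing then 0 else xxs (exit z) z)"
definition a where "a z = (if z \<in> Sing then 1 else ut z / uxx z)"

lemma exit: "z \<notin> Sing \<Longrightarrow> z \<notin> Box (exit z)" "z \<notin> Box n \<Longrightarrow> exit z \<le> n"
  unfolding exit_def Sing_def using LeastI[of "\<lambda>n. z \<notin> Box n"] by (auto intro: Least_le)

lemma summable_half: "summable (\<lambda>n. 2 / (2::real) ^ n)" "(\<Sum>n. 2 / (2::real) ^ n) = 4"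
proof -
  have "(\<lambda>n. 2 * (1/2::real) ^ n) sums (2 * (1 / (1 - 1/2)))"
    by (intro sums_mult geometric_sums) simp
  moreover have "(\<lambda>n. 2 * (1/2::real) ^ n) = (\<lambda>n. 2 / 2 ^ n)" by (simp only: power_one_over) simp
  ultimately have "(\<lambda>n. 2 / (2::real) ^ n) sums 4" by (simp only:) simp
  then show "summable (\<lambda>n. 2 / (2::real) ^ n)" "(\<Sum>n. 2 / (2::real) ^ n) = 4"
    using sums_summable sums_unique by metis+
qed

lemma summable_terms: "summable (\<lambda>n. term_u n z)" "summable (\<lambda>n. term_x n z)"
  by (rule summable_comparison_test'[OF summable_half(1), of 0]; simp add: term_small)+

lemma us_limit: "(\<lambda>m. us m z) \<longlonglongrightarrow> u z" "(\<lambda>m. xs m z) \<longlonglongrightarrow> ux z"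
  unfolding us_def xs_def u_def ux_def
  by (intro tendsto_add tendsto_const summable_LIMSEQ summable_terms)+

text \<open>Any index whose box misses \<open>z\<close> may be used, not only \<open>exit z\<close>;
  hence the identities hold with one fixed \<open>n\<close> on the whole open complement of
  \<open>Box n\<close>.\<close>

lemma off_limits:
  assumes "z \<notin> Box n"
  shows "u z = us n z" "ux z = xs n z" "ut z = ts n z" "uxx z = xxs n z" "a z = ts n z / xxs n z"
proof -
  have "(\<lambda>m. us m z) \<longlonglongrightarrow> us n z" "(\<lambda>m. xs m z) \<longlonglongrightarrow> xs n z"
    by (rule tendsto_eventually, rule eventually_sequentiallyI[of n], rule stable[OF assms], assumption)+
  then show "u z = us n z" "ux z = xs n z" using us_limit LIMSEQ_unique by blast+
  have nS: "z \<notin> Sing" using assms by (auto simp: Sing_def)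
  then show "ut z = ts n z" "uxx z = xxs n z" "a z = ts n z / xxs n z"
    using stable[OF exit(1)[OF nS] exit(2)[OF assms]] by (simp_all add: ut_def uxx_def a_def)
qed

lemma Sing_exits: "z \<notin> Sing \<Longrightarrow> \<exists>n. z \<notin> Box n" by (auto simp: Sing_def)

lemma a_bounds: "\<kappa> \<le> a z" "a z \<le> 1 / \<kappa>"
proof -
  have "\<kappa> \<le> a z \<and> a z \<le> 1 / \<kappa>"
  proof (cases "z \<in> Sing")
    case True then show ?thesis using kappa by (simp add: a_def)
  next
    case False
    then obtain n where "z \<notin> Box n" using Sing_exits by blast
    then show ?thesis
      using ratio[where m = n and z = z] pos(4)[where m = n and z = z] kappa by (simp add: off_limits field_simps)
  qed
  then show "\<kappa> \<le> a z" "a z \<le> 1 / \<kappa>" by auto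
qed

lemma equation: "z \<notin> Sing \<Longrightarrow> ut z - a z * uxx z = 0"
  using Sing_exits[of z] pos(4)[of _ z] by (auto simp: off_limits less_le)

text \<open>The open sets \<open>- Box n\<close> exhaust the complement of \<open>Sing\<close>, and
  on each of them \<open>u\<close> is a stage function and \<open>a\<close> a quotient of smooth
  functions with positive denominator.\<close>

lemma smooth_off_Sing: "smooth_on (- Sing) u" "smooth_on (- Sing) a"
proof -
  have o: "open (- Box n)" for n using compact_imp_closed[OF compact_Box] by (simp add: open_Compl)
  have "smooth_on (- Box n) u \<and> smooth_on (- Box n) a" for n
  proof
    show "smooth_on (- Box n) u"
      using smooth_on_cong[OF o, of n u "us n"] smooth_on_subset[OF smooth_us[of n], of "- Box n"]
      by (simp add: off_limits)
    have "smooth_on (- Box n) (\<lambda>z. ts n z / xxs n z)"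
      using pos(4) by (intro smooth_on_divide o)
        (auto intro: smooth_on_subset[OF smooth_ts] smooth_on_subset[OF smooth_xxs] simp: less_le)
    then show "smooth_on (- Box n) a"
      using smooth_on_cong[OF o, of n a "\<lambda>z. ts n z / xxs n z"] by (simp add: off_limits)
  qed
  then have ex: "\<exists>U. open U \<and> z \<in> U \<and> smooth_on U u" "\<exists>U. open U \<and> z \<in> U \<and> smooth_on U a"
    if "z \<in> - Sing" for z
    using o Sing_exits[of z] that by (metis ComplD ComplI)+
  show "smooth_on (- Sing) u" by (rule smooth_on_local) (rule ex(1))
  show "smooth_on (- Sing) a" by (rule smooth_on_local) (rule ex(2))
qed

lemma continuous_limits: "continuous_on UNIV u" "continuous_on UNIV ux"
proof -
  have ul: "uniform_limit UNIV (\<lambda>m z. \<Sum>n<m. term_u n z) (\<lambda>z. \<Sum>n. term_u n z) sequentially"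
    "uniform_limit UNIV (\<lambda>m z. \<Sum>n<m. term_x n z) (\<lambda>z. \<Sum>n. term_x n z) sequentially"
    using term_small summable_half(1) by (auto intro!: Weierstrass_m_test)
  have c: "continuous_on UNIV (\<lambda>z. \<Sum>n<m. term_u n z)" "continuous_on UNIV (\<lambda>z. \<Sum>n<m. term_x n z)" for m
  proof -
    have "(\<lambda>z. \<Sum>n<m. term_u n z) = (\<lambda>z. us m z - V * (fst z + (snd z)\<^sup>2 / 2))"
      "(\<lambda>z. \<Sum>n<m. term_x n z) = (\<lambda>z. xs m z - V * snd z)" by (auto simp: us_def xs_def)
    then show "continuous_on UNIV (\<lambda>z. \<Sum>n<m. term_u n z)" "continuous_on UNIV (\<lambda>z. \<Sum>n<m. term_x n z)"
      using smooth_on_continuous[OF smooth_us[of m]] smooth_on_continuous[OF smooth_xs[of m]]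
      by (simp_all only:) (auto intro!: continuous_intros)
  qed
  have "continuous_on UNIV (\<lambda>z. \<Sum>n. term_u n z)" "continuous_on UNIV (\<lambda>z. \<Sum>n. term_x n z)"
    using uniform_limit_theorem[OF _ ul(1)] uniform_limit_theorem[OF _ ul(2)] c by auto
  then show "continuous_on UNIV u" "continuous_on UNIV ux"
    unfolding u_def[abs_def] ux_def[abs_def] by (auto intro!: continuous_intros)
qed

lemma u_DERIV: "((\<lambda>y. u (t, y)) has_real_derivative ux (t, x)) (at x)"
proof -
  have "((\<lambda>y. \<Sum>n. term_u n (t, y)) has_real_derivative (\<Sum>n. term_x n (t, x))) (at x)"
  proof (rule has_field_derivative_series'(2)[where S = UNIV and x0 = x])
    show "((\<lambda>y. term_u n (t, y)) has_real_derivative term_x n (t, y)) (at y within UNIV)" for n y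
      unfolding term_u_def term_x_def fst_conv snd_conv
      using smooth1_DERIV[OF smooths(2)] smooth1_DERIV[OF smooths(3)]
      by (auto intro!: derivative_eq_intros)
    show "uniformly_convergent_on UNIV (\<lambda>n y. \<Sum>i<n. term_x i (t, y))"
      using term_small(2) summable_half(1) by (auto intro!: Weierstrass_m_test')
  qed (use summable_terms in auto)
  then show ?thesis
    unfolding u_def ux_def fst_conv snd_conv by (auto intro!: derivative_eq_intros)
qed

lemma us_bound: "\<bar>us m z - V * (fst z + (snd z)\<^sup>2 / 2)\<bar> \<le> 4" "\<bar>xs m z - V * snd z\<bar> \<le> 4"
proof -
  have s: "(\<Sum>n<m. 2 / (2::real) ^ n) \<le> 4"
    using sum_le_suminf[OF summable_half(1), of "{..<m}"] by (simp add: summable_half)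
  have "\<bar>\<Sum>n<m. term_u n z\<bar> \<le> (\<Sum>n<m. 2 / 2 ^ n)" "\<bar>\<Sum>n<m. term_x n z\<bar> \<le> (\<Sum>n<m. 2 / 2 ^ n)"
    by (rule sum_norm_le[where 'a = real, unfolded real_norm_def], rule term_small)+
  then show "\<bar>us m z - V * (fst z + (snd z)\<^sup>2 / 2)\<bar> \<le> 4" "\<bar>xs m z - V * snd z\<bar> \<le> 4"
    using s by (auto simp: us_def xs_def)
qed

end


section \<open>Integration\<close>

lemma borel_lebesgue: "f \<in> borel_measurable borel \<Longrightarrow> f \<in> borel_measurable lebesgue"
  for f :: "real \<times> real \<Rightarrow> real"
  by (intro measurable_completion) simp

lemma borel_lebesgue_on: "f \<in> borel_measurable borel \<Longrightarrow> f \<in> borel_measurable (lebesgue_on S)"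
  for f :: "real \<times> real \<Rightarrow> real"
  by (intro measurable_restrict_space1 borel_lebesgue)

lemma measure_lebesgue_Times:
  fixes A B :: "real set"
  assumes "compact A" "compact B"
  shows "measure lebesgue (A \<times> B) = measure lebesgue A * measure lebesgue B"
proof -
  have b: "A \<in> sets borel" "B \<in> sets borel" using assms by (auto intro: borel_compact)
  have "compact (A \<times> B)" using assms by (rule compact_Times)
  then have c: "A \<times> B \<in> sets borel" by (rule borel_compact)
  have "emeasure lborel (A \<times> B) = emeasure (lborel \<Otimes>\<^sub>M lborel) (A \<times> B)" by (simp add: lborel_prod)
  also have "\<dots> = emeasure lborel A * emeasure lborel B"
    using b by (intro lborel.emeasure_pair_measure_Times) auto
  finally have "measure lborel (A \<times> B) = measure lborel A * measure lborel B"
    by (simp add: measure_def enn2real_mult)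
  then show ?thesis using b c by (simp add: measure_completion)
qed

lemma continuous_compact_support_integrable:
  fixes f :: "real \<times> real \<Rightarrow> real"
  assumes "continuous_on UNIV f" "compact K" "\<And>z. z \<notin> K \<Longrightarrow> f z = 0"
  shows "integrable lborel f"
proof -
  have "integrable lborel (\<lambda>z. indicator K z *\<^sub>R f z)"
    by (rule borel_integrable_compact[OF assms(2), unfolded set_integrable_def])
      (use assms(1) continuous_on_subset in blast)
  moreover have "(\<lambda>z. indicator K z *\<^sub>R f z) = f"
  proof
    show "indicator K z *\<^sub>R f z = f z" for z using assms(3)[of z] by (cases "z \<in> K") auto
  qed
  ultimately show ?thesis by simp
qed

lemma compact_support_integral_deriv:
  fixes F :: "real \<Rightarrow> real"
  assumes "\<And>t. (F has_real_derivative f t) (at t)" "continuous_on UNIV f" "\<And>t. \<bar>t\<bar> \<ge> R \<Longrightarrow> F t = 0" "0 < R"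
    "\<And>t. \<bar>t\<bar> > R \<Longrightarrow> f t = 0"
  shows "(\<integral>t. f t \<partial>lborel) = 0"
proof -
  have "(\<integral>t. f t * indicator {-R..R} t \<partial>lborel) = F R - F (- R)"
  proof (rule integral_FTC_Icc_real)
    show "- R \<le> R" using assms(4) by simp
    show "\<And>x. - R \<le> x \<Longrightarrow> x \<le> R \<Longrightarrow> DERIV F x :> f x" using assms(1) by blast
    show "\<And>x. - R \<le> x \<Longrightarrow> x \<le> R \<Longrightarrow> isCont f x"
      using assms(2) by (simp add: continuous_on_eq_continuous_at)
  qed
  moreover have "(\<lambda>t. f t * indicator {-R..R} t) = f"
  proof
    show "f t * indicator {-R..R} t = f t" for t using assms(5)[of t] by (cases "\<bar>t\<bar> > R") (auto simp: indicator_def)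
  qed
  ultimately show ?thesis using assms(3)[of R] assms(3)[of "-R"] assms(4) by simp
qed

text \<open>Fubini, integrating first in the differentiated variable, where the fundamental theorem
  of calculus gives 0.\<close>

lemma integral_pd_zero:
  assumes F: "smooth_on UNIV F" and K: "compact K" "\<And>z. z \<notin> K \<Longrightarrow> F z = 0"
  shows "integrable lborel (pd_t F)" "integrable lborel (pd_x F)"
    and "(\<integral>z. pd_t F z \<partial>lborel) = 0" "(\<integral>z. pd_x F z \<partial>lborel) = 0"
proof -
  obtain R where R: "0 < R" "\<And>z. z \<in> K \<Longrightarrow> norm z < R"
    using compact_imp_bounded[OF K(1)] by (metis bounded_pos_less)
  have out: "F (t, x) = 0" if "R \<le> \<bar>t\<bar> \<or> R \<le> \<bar>x\<bar>" for t x
  proof (rule K(2))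
    have "\<bar>t\<bar> \<le> norm (t, x)" "\<bar>x\<bar> \<le> norm (t, x)"
      using norm_fst_le[of t x] norm_snd_le[of x t] by auto
    then show "(t, x) \<notin> K" using R(2)[of "(t, x)"] that by auto
  qed
  have D: "((\<lambda>s. F (s, x)) has_real_derivative pd_t F (t, x)) (at t)"
    "((\<lambda>y. F (t, y)) has_real_derivative pd_x F (t, x)) (at x)" for t x
    using pd_derivs[OF smooth_on_differentiable[OF F, of "(t, x)"]] by auto
  have c: "continuous_on UNIV (pd_t F)" "continuous_on UNIV (pd_x F)"
    using F smooth_on_pd smooth_on_continuous by blast+
  \<comment> \<open>Outside the ball of radius \<open>2 * R\<close> one of the coordinates exceeds
    \<open>R\<close> in absolute value, and \<open>F\<close> vanishes near such a point.\<close>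
  have z: "pd_t F z = 0" "pd_x F z = 0" if "z \<notin> cball 0 (2 * R)" for z
  proof -
    have n: "2 * R < \<bar>fst z\<bar> + \<bar>snd z\<bar>"
      using that sqrt_sum_squares_le_sum_abs[of "fst z" "snd z"] by (auto simp: norm_prod_def)
    have "pd_t F z = 0 \<and> pd_x F z = 0"
    proof (cases "R < \<bar>fst z\<bar>")
      case True
      have "(\<lambda>y. F (fst z, y)) = (\<lambda>_. 0)" using out True by auto
      then have "pd_x F z = 0" by (simp add: pd_x_def)
      moreover have "deriv (\<lambda>s. F (s, snd z)) (fst z) = 0"
        by (rule deriv_zero_outside[where K = "{-R..R}"]) (use out True in \<open>auto simp: abs_if split: if_splits\<close>)
      ultimately show ?thesis by (simp add: pd_t_def)
    next
      case False
      then have s: "R < \<bar>snd z\<bar>" using n by simp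
      have "(\<lambda>t. F (t, snd z)) = (\<lambda>_. 0)" using out s by auto
      then have "pd_t F z = 0" by (simp add: pd_t_def)
      moreover have "deriv (\<lambda>y. F (fst z, y)) (snd z) = 0"
        by (rule deriv_zero_outside[where K = "{-R..R}"]) (use out s in \<open>auto simp: abs_if split: if_splits\<close>)
      ultimately show ?thesis by (simp add: pd_x_def)
    qed
    then show "pd_t F z = 0" "pd_x F z = 0" by auto
  qed
  show it: "integrable lborel (pd_t F)"
    by (rule continuous_compact_support_integrable[OF c(1) compact_cball]) (rule z(1))
  show ix: "integrable lborel (pd_x F)"
    by (rule continuous_compact_support_integrable[OF c(2) compact_cball]) (rule z(2))
  have sec: "continuous_on UNIV (\<lambda>t. pd_t F (t, x))" "continuous_on UNIV (\<lambda>x. pd_x F (t, x))" for t x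
    by (rule continuous_on_compose2[OF c(1)] continuous_on_compose2[OF c(2)]; intro continuous_intros subset_UNIV)+
  have zt: "pd_t F (t, x) = 0" if "\<bar>t\<bar> > R" for t x
    unfolding pd_t_def fst_conv snd_conv
    by (rule deriv_zero_outside[where K = "cball 0 R"]) (use that in \<open>auto intro!: out\<close>)
  have zx: "pd_x F (t, x) = 0" if "\<bar>x\<bar> > R" for t x
    unfolding pd_x_def fst_conv snd_conv
    by (rule deriv_zero_outside[where K = "cball 0 R"]) (use that in \<open>auto intro!: out\<close>)
  have it': "integrable (lborel \<Otimes>\<^sub>M lborel) (\<lambda>(t, x). pd_t F (t, x))"
    and ix': "integrable (lborel \<Otimes>\<^sub>M lborel) (\<lambda>(t, x). pd_x F (t, x))"
    using it ix by (simp_all add: lborel_prod)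
  have "(\<integral>z. pd_t F z \<partial>lborel) = (\<integral>z. (\<lambda>(t, x). pd_t F (t, x)) z \<partial>(lborel \<Otimes>\<^sub>M lborel))"
    by (simp add: lborel_prod)
  also have "\<dots> = (\<integral>x. (\<integral>t. pd_t F (t, x) \<partial>lborel) \<partial>lborel)"
    by (rule lborel_pair.integral_snd[OF it', symmetric])
  also have "\<dots> = 0"
    using compact_support_integral_deriv[OF D(1) sec(1) _ R(1) zt] out by simp
  finally show "(\<integral>z. pd_t F z \<partial>lborel) = 0" .
  have "(\<integral>z. pd_x F z \<partial>lborel) = (\<integral>z. (\<lambda>(t, x). pd_x F (t, x)) z \<partial>(lborel \<Otimes>\<^sub>M lborel))"
    by (simp add: lborel_prod)
  also have "\<dots> = (\<integral>t. (\<integral>x. pd_x F (t, x) \<partial>lborel) \<partial>lborel)"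
    by (rule lborel_pair.integral_fst[OF ix', symmetric])
  also have "\<dots> = 0"
    using compact_support_integral_deriv[OF D(2) sec(2) _ R(1) zx] out by simp
  finally show "(\<integral>z. pd_x F z \<partial>lborel) = 0" .
qed

lemma integral_lebesgue_on_lborel:
  fixes f :: "real \<times> real \<Rightarrow> real"
  assumes "S \<in> sets borel" "f \<in> borel_measurable borel" "\<And>z. z \<notin> S \<Longrightarrow> f z = 0"
  shows "(\<integral>z. f z \<partial>lebesgue_on S) = (\<integral>z. f z \<partial>lborel)"
proof -
  have "(\<integral>z. f z \<partial>lebesgue_on S) = (\<integral>z. indicator S z *\<^sub>R f z \<partial>lebesgue)"
    using assms(1) by (subst integral_restrict_space) auto
  also have "(\<lambda>z. indicator S z *\<^sub>R f z) = f"
  proof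
    show "indicator S z *\<^sub>R f z = f z" for z using assms(3)[of z] by (cases "z \<in> S") auto
  qed
  also have "(\<integral>z. f z \<partial>lebesgue) = (\<integral>z. f z \<partial>lborel)"
    using assms(2) by (intro integral_completion) simp
  finally show ?thesis .
qed

lemma Q_cyl_facts: "open Q_cyl" "Q_cyl \<in> sets borel" "Q_cyl \<in> lmeasurable" "bounded Q_cyl"
proof -
  show o: "open Q_cyl" unfolding Q_cyl_def by (intro open_Times) auto
  show b: "bounded Q_cyl" unfolding Q_cyl_def by (intro bounded_Times) auto
  show "Q_cyl \<in> sets borel" using o by simp
  show "Q_cyl \<in> lmeasurable" using o b by (rule lmeasurable_open[rotated])
qed

lemma finite_measure_Q: "finite_measure (lebesgue_on Q_cyl)"
  using Q_cyl_facts(3) by (rule finite_measure_lebesgue_on)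

lemma test_functionD:
  assumes "\<psi> \<in> test_functions Q_cyl"
  shows "smooth_on UNIV \<psi>" "compact (closure {z. \<psi> z \<noteq> 0})" "closure {z. \<psi> z \<noteq> 0} \<subseteq> Q_cyl"
    "z \<notin> Q_cyl \<Longrightarrow> \<psi> z = 0" "z \<notin> Q_cyl \<Longrightarrow> pd_t \<psi> z = 0" "z \<notin> Q_cyl \<Longrightarrow> pd_x \<psi> z = 0"
    "\<exists>M. \<forall>z. \<bar>\<psi> z\<bar> \<le> M \<and> \<bar>pd_t \<psi> z\<bar> \<le> M \<and> \<bar>pd_x \<psi> z\<bar> \<le> M"
proof -
  let ?K = "closure {z. \<psi> z \<noteq> 0}"
  show s: "smooth_on UNIV \<psi>" and K: "compact ?K" "?K \<subseteq> Q_cyl"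
    using assms by (auto simp: test_functions_def compactly_inside_def)
  have z: "\<psi> z = 0 \<and> pd_t \<psi> z = 0 \<and> pd_x \<psi> z = 0" if "z \<notin> ?K" for z
  proof -
    have o: "open (- ?K)" by (simp add: open_Compl)
    have e: "\<psi> y = 0" if "y \<in> - ?K" for y using that closure_subset[of "{z. \<psi> z \<noteq> 0}"] by auto
    obtain A B where AB: "open A" "open B" "z \<in> A \<times> B" "A \<times> B \<subseteq> - ?K"
      using open_prod_elim[OF o, of z] \<open>z \<notin> ?K\<close> by auto
    have zAB: "fst z \<in> A" "snd z \<in> B" using AB(3) by (auto simp: mem_Times_iff)
    have e': "\<psi> (s, y) = 0" if "s \<in> A" "y \<in> B" for s y
      using AB(4) that by (intro e) blast
    have "deriv (\<lambda>s. \<psi> (s, snd z)) (fst z) = 0"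
      by (rule deriv_zero_outside[where K = "- A"]) (simp_all add: AB(1) zAB e' closed_Compl)
    moreover have "deriv (\<lambda>y. \<psi> (fst z, y)) (snd z) = 0"
      by (rule deriv_zero_outside[where K = "- B"]) (simp_all add: AB(2) zAB e' closed_Compl)
    moreover have "\<psi> z = 0" using that by (intro e) simp
    ultimately show ?thesis by (simp add: pd_t_def pd_x_def)
  qed
  show "z \<notin> Q_cyl \<Longrightarrow> \<psi> z = 0" "z \<notin> Q_cyl \<Longrightarrow> pd_t \<psi> z = 0" "z \<notin> Q_cyl \<Longrightarrow> pd_x \<psi> z = 0"
    using z K(2) by blast+
  have "bounded (f ` ?K)" if "smooth_on UNIV f" for f
    using K(1) continuous_on_subset[OF smooth_on_continuous[OF that] subset_UNIV]
    by (intro compact_imp_bounded compact_continuous_image)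
  from this[OF s] this[OF smooth_on_pd(1)[OF s]] this[OF smooth_on_pd(2)[OF s]]
  obtain a b c where "\<forall>z\<in>?K. \<bar>\<psi> z\<bar> \<le> a" "\<forall>z\<in>?K. \<bar>pd_t \<psi> z\<bar> \<le> b" "\<forall>z\<in>?K. \<bar>pd_x \<psi> z\<bar> \<le> c"
    by (auto simp: bounded_real)
  then have "\<bar>\<psi> z\<bar> \<le> max 0 (max a (max b c)) \<and> \<bar>pd_t \<psi> z\<bar> \<le> max 0 (max a (max b c)) \<and> \<bar>pd_x \<psi> z\<bar> \<le> max 0 (max a (max b c))" for z
    using z[of z] by (cases "z \<in> ?K") (force simp: le_max_iff_disj)+
  then show "\<exists>M. \<forall>z. \<bar>\<psi> z\<bar> \<le> M \<and> \<bar>pd_t \<psi> z\<bar> \<le> M \<and> \<bar>pd_x \<psi> z\<bar> \<le> M" by blast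
qed

text \<open>The product with a test function has compact support, so its partial derivatives
  integrate to 0; the product rule then separates the two terms.\<close>

lemma integration_by_parts:
  assumes f: "smooth_on UNIV f" and \<psi>: "\<psi> \<in> test_functions Q_cyl"
  shows "(\<integral>z. f z * pd_t \<psi> z \<partial>lebesgue_on Q_cyl) = - (\<integral>z. pd_t f z * \<psi> z \<partial>lebesgue_on Q_cyl)"
    and "(\<integral>z. f z * pd_x \<psi> z \<partial>lebesgue_on Q_cyl) = - (\<integral>z. pd_x f z * \<psi> z \<partial>lebesgue_on Q_cyl)"
proof -
  note t = test_functionD[OF \<psi>]
  let ?K = "closure {z. \<psi> z \<noteq> 0}"
  have z0: "\<psi> z = 0" if "z \<notin> ?K" for z using that closure_subset[of "{z. \<psi> z \<noteq> 0}"] by auto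
  have F: "smooth_on UNIV (\<lambda>z. f z * \<psi> z)" using f t(1) by (intro smooth_on_mult) auto
  have Fz: "f z * \<psi> z = 0" if "z \<notin> ?K" for z by (simp only: z0[OF that] mult_zero_right)
  note I = integral_pd_zero[OF F t(2) Fz, simplified]
  have pd: "pd_t (\<lambda>z. f z * \<psi> z) = (\<lambda>z. pd_t f z * \<psi> z + f z * pd_t \<psi> z)"
    "pd_x (\<lambda>z. f z * \<psi> z) = (\<lambda>z. pd_x f z * \<psi> z + f z * pd_x \<psi> z)"
    using smooth_on_differentiable[OF f] smooth_on_differentiable[OF t(1)] by (auto simp: pd_mult)
  have c: "continuous_on UNIV f" "continuous_on UNIV \<psi>" "continuous_on UNIV (pd_t f)" "continuous_on UNIV (pd_x f)"
    "continuous_on UNIV (pd_t \<psi>)" "continuous_on UNIV (pd_x \<psi>)"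
    using smooth_on_continuous[OF f] smooth_on_continuous[OF t(1)]
      smooth_on_pd[OF f, THEN smooth_on_continuous] smooth_on_pd[OF t(1), THEN smooth_on_continuous] by simp_all
  have m: "(\<lambda>z. pd_t f z * \<psi> z) \<in> borel_measurable borel" "(\<lambda>z. f z * pd_t \<psi> z) \<in> borel_measurable borel"
    "(\<lambda>z. pd_x f z * \<psi> z) \<in> borel_measurable borel" "(\<lambda>z. f z * pd_x \<psi> z) \<in> borel_measurable borel"
    using c by (auto intro!: borel_measurable_continuous_onI continuous_intros)
  have i: "integrable lborel (\<lambda>z. pd_t f z * \<psi> z)" "integrable lborel (\<lambda>z. pd_x f z * \<psi> z)"
  proof -
    have "integrable lborel (\<lambda>z. k z * \<psi> z)" if "continuous_on UNIV k" for k
    proof (rule continuous_compact_support_integrable[OF _ t(2)])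
      show "continuous_on UNIV (\<lambda>z. k z * \<psi> z)" using that c(2) by (rule continuous_on_mult)
      show "k z * \<psi> z = 0" if "z \<notin> ?K" for z by (simp only: z0[OF that] mult_zero_right)
    qed
    then show "integrable lborel (\<lambda>z. pd_t f z * \<psi> z)" "integrable lborel (\<lambda>z. pd_x f z * \<psi> z)"
      using c by simp_all
  qed
  have i2: "integrable lborel (\<lambda>z. f z * pd_t \<psi> z)" "integrable lborel (\<lambda>z. f z * pd_x \<psi> z)"
    using Bochner_Integration.integrable_diff[OF I(1)[unfolded pd] i(1)]
      Bochner_Integration.integrable_diff[OF I(2)[unfolded pd] i(2)] by simp_all
  have "(\<integral>z. pd_t f z * \<psi> z \<partial>lborel) + (\<integral>z. f z * pd_t \<psi> z \<partial>lborel) = 0"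
    "(\<integral>z. pd_x f z * \<psi> z \<partial>lborel) + (\<integral>z. f z * pd_x \<psi> z \<partial>lborel) = 0"
    using I(3,4) i i2 by (simp_all add: pd)
  then show "(\<integral>z. f z * pd_t \<psi> z \<partial>lebesgue_on Q_cyl) = - (\<integral>z. pd_t f z * \<psi> z \<partial>lebesgue_on Q_cyl)"
    "(\<integral>z. f z * pd_x \<psi> z \<partial>lebesgue_on Q_cyl) = - (\<integral>z. pd_x f z * \<psi> z \<partial>lebesgue_on Q_cyl)"
    using m t(4-6) by (simp_all add: integral_lebesgue_on_lborel[OF Q_cyl_facts(2)])
qed

text \<open>Dominated convergence on both sides of an integration by parts. The functions are
  bounded by a constant, their derivatives only by an integrable \<open>H\<close> and almost
  everywhere, since in the application they are unbounded near the singular set.\<close>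

lemma weak_pd_limit:
  fixes f g :: "nat \<Rightarrow> real \<times> real \<Rightarrow> real" and F G H \<psi> d\<psi> :: "real \<times> real \<Rightarrow> real"
  assumes f: "\<And>m. f m \<in> borel_measurable borel" and g: "\<And>m. g m \<in> borel_measurable borel"
    and \<phi>: "F \<in> borel_measurable borel" "G \<in> borel_measurable borel"
    and fF: "\<And>z. (\<lambda>m. f m z) \<longlonglongrightarrow> F z" and fb: "\<And>m z. z \<in> Q_cyl \<Longrightarrow> \<bar>f m z\<bar> \<le> C"
    and gG: "AE z in lebesgue_on Q_cyl. (\<lambda>m. g m z) \<longlonglongrightarrow> G z"
    and gb: "\<And>m. AE z in lebesgue_on Q_cyl. \<bar>g m z\<bar> \<le> H z" and H: "integrable (lebesgue_on Q_cyl) H"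
    and \<psi>: "\<psi> \<in> borel_measurable borel" "d\<psi> \<in> borel_measurable borel" "\<And>z. \<bar>\<psi> z\<bar> \<le> M" "\<And>z. \<bar>d\<psi> z\<bar> \<le> M"
    and eq: "\<And>m. (\<integral>z. f m z * d\<psi> z \<partial>lebesgue_on Q_cyl) = - (\<integral>z. g m z * \<psi> z \<partial>lebesgue_on Q_cyl)"
  shows "(\<integral>z. F z * d\<psi> z \<partial>lebesgue_on Q_cyl) = - (\<integral>z. G z * \<psi> z \<partial>lebesgue_on Q_cyl)"
proof -
  interpret finite_measure "lebesgue_on Q_cyl" by (rule finite_measure_Q)
  note mm = borel_lebesgue_on
  have M: "0 \<le> M" using order_trans[OF abs_ge_zero \<psi>(3)] .
  have l: "(\<lambda>m. \<integral>z. f m z * d\<psi> z \<partial>lebesgue_on Q_cyl) \<longlonglongrightarrow> (\<integral>z. F z * d\<psi> z \<partial>lebesgue_on Q_cyl)"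
  proof (rule integral_dominated_convergence[where w = "\<lambda>_. C * M"])
    show "AE z in lebesgue_on Q_cyl. norm (f m z * d\<psi> z) \<le> C * M" for m
    proof (rule AE_I2)
      fix z assume "z \<in> space (lebesgue_on Q_cyl)"
      then have "z \<in> Q_cyl" by (simp add: space_restrict_space)
      from fb[OF this, of m] show "norm (f m z * d\<psi> z) \<le> C * M"
        using \<psi>(4)[of z] abs_ge_zero[of "f m z"] unfolding real_norm_def abs_mult
        by (intro mult_mono) linarith+
    qed
    show "AE z in lebesgue_on Q_cyl. (\<lambda>m. f m z * d\<psi> z) \<longlonglongrightarrow> F z * d\<psi> z"
      using fF by (intro AE_I2 tendsto_mult tendsto_const)
  qed (use f \<phi> \<psi> in \<open>auto intro!: mm borel_measurable_times\<close>)
  have r: "(\<lambda>m. \<integral>z. g m z * \<psi> z \<partial>lebesgue_on Q_cyl) \<longlonglongrightarrow> (\<integral>z. G z * \<psi> z \<partial>lebesgue_on Q_cyl)"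
  proof (rule integral_dominated_convergence[where w = "\<lambda>z. H z * M"])
    show "AE z in lebesgue_on Q_cyl. norm (g m z * \<psi> z) \<le> H z * M" for m
      using gb[of m]
    proof eventually_elim
      case (elim z)
      then show ?case
        using \<psi>(3)[of z] abs_ge_zero[of "g m z"] unfolding real_norm_def abs_mult
        by (intro mult_mono) linarith+
    qed
    show "AE z in lebesgue_on Q_cyl. (\<lambda>m. g m z * \<psi> z) \<longlonglongrightarrow> G z * \<psi> z"
      using gG by eventually_elim (intro tendsto_mult tendsto_const)
    show "integrable (lebesgue_on Q_cyl) (\<lambda>z. H z * M)" using H by simp
  qed (use g \<phi> \<psi> in \<open>auto intro!: mm borel_measurable_times\<close>)
  show ?thesis using LIMSEQ_unique[OF l] tendsto_minus[OF r] eq by simp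
qed

lemma locally_integrable_I:
  assumes "integrable (lebesgue_on Q_cyl) f"
  shows "locally_integrable_on f Q_cyl"
  unfolding locally_integrable_on_def
proof (intro allI impI)
  fix K assume K: "compact K \<and> K \<subseteq> Q_cyl"
  have "f absolutely_integrable_on Q_cyl"
    using assms Q_cyl_facts(3) by (simp add: integrable_restrict_space set_integrable_def fmeasurableD)
  then show "f absolutely_integrable_on K"
    by (rule set_integrable_subset) (simp_all add: K lmeasurable_compact fmeasurableD)
qed


section \<open>Size of the second derivative\<close>

locale singular_staircase = staircase +
  fixes p m0 m1 :: real and D :: "(real \<times> real) set"
  assumes p_def: "p = 2 / (1 - \<kappa>)" and m0: "0 < m0"
    and Box_lower: "\<And>n. m0 * (real n + 1) powr - p \<le> measure lebesgue (Box n)"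
    and Box_upper: "\<And>n. measure lebesgue (Box n) \<le> m1 * (real n + 1) powr - p"
    and Box_D: "Box 0 \<subseteq> D" and D_Q: "D \<subseteq> Q_cyl" and open_D: "open D"
begin

lemma p_gt: "2 < p" using kappa by (simp add: p_def field_simps)

lemma m1: "0 < m1"
  using Box_lower[of 0] Box_upper[of 0] m0 by simp

lemma Box_subset: "Box n \<subseteq> D" "Box n \<subseteq> Q_cyl"
  using Box_mono[of 0 n] Box_D D_Q by auto

lemma Box_lmeasurable: "Box n \<in> lmeasurable"
  using compact_Box by (rule lmeasurable_compact)

lemma Sing_lmeasurable: "Sing \<in> lmeasurable"
  using compact_Sing by (rule lmeasurable_compact)

lemma D_lmeasurable: "D \<in> lmeasurable"
  using open_D bounded_subset[OF Q_cyl_facts(4) D_Q] by (intro lmeasurable_open)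

lemma Sing_null: "Sing \<in> null_sets lebesgue"
proof -
  have "filterlim (\<lambda>n. 1 + real n) at_top sequentially"
    by (rule filterlim_tendsto_add_at_top[OF tendsto_const filterlim_real_sequentially])
  then have "(\<lambda>n. (1 + real n) powr - p) \<longlonglongrightarrow> 0" using p_gt by (intro tendsto_neg_powr) auto
  then have "(\<lambda>n. m1 * (real n + 1) powr - p) \<longlonglongrightarrow> m1 * 0"
    by (intro tendsto_mult tendsto_const) (simp add: add.commute)
  moreover have "measure lebesgue Sing \<le> m1 * (real n + 1) powr - p" for n
    using measure_mono_fmeasurable[OF Sing_subset[of n] _ Box_lmeasurable] Sing_lmeasurable Box_upper[of n]
    by (auto dest: fmeasurableD)
  ultimately have "measure lebesgue Sing \<le> m1 * 0"
    by (intro LIMSEQ_le_const) auto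
  then have "measure lebesgue Sing = 0" using measure_nonneg[of lebesgue Sing] by simp
  then show ?thesis
    using Sing_lmeasurable negligible_iff_measure0[OF Sing_lmeasurable] by (simp add: negligible_iff_null_sets)
qed

lemma AE_off_Sing: "AE z in lebesgue_on S. z \<notin> Sing" if "S \<in> sets lebesgue"
  using AE_not_in[OF Sing_null] that by (subst AE_restrict_space_iff) auto

text \<open>The common properties of the pairs \<open>(ts, ut)\<close> and
  \<open>(xxs, uxx)\<close>, isolated so that the size estimates are proved once for both
  derivatives.\<close>

definition is_profile :: "(nat \<Rightarrow> real \<times> real \<Rightarrow> real) \<Rightarrow> (real \<times> real \<Rightarrow> real) \<Rightarrow> bool" where
  "is_profile F f \<longleftrightarrow> (\<forall>m. continuous_on UNIV (F m)) \<and> (\<forall>z\<in>Sing. f z = 0) \<and>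
     (\<forall>n z. z \<notin> Box n \<longrightarrow> f z = F n z) \<and> (\<forall>n m z. z \<notin> Box n \<longrightarrow> n \<le> m \<longrightarrow> F m z = F n z) \<and>
     (\<forall>m z. z \<in> Box m \<longrightarrow> F m z = v m) \<and> (\<forall>k m z. z \<in> Box k \<longrightarrow> k \<le> m \<longrightarrow> \<kappa> * v k \<le> F m z) \<and>
     (\<forall>k m z. z \<notin> Box k \<longrightarrow> F m z \<le> v k + 1) \<and> (\<forall>m z. 0 < F m z)"

lemma profiles: "is_profile ts ut" "is_profile xxs uxx"
proof -
  have c: "continuous_on UNIV (ts m)" "continuous_on UNIV (xxs m)" for m
    using smooth_ts smooth_xxs smooth_on_continuous by blast+
  show "is_profile ts ut"
    unfolding is_profile_def
    by (intro conjI allI ballI impI; (rule c off_limits stable in_Box lower upper pos)?) (simp_all add: ut_def)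
  show "is_profile xxs uxx"
    unfolding is_profile_def
    by (intro conjI allI ballI impI; (rule c off_limits stable in_Box lower upper pos)?) (simp_all add: uxx_def)
qed

context
  fixes F f assumes profile: "is_profile F f"
begin

lemma profileD:
  "continuous_on UNIV (F m)" "z \<in> Sing \<Longrightarrow> f z = 0" "z \<notin> Box n \<Longrightarrow> f z = F n z"
  "z \<notin> Box n \<Longrightarrow> n \<le> m \<Longrightarrow> F m z = F n z" "z \<in> Box m \<Longrightarrow> F m z = v m"
  "z \<in> Box k \<Longrightarrow> k \<le> m \<Longrightarrow> \<kappa> * v k \<le> F m z" "z \<notin> Box k \<Longrightarrow> F m z \<le> v k + 1" "0 < F m z"
  by (use profile[unfolded is_profile_def] in blast)+

lemma profile_nonneg: "0 \<le> f z"
  using profileD(2)[of z] profileD(3)[of z] profileD(8)[of _ z] Sing_exits[of z] by (cases "z \<in> Sing") (auto simp: less_imp_le)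

lemma profile_upper: "z \<notin> Box k \<Longrightarrow> f z \<le> v k + 1"
  using profileD(3,7) by auto

lemma profile_lower:
  assumes "z \<in> Box k" "z \<notin> Sing" shows "\<kappa> * v k \<le> f z"
proof -
  obtain n where n: "z \<notin> Box n" using Sing_exits assms(2) by blast
  then have "k \<le> n" using assms(1) Box_mono[of n k] by (metis nat_le_linear subsetD)
  then show ?thesis using profileD(6)[OF assms(1)] profileD(3)[OF n] by simp
qed

lemma profile_F_le: "F m z \<le> v m + 1"
  using profileD(5)[of z m] profileD(7)[of z m m] by (cases "z \<in> Box m") auto

text \<open>On \<open>Box m\<close> the stage value is \<open>v m\<close> while the limit is at
  least \<open>\<kappa> * v m\<close>; elsewhere the two agree. This supplies the dominating
  function for the weak derivatives and bounds all stage integrals at once in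
  \<open>profile_not_Lp\<close>.\<close>

lemma profile_dominates:
  assumes "z \<notin> Sing" shows "F m z \<le> f z / \<kappa>"
proof (cases "z \<in> Box m")
  case True
  then show ?thesis using profile_lower[OF True assms] profileD(5) kappa by (simp add: field_simps)
next
  case False
  then show ?thesis using profileD(3)[of z m] profileD(8)[of m z] kappa by (simp add: field_simps mult_left_le_one_le)
qed

lemma profile_limit:
  assumes "z \<notin> Sing" shows "(\<lambda>m. F m z) \<longlonglongrightarrow> f z"
proof -
  obtain n where n: "z \<notin> Box n" using Sing_exits assms by blast
  show ?thesis
    by (rule tendsto_eventually, rule eventually_sequentiallyI[of n])
       (rule trans[OF profileD(4)[OF n] profileD(3)[OF n, symmetric]])
qed

lemma F_measurable: "F m \<in> borel_measurable borel"
  using profileD(1) by (rule borel_measurable_continuous_onI)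

lemma f_measurable: "f \<in> borel_measurable borel"
proof (rule borel_measurable_LIMSEQ_real)
  have "Sing \<in> sets borel" using compact_Sing by (rule borel_compact)
  then show "(\<lambda>z. indicator (- Sing) z * F m z) \<in> borel_measurable borel" for m
    using F_measurable by (intro borel_measurable_times borel_measurable_indicator) auto
  show "(\<lambda>m. indicator (- Sing) z * F m z) \<longlonglongrightarrow> f z" for z
    by (cases "z \<in> Sing") (simp_all add: profile_limit profileD(2))
qed

section \<open>Distribution function and integrability of the two unbounded derivatives\<close>

lemma superlevel_measurable: "{z \<in> D. \<tau> < f z} \<in> lmeasurable" "{z \<in> D. \<tau> < f z} \<in> sets lebesgue"
proof -
  have "{z \<in> D. \<tau> < f z} = D \<inter> {z \<in> space borel. \<tau> < f z}" by auto
  moreover have "{z \<in> space borel. \<tau> < f z} \<in> sets borel" using f_measurable by measurable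
  ultimately show s: "{z \<in> D. \<tau> < f z} \<in> sets lebesgue" using open_D by auto
  show "{z \<in> D. \<tau> < f z} \<in> lmeasurable"
    by (rule fmeasurableI2[OF D_lmeasurable _ s]) auto
qed

lemma tail_upper:
  assumes "2 * (V + 1) \<le> \<tau>"
  shows "measure lebesgue {z \<in> D. \<tau> < f z} \<le> (m1 * 2 powr p) * \<tau> powr - p"
proof -
  \<comment> \<open>The largest \<open>n\<close> with \<open>v n + 1 \<le> \<tau>\<close>, so a
    value above \<tau> forces the point into \<open>Box n\<close>; the assumption on \<tau> gives
    \<open>\<tau> / 2 \<le> n + 1\<close>.\<close>
  define n where "n = nat \<lfloor>\<tau> - V - 1\<rfloor>"
  have n: "real n \<le> \<tau> - V - 1" "\<tau> - V - 1 < real n + 1"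
    using assms V_pos by (auto simp: n_def of_nat_nat)
  have "{z \<in> D. \<tau> < f z} \<subseteq> Box n"
    using profile_upper[of _ n] n(1) by (force simp: v_def)
  then have "measure lebesgue {z \<in> D. \<tau> < f z} \<le> measure lebesgue (Box n)"
    by (intro measure_mono_fmeasurable superlevel_measurable Box_lmeasurable)
  also have "\<dots> \<le> m1 * (real n + 1) powr - p" by (rule Box_upper)
  also have "\<dots> \<le> m1 * (\<tau> / 2) powr - p"
    using m1 p_gt n assms V_pos by (intro mult_left_mono powr_mono2') auto
  also have "\<dots> = (m1 * 2 powr p) * \<tau> powr - p"
    using assms V_pos by (simp add: powr_divide powr_minus_divide)
  finally show ?thesis .
qed

lemma tail_lower:
  assumes "1 \<le> \<tau>"
  shows "(m0 * (3 / \<kappa>) powr - p) * \<tau> powr - p \<le> measure lebesgue {z \<in> D. \<tau> < f z}"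
proof -
  \<comment> \<open>Makes \<open>\<kappa> * v n\<close> exceed \<tau>; since
    \<open>\<tau> / \<kappa>\<close> is at least 1, also
    \<open>n + 1 \<le> 3 * (\<tau> / \<kappa>)\<close>.\<close>
  define n where "n = nat \<lceil>\<tau> / \<kappa>\<rceil>"
  have "0 \<le> \<tau> / \<kappa>" using assms kappa by simp
  then have n: "\<tau> / \<kappa> \<le> real n" "real n \<le> \<tau> / \<kappa> + 1"
    unfolding n_def by linarith+
  have t: "1 \<le> \<tau> / \<kappa>" using assms kappa by simp
  have "\<tau> \<le> \<kappa> * real n" using n(1) kappa by (simp add: field_simps)
  moreover have "0 < \<kappa> * V" using kappa V_pos by simp
  ultimately have "\<tau> < \<kappa> * v n" by (simp add: v_def distrib_left)
  then have sub: "Box n - Sing \<subseteq> {z \<in> D. \<tau> < f z}"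
    using profile_lower[of _ n] Box_subset(1)[of n] by force
  have "(m0 * (3 / \<kappa>) powr - p) * \<tau> powr - p = m0 * (3 * (\<tau> / \<kappa>)) powr - p"
    using assms kappa by (simp add: powr_divide powr_mult)
  also have "\<dots> \<le> m0 * (real n + 1) powr - p"
    using m0 p_gt n t by (intro mult_left_mono powr_mono2') auto
  also have "\<dots> \<le> measure lebesgue (Box n)" by (rule Box_lower)
  also have "\<dots> = measure lebesgue (Box n - Sing)"
    using Sing_null Box_lmeasurable by (simp add: measure_Diff_null_set)
  also have "\<dots> \<le> measure lebesgue {z \<in> D. \<tau> < f z}"
    using sub Box_lmeasurable Sing_lmeasurable by (intro measure_mono_fmeasurable superlevel_measurable) (auto dest: fmeasurableD)
  finally show ?thesis .
qed

lemma profile_tail: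
  "\<exists>c>0. \<exists>N>0. \<forall>\<^sub>F \<tau> in at_top.
     c * \<tau> powr - p \<le> measure lebesgue {z \<in> D. \<tau> < f z} \<and> measure lebesgue {z \<in> D. \<tau> < f z} \<le> N * \<tau> powr - p"
proof (intro exI conjI)
  show "0 < m0 * (3 / \<kappa>) powr - p" using m0 kappa by simp
  show "0 < m1 * 2 powr p" using m1 by simp
  show "\<forall>\<^sub>F \<tau> in at_top.
     (m0 * (3 / \<kappa>) powr - p) * \<tau> powr - p \<le> measure lebesgue {z \<in> D. \<tau> < f z} \<and>
     measure lebesgue {z \<in> D. \<tau> < f z} \<le> (m1 * 2 powr p) * \<tau> powr - p"
    using eventually_ge_at_top[of "2 * (V + 1)"]
    by eventually_elim (use tail_upper tail_lower V_pos in auto)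
qed

lemma profile_weak_Lp: "weak_Lp_on p D f"
  unfolding weak_Lp_on_def
proof (intro conjI exI allI impI)
  show "f \<in> borel_measurable (lebesgue_on D)" by (rule borel_lebesgue_on[OF f_measurable])
  define \<tau>0 where "\<tau>0 = 2 * (V + 1)"
  have \<tau>0: "0 < \<tau>0" using V_pos by (simp add: \<tau>0_def)
  let ?N = "m1 * 2 powr p + measure lebesgue D * \<tau>0 powr p"
  show "0 \<le> ?N" using m1 by simp
  fix \<tau> :: real assume \<tau>: "0 < \<tau>"
  have "measure lebesgue {z \<in> D. \<tau> < f z} \<le> ?N * \<tau> powr - p"
  proof (cases "\<tau>0 \<le> \<tau>")
    case True
    then have "measure lebesgue {z \<in> D. \<tau> < f z} \<le> (m1 * 2 powr p) * \<tau> powr - p"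
      by (intro tail_upper) (simp add: \<tau>0_def)
    also have "\<dots> \<le> ?N * \<tau> powr - p" by (intro mult_right_mono) auto
    finally show ?thesis .
  next
    case False
    \<comment> \<open>Below the threshold the measure of \<open>D\<close> is enough, because
      \<open>\<tau>0 powr p * \<tau> powr - p\<close> is at least 1.\<close>
    have "measure lebesgue {z \<in> D. \<tau> < f z} \<le> measure lebesgue D * 1"
      using measure_mono_fmeasurable[OF _ superlevel_measurable(2) D_lmeasurable, of \<tau>] by auto
    also have "\<dots> \<le> measure lebesgue D * (\<tau>0 powr p * \<tau> powr - p)"
    proof (intro mult_left_mono)
      have "\<tau> powr p \<le> \<tau>0 powr p" using False \<tau> p_gt by (intro powr_mono2) auto
      then show "1 \<le> \<tau>0 powr p * \<tau> powr - p" using \<tau> by (simp add: powr_minus_divide le_divide_eq)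
    qed simp
    also have "\<dots> \<le> ?N * \<tau> powr - p" using m1 by (simp add: algebra_simps)
    finally show ?thesis .
  qed
  then show "emeasure lebesgue {z \<in> D. \<bar>f z\<bar> > \<tau>} \<le> ennreal (?N * \<tau> powr - p)"
    using superlevel_measurable(1)[of \<tau>] profile_nonneg
    by (simp add: emeasure_eq_measure2 ennreal_leI)
qed

text \<open>A layer-cake estimate: a point off \<open>Sing\<close> lies in \<open>Box k\<close>
  exactly for \<open>k < exit z\<close>, and the square of the exit index is bounded by a sum of
  linear weights over these layers.\<close>

lemma profile_square_bound:
  "ennreal ((f z)\<^sup>2) \<le> ennreal (2 * (V + 1)\<^sup>2) + (\<Sum>k. ennreal (4 * (real k + 1)) * indicator (Box k) z)"
proof (cases "z \<in> Sing")
  case True then show ?thesis by (simp add: profileD(2))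
next
  case False
  define e where "e = exit z"
  have e: "f z \<le> real e + (V + 1)" using profile_upper[OF exit(1)[OF False]] by (simp add: e_def v_def)
  have inb: "z \<in> Box k" if "k < e" for k using exit(2)[of z k] that by (force simp: e_def)
  have "(f z)\<^sup>2 \<le> (real e + (V + 1))\<^sup>2" using e profile_nonneg by (intro power_mono)
  also have "\<dots> \<le> 2 * (V + 1)\<^sup>2 + 2 * (real e)\<^sup>2"
    using sum_squares_bound[of "real e" "V + 1"] by (simp add: power2_sum)
  also have "2 * (real e)\<^sup>2 \<le> (\<Sum>k<e. 4 * (real k + 1))"
    by (induction e) (auto simp: power2_eq_square algebra_simps)
  finally have "ennreal ((f z)\<^sup>2) \<le> ennreal (2 * (V + 1)\<^sup>2) + ennreal (\<Sum>k<e. 4 * (real k + 1))"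
    by (simp add: ennreal_plus[symmetric] sum_nonneg ennreal_leI del: ennreal_plus)
  also have "ennreal (\<Sum>k<e. 4 * (real k + 1)) = (\<Sum>k<e. ennreal (4 * (real k + 1)) * indicator (Box k) z)"
    using inb by (subst sum_ennreal[symmetric]) auto
  also have "\<dots> \<le> (\<Sum>k. ennreal (4 * (real k + 1)) * indicator (Box k) z)"
    by (rule sum_le_suminf) auto
  finally show ?thesis by (simp add: add_left_mono)
qed

text \<open>Integrating the layers leaves the series of \<open>(k + 1) powr (1 - p)\<close>, which
  converges because \<open>p > 2\<close>.\<close>

lemma profile_square_integrable: "integrable (lebesgue_on Q_cyl) (\<lambda>z. (f z)\<^sup>2)"
proof (rule integrableI_bounded)
  let ?M = "lebesgue_on Q_cyl"
  show "(\<lambda>z. (f z)\<^sup>2) \<in> borel_measurable ?M" using f_measurable by (intro borel_lebesgue_on) simp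
  have Bm: "Box k \<in> sets ?M" for k
    using Box_lmeasurable Box_subset(2) Q_cyl_facts(3) by (auto simp: sets_restrict_space_iff fmeasurableD)
  have Be: "emeasure ?M (Box k) = ennreal (measure lebesgue (Box k))" for k
    using Box_lmeasurable[of k] Box_subset(2) Q_cyl_facts(3)
    by (simp add: emeasure_restrict_space fmeasurableD emeasure_eq_measure2)
  have "(\<integral>\<^sup>+z. ennreal (norm ((f z)\<^sup>2)) \<partial>?M) \<le>
      (\<integral>\<^sup>+z. (ennreal (2 * (V + 1)\<^sup>2) + (\<Sum>k. ennreal (4 * (real k + 1)) * indicator (Box k) z)) \<partial>?M)"
    using profile_square_bound by (intro nn_integral_mono) simp
  also have "\<dots> = (\<integral>\<^sup>+z. ennreal (2 * (V + 1)\<^sup>2) \<partial>?M) + (\<integral>\<^sup>+z. (\<Sum>k. ennreal (4 * (real k + 1)) * indicator (Box k) z) \<partial>?M)"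
    using Bm by (intro nn_integral_add) auto
  finally have le: "(\<integral>\<^sup>+z. ennreal (norm ((f z)\<^sup>2)) \<partial>?M) \<le>
      (\<integral>\<^sup>+z. ennreal (2 * (V + 1)\<^sup>2) \<partial>?M) + (\<integral>\<^sup>+z. (\<Sum>k. ennreal (4 * (real k + 1)) * indicator (Box k) z) \<partial>?M)" .
  have "(\<integral>\<^sup>+z. (\<Sum>k. ennreal (4 * (real k + 1)) * indicator (Box k) z) \<partial>?M) =
      (\<Sum>k. \<integral>\<^sup>+z. ennreal (4 * (real k + 1)) * indicator (Box k) z \<partial>?M)"
    using Bm by (intro nn_integral_suminf) auto
  also have "\<dots> = (\<Sum>k. ennreal (4 * (real k + 1)) * ennreal (measure lebesgue (Box k)))"
    using Bm Be by (simp add: nn_integral_cmult_indicator)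
  also have "\<dots> \<le> (\<Sum>k. ennreal ((4 * m1) * (real k + 1) powr (1 - p)))"
  proof (rule suminf_le)
    fix k
    have "4 * (real k + 1) * measure lebesgue (Box k) \<le> 4 * (real k + 1) * (m1 * (real k + 1) powr - p)"
      using Box_upper[of k] by (intro mult_left_mono) auto
    also have "\<dots> = (4 * m1) * ((real k + 1) powr 1 * (real k + 1) powr - p)" by simp
    also have "\<dots> = (4 * m1) * (real k + 1) powr (1 - p)" by (simp only: powr_add[symmetric]) simp
    finally have le: "4 * (real k + 1) * measure lebesgue (Box k) \<le> (4 * m1) * (real k + 1) powr (1 - p)" .
    have "ennreal (4 * (real k + 1)) * ennreal (measure lebesgue (Box k)) = ennreal (4 * (real k + 1) * measure lebesgue (Box k))"
      by (rule ennreal_mult[symmetric]) auto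
    then show "ennreal (4 * (real k + 1)) * ennreal (measure lebesgue (Box k)) \<le> ennreal ((4 * m1) * (real k + 1) powr (1 - p))"
      using ennreal_leI[OF le] by (simp only:)
  qed auto
  also have "\<dots> < \<infinity>"
  proof -
    have "summable (\<lambda>k. real (Suc k) powr (1 - p))"
      using p_gt by (subst summable_Suc_iff) (simp add: summable_real_powr_iff)
    then have "summable (\<lambda>k. (4 * m1) * (real k + 1) powr (1 - p))"
      by (intro summable_mult) (simp add: add.commute)
    then have "(\<Sum>k. ennreal ((4 * m1) * (real k + 1) powr (1 - p))) \<noteq> top"
      using m1 by (intro ennreal_suminf_neq_top) auto
    then show ?thesis by (simp only: infinity_ennreal_def less_top[symmetric] not_False_eq_True)
  qed
  finally have "(\<integral>\<^sup>+z. (\<Sum>k. ennreal (4 * (real k + 1)) * indicator (Box k) z) \<partial>?M) < \<infinity>" .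
  moreover have "(\<integral>\<^sup>+z. ennreal (2 * (V + 1)\<^sup>2) \<partial>?M) < \<infinity>"
  proof -
    interpret finite_measure ?M by (rule finite_measure_Q)
    have "emeasure ?M Q_cyl < top" by (rule less_top[THEN iffD1], rule emeasure_finite)
    then show ?thesis by (simp add: ennreal_mult_less_top)
  qed
  ultimately show "(\<integral>\<^sup>+z. ennreal (norm ((f z)\<^sup>2)) \<partial>?M) < \<infinity>"
    by (intro le_less_trans[OF le]) (simp only: infinity_ennreal_def ennreal_add_less_top simp_thms)
qed

lemma profile_integrable: "integrable (lebesgue_on Q_cyl) f"
proof (rule Bochner_Integration.integrable_bound)
  interpret finite_measure "lebesgue_on Q_cyl" by (rule finite_measure_Q)
  show "integrable (lebesgue_on Q_cyl) (\<lambda>z. 1 + (f z)\<^sup>2)" using profile_square_integrable by simp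
  show "f \<in> borel_measurable (lebesgue_on Q_cyl)" by (rule borel_lebesgue_on[OF f_measurable])
  have "\<bar>y\<bar> \<le> \<bar>1 + y\<^sup>2\<bar>" for y :: real
  proof -
    have "2 * \<bar>y\<bar> \<le> 1 + y\<^sup>2" using sum_squares_bound[of 1 "\<bar>y\<bar>"] by simp
    then show ?thesis using abs_ge_self[of "1 + y\<^sup>2"] abs_ge_zero[of y] by linarith
  qed
  then show "AE z in lebesgue_on Q_cyl. norm (f z) \<le> norm (1 + (f z)\<^sup>2)" by simp
qed

lemma profile_Lp2: "Lp_on 2 Q_cyl f"
  using profile_square_integrable borel_lebesgue_on[OF f_measurable] by (simp add: Lp_on_def)

text \<open>If \<open>i\<close> is the last index up to \<open>j\<close> with \<open>z\<close> in
  \<open>Box i\<close>, the sum is at most \<open>i powr p\<close>, while \<open>F j z\<close> is at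
  least \<open>\<kappa> * v i\<close>.\<close>

lemma F_powr_lower: "\<kappa> powr p * (\<Sum>k=1..j. real k powr (p - 1) * indicator (Box k) z) \<le> F j z powr p"
proof -
  have s: "(\<Sum>k=1..j. real k powr (p - 1) * indicator (Box k) z) \<le> real j powr p" for j
  proof -
    have "(\<Sum>k=1..j. real k powr (p - 1) * indicator (Box k) z) \<le> (\<Sum>k=1..j. real j powr (p - 1))"
      using p_gt by (intro sum_mono) (auto simp: indicator_def intro!: powr_mono2)
    also have "\<dots> = real j powr p"
      using powr_add[of "real j" 1 "p - 1"] by (cases "j = 0") auto
    finally show ?thesis .
  qed
  have big: "\<kappa> powr p * (\<Sum>k=1..i. real k powr (p - 1) * indicator (Box k) z) \<le> y powr p"
    if "\<kappa> * v i \<le> y" for i y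
  proof -
    have "\<kappa> powr p * (\<Sum>k=1..i. real k powr (p - 1) * indicator (Box k) z) \<le> \<kappa> powr p * real i powr p"
      using s by (intro mult_left_mono) auto
    also have "\<dots> = (\<kappa> * real i) powr p" using kappa by (simp add: powr_mult)
    also have "\<dots> \<le> y powr p"
    proof (rule powr_mono2)
      have "\<kappa> * real i \<le> \<kappa> * v i" using kappa V_pos by (intro mult_left_mono) (auto simp: v_def)
      then show "\<kappa> * real i \<le> y" using that by simp
    qed (use p_gt kappa in auto)
    finally show ?thesis .
  qed
  show ?thesis
  proof (induction j)
    case 0 then show ?case by simp
  next
    case (Suc j)
    show ?case
    proof (cases "z \<in> Box (Suc j)")
      case True
      then show ?thesis using profileD(6)[OF True] by (intro big) auto
    next
      case False
      then have eq: "(\<Sum>k=1..Suc j. real k powr (p - 1) * indicator (Box k) z) =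
          (\<Sum>k=1..j. real k powr (p - 1) * indicator (Box k) z :: real)" by simp
      show ?thesis
      \<comment> \<open>A point that leaves at this very stage may still drop, but not below
        \<open>\<kappa> * v j\<close>; one that left earlier is frozen.\<close>
      proof (cases "z \<in> Box j")
        case True
        then show ?thesis unfolding eq using profileD(6)[OF True] by (intro big) auto
      next
        case False
        then show ?thesis unfolding eq using Suc profileD(4)[OF False, of "Suc j"] by simp
      qed
    qed
  qed
qed

lemma finite_measure_D: "finite_measure (lebesgue_on D)"
  using D_lmeasurable by (rule finite_measure_lebesgue_on)

lemma F_powr_integrable: "integrable (lebesgue_on D) (\<lambda>z. F j z powr p)"
proof -
  interpret finite_measure "lebesgue_on D" by (rule finite_measure_D)
  show ?thesis
  proof (rule integrable_const_bound[where B = "(v j + 1) powr p"])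
    show "AE z in lebesgue_on D. norm (F j z powr p) \<le> (v j + 1) powr p"
    proof (rule AE_I2)
      fix z
      have "F j z powr p \<le> (v j + 1) powr p"
        using profile_F_le[of j z] profileD(8)[of j z] p_gt by (intro powr_mono2) auto
      then show "norm (F j z powr p) \<le> (v j + 1) powr p" by simp
    qed
    show "(\<lambda>z. F j z powr p) \<in> borel_measurable (lebesgue_on D)"
      using F_measurable by (intro borel_lebesgue_on) measurable
  qed
qed

text \<open>Layer \<open>k\<close> contributes \<open>k powr (p - 1)\<close> times a measure of
  order \<open>k powr - p\<close>, so the sum is harmonic; the factor \<open>2 powr - p\<close>
  comes from \<open>k + 1 \<le> 2 * k\<close>.\<close>

lemma F_powr_integral:
  assumes "1 \<le> j"
  shows "(\<kappa> powr p * m0 * 2 powr - p) * ln (real j) \<le> (\<integral>z. F j z powr p \<partial>lebesgue_on D)"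
proof -
  interpret finite_measure "lebesgue_on D" by (rule finite_measure_D)
  have Bm: "Box k \<in> sets (lebesgue_on D)" for k
    using Box_lmeasurable Box_subset(1) D_lmeasurable by (auto simp: sets_restrict_space_iff fmeasurableD)
  have Be: "measure (lebesgue_on D) (Box k) = measure lebesgue (Box k)" for k
    using Box_lmeasurable[of k] Box_subset(1) D_lmeasurable by (intro measure_restrict_space) (auto simp: fmeasurableD)
  have I: "integrable (lebesgue_on D) (\<lambda>z. real k powr (p - 1) * indicator (Box k) z)" for k
    by (intro integrable_mult_right integrable_real_indicator Bm) (simp add: less_top[symmetric])
  have "ln (real j) \<le> (\<Sum>k=1..j. 1 / real k)"
    using ln_le_harm[of j] assms by (auto simp: harm_def inverse_eq_divide intro: order_trans[rotated])
  then have "(\<kappa> powr p * m0 * 2 powr - p) * ln (real j) \<le> (\<kappa> powr p * m0 * 2 powr - p) * (\<Sum>k=1..j. 1 / real k)"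
    using m0 by (intro mult_left_mono) auto
  also have "\<dots> = \<kappa> powr p * (\<Sum>k=1..j. m0 * 2 powr - p * (1 / real k))"
    by (simp add: sum_distrib_left mult.assoc)
  also have "\<dots> \<le> \<kappa> powr p * (\<Sum>k=1..j. real k powr (p - 1) * measure lebesgue (Box k))"
  proof (intro mult_left_mono sum_mono)
    fix k assume k: "k \<in> {1..j}"
    have "m0 * 2 powr - p * (1 / real k) = real k powr (p - 1) * (m0 * (2 * real k) powr - p)"
      using k by (simp add: powr_mult powr_diff powr_minus_divide)
    also have "\<dots> \<le> real k powr (p - 1) * (m0 * (real k + 1) powr - p)"
      using k p_gt m0 by (intro mult_left_mono powr_mono2') auto
    also have "\<dots> \<le> real k powr (p - 1) * measure lebesgue (Box k)"
      using Box_lower[of k] by (intro mult_left_mono) auto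
    finally show "m0 * 2 powr - p * (1 / real k) \<le> real k powr (p - 1) * measure lebesgue (Box k)" .
  qed simp
  also have "\<dots> = (\<integral>z. \<kappa> powr p * (\<Sum>k=1..j. real k powr (p - 1) * indicator (Box k) z) \<partial>lebesgue_on D)"
  proof -
    have "(\<integral>z. real k powr (p - 1) * indicator (Box k) z \<partial>lebesgue_on D) = real k powr (p - 1) * measure lebesgue (Box k)" for k
      using Box_subset(1)[of k] by (simp add: Be[of k, symmetric] Int_absorb2)
    then show ?thesis using I by (simp only: integral_mult_right_zero Bochner_Integration.integral_sum)
  qed
  also have "\<dots> \<le> (\<integral>z. F j z powr p \<partial>lebesgue_on D)"
    by (rule integral_mono[OF integrable_mult_right[OF Bochner_Integration.integrable_sum[OF I]] F_powr_integrable F_powr_lower])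
  finally show ?thesis .
qed

text \<open>Were the limit in the space, domination by \<open>f / \<kappa>\<close> would bound all
  stage integrals, against their logarithmic growth.\<close>

lemma profile_not_Lp: "\<not> Lp_on p D f"
proof
  assume "Lp_on p D f"
  then have I: "integrable (lebesgue_on D) (\<lambda>z. f z powr p)"
    using profile_nonneg by (simp add: Lp_on_def)
  define C where "C = (\<integral>z. f z powr p \<partial>lebesgue_on D) / \<kappa> powr p"
  have le: "(\<integral>z. F j z powr p \<partial>lebesgue_on D) \<le> C" for j
  proof -
    have "(\<integral>z. F j z powr p \<partial>lebesgue_on D) \<le> (\<integral>z. f z powr p / \<kappa> powr p \<partial>lebesgue_on D)"
    proof (rule integral_mono_AE[OF F_powr_integrable])
      show "integrable (lebesgue_on D) (\<lambda>z. f z powr p / \<kappa> powr p)" using I by simp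
      show "AE z in lebesgue_on D. F j z powr p \<le> f z powr p / \<kappa> powr p"
        using AE_off_Sing[OF fmeasurableD[OF D_lmeasurable]]
      proof eventually_elim
        case (elim z)
        have "F j z powr p \<le> (f z / \<kappa>) powr p"
          using profile_dominates[OF elim] profileD(8)[of j z] p_gt by (intro powr_mono2) auto
        then show ?case using profile_nonneg[of z] kappa by (simp add: powr_divide)
      qed
    qed
    then show ?thesis by (simp add: C_def)
  qed
  define c where "c = \<kappa> powr p * m0 * 2 powr - p"
  have c: "0 < c" using kappa m0 by (simp add: c_def)
  have "filterlim (\<lambda>j. ln (real j)) at_top sequentially"
    by (rule filterlim_compose[OF ln_at_top filterlim_real_sequentially])
  then have "\<forall>\<^sub>F j in sequentially. C / c + 1 \<le> ln (real j) \<and> 1 \<le> j"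
    by (intro eventually_conj eventually_ge_at_top) (simp add: filterlim_at_top)
  then obtain j where j: "C / c + 1 \<le> ln (real j)" "1 \<le> j"
    using eventually_happens[of _ sequentially] by auto
  have "c * ln (real j) \<le> C" using F_powr_integral[OF j(2)] le[of j] by (simp add: c_def)
  then have "ln (real j) \<le> C / c" using c by (simp add: field_simps)
  then show False using j(1) by simp
qed

end

end


section \<open>Weak derivatives and test functions\<close>

lemma deriv_const_on_open:
  fixes f :: "real \<Rightarrow> real"
  assumes "open U" "\<And>x. x \<in> U \<Longrightarrow> f x = c" "x \<in> U"
  shows "deriv f x = 0"
  by (rule DERIV_imp_deriv, rule has_field_derivative_transform_within_open[of "\<lambda>_. c" 0 x U])
    (use assms in auto)

context singular_staircase
begin

lemma us_bounded_Q:
  assumes "z \<in> Q_cyl" shows "\<bar>us m z\<bar> \<le> 2 * V + 4" "\<bar>xs m z\<bar> \<le> 2 * V + 4"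
proof -
  have z: "\<bar>fst z\<bar> \<le> 1" "\<bar>snd z\<bar> \<le> 1" using assms by (auto simp: Q_cyl_def)
  then have "(snd z)\<^sup>2 \<le> 1" by (simp add: abs_square_le_1)
  then have "\<bar>fst z + (snd z)\<^sup>2 / 2\<bar> \<le> 2" using z(1) by (auto simp: abs_le_iff) (use zero_le_power2[of "snd z"] in linarith)+
  then have "V * \<bar>fst z + (snd z)\<^sup>2 / 2\<bar> \<le> V * 2" "V * \<bar>snd z\<bar> \<le> V * 2"
    using z V_pos by (intro mult_left_mono; simp)+
  then have "\<bar>V * (fst z + (snd z)\<^sup>2 / 2)\<bar> \<le> 2 * V" "\<bar>V * snd z\<bar> \<le> 2 * V"
    using V_pos by (auto simp: abs_mult)
  then show "\<bar>us m z\<bar> \<le> 2 * V + 4" "\<bar>xs m z\<bar> \<le> 2 * V + 4"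
    using us_bound[of m z] by linarith+
qed

lemma u_bounded_Q:
  assumes "z \<in> Q_cyl" shows "\<bar>u z\<bar> \<le> 2 * V + 4" "\<bar>ux z\<bar> \<le> 2 * V + 4"
  using LIMSEQ_le_const2[OF tendsto_rabs[OF us_limit(1)]] LIMSEQ_le_const2[OF tendsto_rabs[OF us_limit(2)]]
    us_bounded_Q[OF assms] by blast+

lemma measurables:
  "us m \<in> borel_measurable borel" "ts m \<in> borel_measurable borel" "xs m \<in> borel_measurable borel"
  "xxs m \<in> borel_measurable borel" "u \<in> borel_measurable borel" "ux \<in> borel_measurable borel"
  "ut \<in> borel_measurable borel" "uxx \<in> borel_measurable borel" "a \<in> borel_measurable borel"
proof -
  show "us m \<in> borel_measurable borel" "ts m \<in> borel_measurable borel" "xs m \<in> borel_measurable borel"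
    "xxs m \<in> borel_measurable borel" "u \<in> borel_measurable borel" "ux \<in> borel_measurable borel"
    by (intro borel_measurable_continuous_onI smooth_on_continuous smooth_us smooth_ts smooth_xs smooth_xxs continuous_limits)+
  show ut: "ut \<in> borel_measurable borel" and uxx: "uxx \<in> borel_measurable borel"
    using f_measurable[OF profiles(1)] f_measurable[OF profiles(2)] by auto
  have "Sing \<in> sets borel" using compact_Sing by (rule borel_compact)
  then show "a \<in> borel_measurable borel"
    unfolding a_def[abs_def] using ut uxx by (intro measurable_If_set borel_measurable_divide) auto
qed

lemma bounded_integrable_Q:
  fixes f :: "real \<times> real \<Rightarrow> real" and C :: real
  assumes "f \<in> borel_measurable borel" "\<And>z. z \<in> Q_cyl \<Longrightarrow> \<bar>f z\<bar> \<le> C"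
  shows "integrable (lebesgue_on Q_cyl) f"
proof -
  interpret finite_measure "lebesgue_on Q_cyl" by (rule finite_measure_Q)
  show ?thesis
  proof (rule integrable_const_bound[where B = C])
    show "AE z in lebesgue_on Q_cyl. norm (f z) \<le> C"
      using assms(2) by (intro AE_I2) (simp add: space_restrict_space)
  qed (rule borel_lebesgue_on[OF assms(1)])
qed

lemma bounded_Lp2:
  fixes f :: "real \<times> real \<Rightarrow> real" and C :: real
  assumes "f \<in> borel_measurable borel" "\<And>z. z \<in> Q_cyl \<Longrightarrow> \<bar>f z\<bar> \<le> C"
  shows "Lp_on 2 Q_cyl f"
  unfolding Lp_on_def
proof
  show "f \<in> borel_measurable (lebesgue_on Q_cyl)" using assms(1) by (rule borel_lebesgue_on)
  have "integrable (lebesgue_on Q_cyl) (\<lambda>z. (f z)\<^sup>2)"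
  proof (rule bounded_integrable_Q)
    show "\<bar>(f z)\<^sup>2\<bar> \<le> C\<^sup>2" if "z \<in> Q_cyl" for z
      using power_mono[OF assms(2)[OF that] abs_ge_zero, of 2] by simp
  qed (use assms(1) in measurable)
  then show "integrable (lebesgue_on Q_cyl) (\<lambda>z. \<bar>f z\<bar> powr 2)" by simp
qed

text \<open>Classical integration by parts for the smooth stages passes to the limit, with
  \<open>ut / \<kappa>\<close> and \<open>uxx / \<kappa>\<close> dominating the unbounded
  derivatives.\<close>

lemma W122_u: "W122_on Q_cyl u ut ux uxx"
proof -
  have AE: "AE z in lebesgue_on Q_cyl. z \<notin> Sing"
    using AE_off_Sing Q_cyl_facts(3) by (simp add: fmeasurableD)
  note li = locally_integrable_I[OF bounded_integrable_Q[OF measurables(5) u_bounded_Q(1)]]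
    locally_integrable_I[OF bounded_integrable_Q[OF measurables(6) u_bounded_Q(2)]]
    locally_integrable_I[OF profile_integrable[OF profiles(1)]]
    locally_integrable_I[OF profile_integrable[OF profiles(2)]]
  have H: "integrable (lebesgue_on Q_cyl) (\<lambda>z. f z / \<kappa>)" if "is_profile F f" for F f
    using profile_integrable[OF that] by simp
  have L: "AE z in lebesgue_on Q_cyl. (\<lambda>m. F m z) \<longlonglongrightarrow> f z" if "is_profile F f" for F f
    using AE by eventually_elim (rule profile_limit[OF that])
  have dom: "AE z in lebesgue_on Q_cyl. \<bar>F m z\<bar> \<le> f z / \<kappa>" if "is_profile F f" for F f m
    using AE by eventually_elim (use profile_dominates[OF that] profileD(8)[OF that] in \<open>auto simp: abs_of_pos\<close>)
  have "has_weak_pd_t Q_cyl u ut"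
    unfolding has_weak_pd_t_def
  proof (intro conjI li ballI)
    fix \<psi> assume \<psi>: "\<psi> \<in> test_functions Q_cyl"
    note t = test_functionD[OF \<psi>]
    obtain M where M: "\<And>z. \<bar>\<psi> z\<bar> \<le> M" "\<And>z. \<bar>pd_t \<psi> z\<bar> \<le> M" using t(7) by blast
    have mm: "\<psi> \<in> borel_measurable borel" "pd_t \<psi> \<in> borel_measurable borel"
      using t(1) smooth_on_pd by (auto intro!: borel_measurable_continuous_onI smooth_on_continuous)
    show "(\<integral>z. u z * pd_t \<psi> z \<partial>lebesgue_on Q_cyl) = - (\<integral>z. ut z * \<psi> z \<partial>lebesgue_on Q_cyl)"
      by (rule weak_pd_limit[OF measurables(1) measurables(2) measurables(5,7) us_limit(1) us_bounded_Q(1)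
            L[OF profiles(1)] dom[OF profiles(1)] H[OF profiles(1)] mm M integration_by_parts(1)[OF smooth_us \<psi>, unfolded pd_us]])
  qed
  moreover have "has_weak_pd_x Q_cyl u ux"
    unfolding has_weak_pd_x_def
  proof (intro conjI li ballI)
    fix \<psi> assume \<psi>: "\<psi> \<in> test_functions Q_cyl"
    note t = test_functionD[OF \<psi>]
    obtain M where M: "\<And>z. \<bar>\<psi> z\<bar> \<le> M" "\<And>z. \<bar>pd_x \<psi> z\<bar> \<le> M" using t(7) by blast
    have mm: "\<psi> \<in> borel_measurable borel" "pd_x \<psi> \<in> borel_measurable borel"
      using t(1) smooth_on_pd by (auto intro!: borel_measurable_continuous_onI smooth_on_continuous)
    have xb: "AE z in lebesgue_on Q_cyl. \<bar>xs m z\<bar> \<le> 2 * V + 4" for m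
      using us_bounded_Q(2) by (intro AE_I2) (simp add: space_restrict_space)
    interpret finite_measure "lebesgue_on Q_cyl" by (rule finite_measure_Q)
    show "(\<integral>z. u z * pd_x \<psi> z \<partial>lebesgue_on Q_cyl) = - (\<integral>z. ux z * \<psi> z \<partial>lebesgue_on Q_cyl)"
      by (rule weak_pd_limit[OF measurables(1) measurables(3) measurables(5,6) us_limit(1) us_bounded_Q(1)
            AE_I2[OF us_limit(2)] xb integrable_const mm M integration_by_parts(2)[OF smooth_us \<psi>, unfolded pd_us]])
  qed
  moreover have "has_weak_pd_x Q_cyl ux uxx"
    unfolding has_weak_pd_x_def
  proof (intro conjI li ballI)
    fix \<psi> assume \<psi>: "\<psi> \<in> test_functions Q_cyl"
    note t = test_functionD[OF \<psi>]
    obtain M where M: "\<And>z. \<bar>\<psi> z\<bar> \<le> M" "\<And>z. \<bar>pd_x \<psi> z\<bar> \<le> M" using t(7) by blast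
    have mm: "\<psi> \<in> borel_measurable borel" "pd_x \<psi> \<in> borel_measurable borel"
      using t(1) smooth_on_pd by (auto intro!: borel_measurable_continuous_onI smooth_on_continuous)
    show "(\<integral>z. ux z * pd_x \<psi> z \<partial>lebesgue_on Q_cyl) = - (\<integral>z. uxx z * \<psi> z \<partial>lebesgue_on Q_cyl)"
      by (rule weak_pd_limit[OF measurables(3) measurables(4) measurables(6,8) us_limit(2) us_bounded_Q(2)
            L[OF profiles(2)] dom[OF profiles(2)] H[OF profiles(2)] mm M integration_by_parts(2)[OF smooth_xs \<psi>, unfolded pd_us]])
  qed
  ultimately show ?thesis
    unfolding W122_on_def
    using bounded_Lp2[OF measurables(5) u_bounded_Q(1)] bounded_Lp2[OF measurables(6) u_bounded_Q(2)]
      profile_Lp2[OF profiles(1)] profile_Lp2[OF profiles(2)] by simp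
qed

text \<open>The integral of the p-th power over \<open>Box j\<close> is of order
  \<open>j powr p\<close> times \<open>j powr - p\<close>, hence bounded in \<open>j\<close>: a
  defect of order \<open>j\<close> is just affordable.\<close>

lemma Lp_norm_concentrated:
  assumes E: "E \<in> borel_measurable borel" and K: "0 \<le> K"
    and le: "\<And>z. z \<in> Q_cyl \<Longrightarrow> z \<notin> Box j \<Longrightarrow> \<bar>E z\<bar> \<le> K" "\<And>z. z \<in> Box j \<Longrightarrow> \<bar>E z\<bar> \<le> K * v j"
  shows "Lp_norm p Q_cyl E \<le> ennreal ((K powr p * measure lebesgue Q_cyl + (K * V) powr p * m1) powr (1 / p))"
proof -
  interpret finite_measure "lebesgue_on Q_cyl" by (rule finite_measure_Q)
  have Bm: "Box j \<in> sets (lebesgue_on Q_cyl)"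
    using Box_lmeasurable Box_subset(2) Q_cyl_facts(3) by (auto simp: sets_restrict_space_iff fmeasurableD)
  have Be: "measure (lebesgue_on Q_cyl) (Box j) = measure lebesgue (Box j)"
    using Box_lmeasurable[of j] Box_subset(2) Q_cyl_facts(3) by (intro measure_restrict_space) (auto simp: fmeasurableD)
  have QE: "measure (lebesgue_on Q_cyl) Q_cyl = measure lebesgue Q_cyl"
    using Q_cyl_facts(3) by (intro measure_restrict_space) (auto simp: fmeasurableD)
  let ?G = "\<lambda>z. K powr p + (K * v j) powr p * indicator (Box j) z"
  have G: "integrable (lebesgue_on Q_cyl) ?G"
    by (intro Bochner_Integration.integrable_add integrable_const integrable_mult_right integrable_real_indicator Bm)
      (simp add: less_top[symmetric])
  have EG: "\<bar>E z\<bar> powr p \<le> ?G z" if "z \<in> Q_cyl" for z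
  proof (cases "z \<in> Box j")
    case True
    have "\<bar>E z\<bar> powr p \<le> (K * v j) powr p" using le(2)[OF True] p_gt by (intro powr_mono2) auto
    then show ?thesis using True by (simp add: add_increasing)
  next
    case False
    have "\<bar>E z\<bar> powr p \<le> K powr p" using le(1)[OF that False] p_gt by (intro powr_mono2) auto
    then show ?thesis using False by simp
  qed
  have Em: "E \<in> borel_measurable (lebesgue_on Q_cyl)" using E by (rule borel_lebesgue_on)
  have I: "integrable (lebesgue_on Q_cyl) (\<lambda>z. \<bar>E z\<bar> powr p)"
  proof (rule Bochner_Integration.integrable_bound[OF G])
    show "(\<lambda>z. \<bar>E z\<bar> powr p) \<in> borel_measurable (lebesgue_on Q_cyl)" using Em by measurable
    show "AE z in lebesgue_on Q_cyl. norm (\<bar>E z\<bar> powr p) \<le> norm (?G z)"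
    proof (rule AE_I2)
      fix z assume "z \<in> space (lebesgue_on Q_cyl)"
      then have "z \<in> Q_cyl" by (simp add: space_restrict_space)
      from order_trans[OF EG[OF this] abs_ge_self] show "norm (\<bar>E z\<bar> powr p) \<le> norm (?G z)"
        by (simp only: real_norm_def abs_of_nonneg[OF powr_ge_zero])
    qed
  qed
  have vj: "v j powr p * (real j + 1) powr - p \<le> V powr p"
  proof -
    \<comment> \<open>Uses only that \<open>V\<close> is at least 1.\<close>
    have "v j \<le> V * (real j + 1)" using V_pos by (simp add: v_def distrib_left mult_le_cancel_right1)
    then have "v j powr p \<le> (V * (real j + 1)) powr p" using v_pos[of j] p_gt by (intro powr_mono2) auto
    then show ?thesis using V_pos by (simp add: powr_mult powr_minus_divide divide_le_eq)
  qed
  have "(\<integral>z. \<bar>E z\<bar> powr p \<partial>lebesgue_on Q_cyl) \<le> (\<integral>z. ?G z \<partial>lebesgue_on Q_cyl)"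
    using EG by (intro integral_mono[OF I G]) (simp add: space_restrict_space)
  also have "\<dots> = K powr p * measure lebesgue Q_cyl + (K * v j) powr p * measure lebesgue (Box j)"
    using Box_subset(2)[of j] Bm
    by (subst Bochner_Integration.integral_add)
      (auto simp: QE Be Int_absorb2 less_top[symmetric] space_restrict_space intro!: integrable_real_indicator)
  also have "\<dots> \<le> K powr p * measure lebesgue Q_cyl + (K * v j) powr p * (m1 * (real j + 1) powr - p)"
    using Box_upper by (intro add_left_mono mult_left_mono) auto
  also have "(K * v j) powr p * (m1 * (real j + 1) powr - p) = (K powr p * m1) * (v j powr p * (real j + 1) powr - p)"
    using K v_pos[of j] by (simp add: powr_mult)
  also have "K powr p * measure lebesgue Q_cyl + \<dots> \<le> K powr p * measure lebesgue Q_cyl + (K powr p * m1) * V powr p"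
    using vj m1 by (intro add_left_mono mult_left_mono) auto
  also have "(K powr p * m1) * V powr p = (K * V) powr p * m1" using K V_pos by (simp add: powr_mult)
  finally have "(\<integral>z. \<bar>E z\<bar> powr p \<partial>lebesgue_on Q_cyl) \<le> K powr p * measure lebesgue Q_cyl + (K * V) powr p * m1" .
  then show ?thesis
    using Em I p_gt by (auto simp: Lp_norm_def Lp_on_def intro!: ennreal_leI powr_mono2)
qed

lemma Linf_bound:
  fixes f :: "real \<times> real \<Rightarrow> real" and C :: real
  assumes "f \<in> borel_measurable borel" "\<And>z. z \<in> Q_cyl \<Longrightarrow> \<bar>f z\<bar> \<le> C"
  shows "Linf_norm Q_cyl f \<le> ennreal C"
  unfolding Linf_norm_def
  using assms borel_lebesgue_on[OF assms(1)]
  by (intro esssup_I AE_I2) (auto simp: space_restrict_space intro!: ennreal_leI)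

text \<open>The functions are \<open>\<eta> * us j\<close>. Off \<open>Box j\<close> stage
  \<open>j\<close> already solves the equation with the final coefficient \<open>a\<close>, so only
  terms with derivatives of the cutoff remain, and these involve just the bounded
  \<open>us j\<close> and \<open>xs j\<close>. On \<open>D\<close> the cutoff is 1, so the second
  derivative there is \<open>xxs j\<close>.\<close>

lemma test_sequence:
  fixes \<eta>1 \<eta>2 :: "real \<Rightarrow> real"
  assumes \<eta>: "smooth1 \<eta>1" "smooth1 \<eta>2" "\<And>t. t \<notin> {a1..b1} \<Longrightarrow> \<eta>1 t = 0" "\<And>x. x \<notin> {a2..b2} \<Longrightarrow> \<eta>2 x = 0"
    and ab: "- 1 < a1" "b1 < 0" "- 1 < a2" "b2 < 1"
    and D: "D = {t1<..<t2} \<times> {x1<..<x2}"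
    and one: "\<And>t. t \<in> {t1<..<t2} \<Longrightarrow> \<eta>1 t = 1" "\<And>x. x \<in> {x1<..<x2} \<Longrightarrow> \<eta>2 x = 1"
  shows "\<exists>\<phi> :: nat \<Rightarrow> real \<times> real \<Rightarrow> real. \<exists>c>0. \<exists>N>0. \<forall>j\<ge>1.
         \<phi> j \<in> test_functions Q_cyl \<and>
         Linf_norm Q_cyl (\<phi> j) + Linf_norm Q_cyl (pd_x (\<phi> j)) +
           Lp_norm p Q_cyl (\<lambda>z. pd_t (\<phi> j) z - a z * pd_x (pd_x (\<phi> j)) z) \<le> ennreal N \<and>
         (\<integral>z. \<bar>pd_x (pd_x (\<phi> j)) z\<bar> powr p \<partial>lebesgue_on D) \<ge> c * ln (real j)"
proof -
  define \<eta> where "\<eta> z = \<eta>1 (fst z) * \<eta>2 (snd z)" for z :: "real \<times> real"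
  define \<eta>t where "\<eta>t z = deriv \<eta>1 (fst z) * \<eta>2 (snd z)" for z :: "real \<times> real"
  define \<eta>x where "\<eta>x z = \<eta>1 (fst z) * deriv \<eta>2 (snd z)" for z :: "real \<times> real"
  define \<eta>xx where "\<eta>xx z = \<eta>1 (fst z) * deriv (deriv \<eta>2) (snd z)" for z :: "real \<times> real"
  note s1 = smooth1_deriv[OF \<eta>(1)] and s2 = smooth1_deriv[OF \<eta>(2)] smooth1_deriv[OF smooth1_deriv[OF \<eta>(2)]]
  have sm: "smooth_on UNIV (\<lambda>z. f (fst z) * g (snd z))" if "smooth1 f" "smooth1 g" for f g
    using that smooth1_fst by (intro smooth_on_mult) (auto simp: smooth1_def)
  have smooth: "smooth_on UNIV \<eta>" "smooth_on UNIV \<eta>t" "smooth_on UNIV \<eta>x" "smooth_on UNIV \<eta>xx"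
    unfolding \<eta>_def[abs_def] \<eta>t_def[abs_def] \<eta>x_def[abs_def] \<eta>xx_def[abs_def]
    using \<eta>(1,2) s1 s2 by (simp_all add: sm)
  have pd\<eta>: "pd_t \<eta> = \<eta>t" "pd_x \<eta> = \<eta>x" "pd_x \<eta>x = \<eta>xx"
    unfolding \<eta>_def[abs_def] \<eta>t_def[abs_def] \<eta>x_def[abs_def] \<eta>xx_def[abs_def] pd_t_def[abs_def] pd_x_def[abs_def] fst_conv snd_conv
    using \<eta>(1,2) s1 s2
    by (auto intro!: DERIV_imp_deriv derivative_eq_intros smooth1_DERIV)
  have z1: "t \<notin> {a1..b1} \<Longrightarrow> deriv \<eta>1 t = 0" for t using deriv_zero_outside[of "{a1..b1}" \<eta>1 t] \<eta>(3) by simp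
  have z2: "x \<notin> {a2..b2} \<Longrightarrow> deriv \<eta>2 x = 0" for x using deriv_zero_outside[of "{a2..b2}" \<eta>2 x] \<eta>(4) by simp
  have z3: "x \<notin> {a2..b2} \<Longrightarrow> deriv (deriv \<eta>2) x = 0" for x using deriv_zero_outside[of "{a2..b2}" "deriv \<eta>2" x] z2 by simp
  obtain M1 where M1: "0 \<le> M1" "\<And>t. \<bar>\<eta>1 t\<bar> \<le> M1" using smooth1_bounded[OF \<eta>(1) compact_Icc \<eta>(3)] by blast
  obtain M2 where M2: "0 \<le> M2" "\<And>t. \<bar>deriv \<eta>1 t\<bar> \<le> M2" using smooth1_bounded[OF s1 compact_Icc z1] by blast
  obtain M3 where M3: "0 \<le> M3" "\<And>x. \<bar>\<eta>2 x\<bar> \<le> M3" using smooth1_bounded[OF \<eta>(2) compact_Icc \<eta>(4)] by blast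
  obtain M4 where M4: "0 \<le> M4" "\<And>x. \<bar>deriv \<eta>2 x\<bar> \<le> M4" using smooth1_bounded[OF s2(1) compact_Icc z2] by blast
  obtain M5 where M5: "0 \<le> M5" "\<And>x. \<bar>deriv (deriv \<eta>2) x\<bar> \<le> M5" using smooth1_bounded[OF s2(2) compact_Icc z3] by blast
  define M where "M = (M1 + M2) * (M3 + M4 + M5)"
  have pb: "\<bar>a * b\<bar> \<le> M" if "\<bar>a\<bar> \<le> M1 + M2" "\<bar>b\<bar> \<le> M3 + M4 + M5" for a b
    unfolding M_def abs_mult using that M1(1) M2(1) by (intro mult_mono) auto
  have ge: "\<bar>\<eta>1 t\<bar> \<le> M1 + M2" "\<bar>deriv \<eta>1 t\<bar> \<le> M1 + M2" "\<bar>\<eta>2 x\<bar> \<le> M3 + M4 + M5" "\<bar>deriv \<eta>2 x\<bar> \<le> M3 + M4 + M5"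
    "\<bar>deriv (deriv \<eta>2) x\<bar> \<le> M3 + M4 + M5" for t x
    using M1(1) M1(2)[of t] M2(1) M2(2)[of t] M3(1) M3(2)[of x] M4(1) M4(2)[of x] M5(1) M5(2)[of x] by linarith+
  have b: "\<bar>\<eta> z\<bar> \<le> M" "\<bar>\<eta>t z\<bar> \<le> M" "\<bar>\<eta>x z\<bar> \<le> M" "\<bar>\<eta>xx z\<bar> \<le> M" for z
    unfolding \<eta>_def \<eta>t_def \<eta>x_def \<eta>xx_def by (intro pb ge)+
  have M: "0 \<le> M" using order_trans[OF abs_ge_zero b(1)] .
  define C where "C = 2 * V + 4"
  have C: "0 \<le> C" using V_pos by (simp add: C_def)
  define \<phi> where "\<phi> j z = \<eta> z * us j z" for j z
  have diff: "f differentiable (at z)" if "smooth_on UNIV f" for f and z :: "real \<times> real"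
    using that smooth_on_differentiable by blast
  have pdt: "pd_t (\<phi> j) = (\<lambda>z. \<eta>t z * us j z + \<eta> z * ts j z)" for j
    unfolding \<phi>_def[abs_def] by (rule ext) (simp add: pd_mult diff smooth smooth_us pd\<eta> pd_us)
  have pdx: "pd_x (\<phi> j) = (\<lambda>z. \<eta>x z * us j z + \<eta> z * xs j z)" for j
    unfolding \<phi>_def[abs_def] by (rule ext) (simp add: pd_mult diff smooth smooth_us pd\<eta> pd_us)
  have pdxx: "pd_x (pd_x (\<phi> j)) = (\<lambda>z. \<eta>xx z * us j z + 2 * (\<eta>x z * xs j z) + \<eta> z * xxs j z)" for j
    unfolding pdx
    by (rule ext) (simp add: pd_add pd_mult diff smooth smooth_us smooth_xs smooth_on_mult pd\<eta> pd_us)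
  have me: "\<eta> \<in> borel_measurable borel" "\<eta>t \<in> borel_measurable borel" "\<eta>x \<in> borel_measurable borel" "\<eta>xx \<in> borel_measurable borel"
    by (intro borel_measurable_continuous_onI smooth_on_continuous smooth)+
  have test: "\<phi> j \<in> test_functions Q_cyl" for j
  proof -
    have "smooth_on UNIV (\<phi> j)"
      unfolding \<phi>_def[abs_def] by (intro smooth_on_mult smooth smooth_us open_UNIV)
    moreover have "{z. \<phi> j z \<noteq> 0} \<subseteq> {a1..b1} \<times> {a2..b2}"
    proof
      fix z assume "z \<in> {z. \<phi> j z \<noteq> 0}"
      then have "\<eta>1 (fst z) \<noteq> 0" "\<eta>2 (snd z) \<noteq> 0" by (auto simp: \<phi>_def \<eta>_def)
      then show "z \<in> {a1..b1} \<times> {a2..b2}" using \<eta>(3)[of "fst z"] \<eta>(4)[of "snd z"] by (auto simp: mem_Times_iff)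
    qed
    then have cl: "closure {z. \<phi> j z \<noteq> 0} \<subseteq> {a1..b1} \<times> {a2..b2}"
      by (intro closure_minimal closed_Times) auto
    moreover have "{a1..b1} \<times> {a2..b2} \<subseteq> Q_cyl" using ab by (auto simp: Q_cyl_def)
    moreover have "compact (closure {z. \<phi> j z \<noteq> 0})"
      using closed_Int_compact[OF closed_closure compact_Times[OF compact_Icc compact_Icc]] cl
      by (metis inf.absorb_iff1)
    ultimately show ?thesis by (auto simp: test_functions_def compactly_inside_def)
  qed
  have L1: "Linf_norm Q_cyl (\<phi> j) \<le> ennreal (M * C)" for j
  proof (rule Linf_bound)
    show "\<phi> j \<in> borel_measurable borel" unfolding \<phi>_def[abs_def] using me measurables by measurable
    show "\<bar>\<phi> j z\<bar> \<le> M * C" if "z \<in> Q_cyl" for z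
      unfolding \<phi>_def abs_mult C_def using b us_bounded_Q[OF that] M by (intro mult_mono) auto
  qed
  have prod: "\<bar>f z * g z\<bar> \<le> M * C" if "\<bar>f z\<bar> \<le> M" "\<bar>g z\<bar> \<le> C" for f g :: "real \<times> real \<Rightarrow> real" and z
    unfolding abs_mult using that M by (intro mult_mono) auto
  have L2: "Linf_norm Q_cyl (pd_x (\<phi> j)) \<le> ennreal (2 * (M * C))" for j
  proof (rule Linf_bound)
    show "pd_x (\<phi> j) \<in> borel_measurable borel" unfolding pdx using me measurables by measurable
    show "\<bar>pd_x (\<phi> j) z\<bar> \<le> 2 * (M * C)" if "z \<in> Q_cyl" for z
      using prod[of \<eta>x z "us j"] prod[of \<eta> z "xs j"] b us_bounded_Q[OF that] by (simp add: pdx C_def)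
  qed
  \<comment> \<open>The three summands bound the time derivative of the cutoff, its space
    derivatives multiplied by \<open>a\<close>, and the defect of stage \<open>j\<close> on
    \<open>Box j\<close> relative to \<open>v j\<close>.\<close>
  define K where "K = M * C + (1 / \<kappa>) * (3 * (M * C)) + M * (1 + 1 / \<kappa>)"
  have K0: "0 \<le> M * C" "0 \<le> (1 / \<kappa>) * (3 * (M * C))" "0 \<le> M * (1 + 1 / \<kappa>)" using M C kappa by auto
  then have K: "0 \<le> K" by (simp add: K_def)
  define N1 where "N1 = (K powr p * measure lebesgue Q_cyl + (K * V) powr p * m1) powr (1 / p)"
  have L3: "Lp_norm p Q_cyl (\<lambda>z. pd_t (\<phi> j) z - a z * pd_x (pd_x (\<phi> j)) z) \<le> ennreal N1" for j
    unfolding N1_def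
  proof (rule Lp_norm_concentrated[OF _ K])
    show "(\<lambda>z. pd_t (\<phi> j) z - a z * pd_x (pd_x (\<phi> j)) z) \<in> borel_measurable borel"
      unfolding pdt pdxx using me measurables by measurable
    have split: "pd_t (\<phi> j) z - a z * pd_x (pd_x (\<phi> j)) z =
        (\<eta>t z * us j z - a z * (\<eta>xx z * us j z + 2 * (\<eta>x z * xs j z))) + \<eta> z * (ts j z - a z * xxs j z)" for z
      unfolding pdt pdxx by (simp add: algebra_simps)
    have lo: "\<bar>\<eta>t z * us j z - a z * (\<eta>xx z * us j z + 2 * (\<eta>x z * xs j z))\<bar> \<le> M * C + (1 / \<kappa>) * (3 * (M * C))"
      if "z \<in> Q_cyl" for z
    proof -
      have "\<bar>\<eta>t z * us j z\<bar> \<le> M * C" "\<bar>\<eta>xx z * us j z\<bar> \<le> M * C" "\<bar>\<eta>x z * xs j z\<bar> \<le> M * C"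
        using prod b us_bounded_Q[OF that] by (auto simp: C_def)
      moreover from this have "\<bar>a z * (\<eta>xx z * us j z + 2 * (\<eta>x z * xs j z))\<bar> \<le> (1 / \<kappa>) * (3 * (M * C))"
        unfolding abs_mult[of "a z"] using a_bounds[of z] kappa by (intro mult_mono) auto
      ultimately show ?thesis by linarith
    qed
    show "\<bar>pd_t (\<phi> j) z - a z * pd_x (pd_x (\<phi> j)) z\<bar> \<le> K" if "z \<in> Q_cyl" "z \<notin> Box j" for z
    proof -
      have "ts j z - a z * xxs j z = 0" using off_limits(5)[OF that(2)] pos(4)[of j z] by simp
      then show ?thesis unfolding split using lo[OF that(1)] K0(3) by (simp add: K_def)
    qed
    show "\<bar>pd_t (\<phi> j) z - a z * pd_x (pd_x (\<phi> j)) z\<bar> \<le> K * v j" if z: "z \<in> Box j" for z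
    proof -
      have "ts j z - a z * xxs j z = v j * (1 - a z)" using in_Box[OF z] by (simp add: algebra_simps)
      then have "\<bar>\<eta> z * (ts j z - a z * xxs j z)\<bar> = \<bar>\<eta> z\<bar> * (v j * \<bar>1 - a z\<bar>)"
        using v_pos[of j] by (simp add: abs_mult)
      also have "\<dots> \<le> M * (v j * (1 + 1 / \<kappa>))"
        using a_bounds[of z] kappa v_pos[of j] b(1) M by (intro mult_mono) auto
      finally have "\<bar>\<eta> z * (ts j z - a z * xxs j z)\<bar> \<le> (M * (1 + 1 / \<kappa>)) * v j" by (simp add: ac_simps)
      moreover have "M * C + (1 / \<kappa>) * (3 * (M * C)) \<le> (M * C + (1 / \<kappa>) * (3 * (M * C))) * v j"
        using K0 v_pos[of j] mult_left_mono[of 1 "v j" "M * C + (1 / \<kappa>) * (3 * (M * C))"] by simp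
      moreover have "z \<in> Q_cyl" using z Box_subset(2) by blast
      ultimately show ?thesis unfolding split K_def distrib_right[of _ _ "v j"]
        using lo[of z] by (simp add: distrib_right)
    qed
  qed
  define c where "c = \<kappa> powr p * m0 * 2 powr - p"
  have lower: "c * ln (real j) \<le> (\<integral>z. \<bar>pd_x (pd_x (\<phi> j)) z\<bar> powr p \<partial>lebesgue_on D)" if "1 \<le> j" for j
  proof -
    have "pd_x (pd_x (\<phi> j)) z = xxs j z" if "z \<in> D" for z
    proof -
      have z: "fst z \<in> {t1<..<t2}" "snd z \<in> {x1<..<x2}" using that by (auto simp: D)
      have d2: "deriv \<eta>2 x = 0" if "x \<in> {x1<..<x2}" for x
        using deriv_const_on_open[OF _ one(2) that] by simp
      have "deriv (deriv \<eta>2) (snd z) = 0"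
        using deriv_const_on_open[OF _ d2 z(2)] by simp
      then show ?thesis using one(1)[OF z(1)] one(2)[OF z(2)] d2[OF z(2)]
        by (simp add: pdxx \<eta>_def \<eta>x_def \<eta>xx_def)
    qed
    then have "(\<integral>z. \<bar>pd_x (pd_x (\<phi> j)) z\<bar> powr p \<partial>lebesgue_on D) = (\<integral>z. xxs j z powr p \<partial>lebesgue_on D)"
      using pos(4) by (intro Bochner_Integration.integral_cong) (auto simp: space_restrict_space abs_of_pos)
    then show ?thesis using F_powr_integral[OF profiles(2) that] by (simp add: c_def)
  qed
  have "0 < c" using kappa m0 by (simp add: c_def)
  \<comment> \<open>The added 1 ensures strict positivity, since the other summands are only known
    to be nonnegative.\<close>
  moreover have N: "0 < M * C + 2 * (M * C) + N1 + 1" "0 \<le> N1"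
    using K0(1) powr_ge_zero[of "K powr p * measure lebesgue Q_cyl + (K * V) powr p * m1" "1 / p"]
    unfolding N1_def by linarith+
  moreover have "Linf_norm Q_cyl (\<phi> j) + Linf_norm Q_cyl (pd_x (\<phi> j)) +
      Lp_norm p Q_cyl (\<lambda>z. pd_t (\<phi> j) z - a z * pd_x (pd_x (\<phi> j)) z) \<le> ennreal (M * C + 2 * (M * C) + N1 + 1)" for j
  proof -
    have "Linf_norm Q_cyl (\<phi> j) + Linf_norm Q_cyl (pd_x (\<phi> j)) +
        Lp_norm p Q_cyl (\<lambda>z. pd_t (\<phi> j) z - a z * pd_x (pd_x (\<phi> j)) z) \<le> ennreal (M * C) + ennreal (2 * (M * C)) + ennreal N1"
      by (intro add_mono L1 L2 L3)
    also have "\<dots> = ennreal (M * C + 2 * (M * C) + N1)"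
      using K0(1) N(2) by (simp only: ennreal_plus add_nonneg_nonneg mult_nonneg_nonneg zero_le_numeral)
    also have "\<dots> \<le> ennreal (M * C + 2 * (M * C) + N1 + 1)" by (rule ennreal_leI) simp
    finally show ?thesis .
  qed
  ultimately show ?thesis using test lower by blast
qed

end

theorem mainTheorem3:
  fixes \<kappa> p t1 t2 x1 x2 :: real and D :: "(real \<times> real) set"
  assumes "D = {t1<..<t2} \<times> {x1<..<x2}" and "D \<noteq> {}" and "compactly_inside D Q_half"
    and "0 < \<kappa>" and "\<kappa> < 1" and "p = 2 / (1 - \<kappa>)"
  shows "\<exists>(a :: real \<times> real \<Rightarrow> real) (u :: real \<times> real \<Rightarrow> real) ut ux uxx (\<Sigma> :: (real \<times> real) set).
      a \<in> borel_measurable (restrict_space borel Q_cyl) \<and>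
      (\<forall>z\<in>Q_cyl. \<kappa> \<le> a z \<and> a z \<le> 1 / \<kappa>) \<and>
      W122_on Q_cyl u ut ux uxx \<and>
      compact \<Sigma> \<and> \<Sigma> \<subseteq> D \<and> \<Sigma> \<in> null_sets lebesgue \<and>
      smooth_on (Q_cyl - \<Sigma>) a \<and> smooth_on (Q_cyl - \<Sigma>) u \<and>
      (AE z in lebesgue_on Q_cyl. ut z - a z * uxx z = 0) \<and>
      bounded (u ` Q_cyl) \<and> continuous_on Q_cyl u \<and>
      (\<forall>(t, x)\<in>Q_cyl. ((\<lambda>y. u (t, y)) has_real_derivative ux (t, x)) (at x)) \<and>
      bounded (ux ` Q_cyl) \<and> continuous_on Q_cyl ux \<and>
      (\<exists>c>0. \<exists>N>0. \<forall>\<^sub>F \<tau> in at_top.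
         c * \<tau> powr (-p) \<le> measure lebesgue {z\<in>D. uxx z > \<tau>} \<and>
         measure lebesgue {z\<in>D. uxx z > \<tau>} \<le> N * \<tau> powr (-p)) \<and>
      weak_Lp_on p D ut \<and> weak_Lp_on p D uxx \<and> \<not> Lp_on p D ut \<and> \<not> Lp_on p D uxx \<and>
      (\<exists>\<phi> :: nat \<Rightarrow> real \<times> real \<Rightarrow> real. \<exists>c>0. \<exists>N>0. \<forall>j\<ge>1.
         \<phi> j \<in> test_functions Q_cyl \<and>
         Linf_norm Q_cyl (\<phi> j) + Linf_norm Q_cyl (pd_x (\<phi> j)) +
           Lp_norm p Q_cyl (\<lambda>z. pd_t (\<phi> j) z - a z * pd_x (pd_x (\<phi> j)) z) \<le> ennreal N \<and>
         (\<integral>z. \<bar>pd_x (pd_x (\<phi> j)) z\<bar> powr p \<partial>lebesgue_on D) \<ge> c * ln (real j))"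
proof -
  have tx: "t1 < t2" "x1 < x2" using assms(1,2) by auto
  have "closure D = {t1..t2} \<times> {x1..x2}"
    using tx by (simp add: assms(1) closure_Times)
  then have "{t1..t2} \<times> {x1..x2} \<subseteq> Q_half" using assms(3) by (simp add: compactly_inside_def)
  then have "(t1, x1) \<in> Q_half" "(t2, x2) \<in> Q_half" using tx by (auto simp: subset_iff)
  then have r: "- 1 / 4 < t1" "t2 < 0" "- 1 / 2 < x1" "x2 < 1 / 2" by (auto simp: Q_half_def)
  \<comment> \<open>Middle thirds of the sides of \<open>D\<close>, so that the compact
    \<open>Box 0\<close> lies inside the open rectangle.\<close>
  define A0 where "A0 = {(2 * t1 + t2) / 3..(t1 + 2 * t2) / 3}"
  define B0 where "B0 = {(2 * x1 + x2) / 3..(x1 + 2 * x2) / 3}"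
  have "cellset A0" "cellset B0" using tx by (auto simp: A0_def B0_def intro!: cellset_Icc)
  from stages_exist[OF this assms(4,5)] obtain A B A1 B1 \<rho> h \<xi> g \<mu> c where
    S: "A 0 = A0" "B 0 = B0"
      "\<And>n. stage (\<mu> n) (c n) (1 / 2 ^ n) (A n) (B n) (A1 n) (B1 n) (A (Suc n)) (B (Suc n)) (\<rho> n) (h n) (\<xi> n) (g n)"
      "\<And>n. cellset (A n)" "\<And>n. cellset (B n)"
      "\<And>n. c n \<le> (1 - \<kappa>) * (real n + 4 / (1 - \<kappa>)) - 2"
      "\<And>n. measure lebesgue (A n) = measure lebesgue A0 / 2 * (real n + 1) powr - (1 / (1 - \<kappa>)) * (1 + 1 / (real n + 1))"
      "\<And>n. measure lebesgue (B n) = measure lebesgue B0 / 2 * (real n + 1) powr - (1 / (1 - \<kappa>)) * (1 + 1 / (real n + 1))"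
    by blast
  interpret S: staircase \<kappa> A B A1 B1 \<rho> h \<xi> g \<mu> c
    by unfold_locales (fact assms(4) assms(5) S)+
  \<comment> \<open>The 4 collects the factor 1/2 from each of the two measure formulas.\<close>
  define m where "m = measure lebesgue A0 * measure lebesgue B0 / 4"
  have m: "0 < m" using tx by (simp add: m_def A0_def B0_def)
  have mBox: "measure lebesgue (S.Box n) = m * (real n + 1) powr - p * (1 + 1 / (real n + 1))\<^sup>2" for n
  proof -
    have e: "- p = - (1 / (1 - \<kappa>)) + - (1 / (1 - \<kappa>))" by (simp add: assms(6))
    have "measure lebesgue (S.Box n) = measure lebesgue (A n) * measure lebesgue (B n)"
      unfolding S.Box_def by (intro measure_lebesgue_Times cellset_compact S)
    then show ?thesis unfolding S(7,8) m_def e powr_add by (simp add: power2_eq_square)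
  qed
  \<comment> \<open>The cutoff losses of both variables together lie between these bounds, whence
    the constants \<open>m\<close> and \<open>4 * m\<close> in the two-sided estimate.\<close>
  have w: "1 \<le> (1 + 1 / (real n + 1))\<^sup>2" "(1 + 1 / (real n + 1))\<^sup>2 \<le> 4" for n
    using power_mono[of 1 "1 + 1 / (real n + 1)" 2] power_mono[of "1 + 1 / (real n + 1)" 2 2] by auto
  interpret S: singular_staircase \<kappa> A B A1 B1 \<rho> h \<xi> g \<mu> c p m "4 * m" D
  proof unfold_locales
    show "p = 2 / (1 - \<kappa>)" "0 < m" by (fact assms m)+
    show "m * (real n + 1) powr - p \<le> measure lebesgue (S.Box n)" for n
      unfolding mBox using w(1)[of n] m mult_left_mono[of 1 "(1 + 1 / (real n + 1))\<^sup>2" "m * (real n + 1) powr - p"] by simp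
    show "measure lebesgue (S.Box n) \<le> 4 * m * (real n + 1) powr - p" for n
      unfolding mBox using w(2)[of n] m mult_left_mono[of "(1 + 1 / (real n + 1))\<^sup>2" 4 "m * (real n + 1) powr - p"] by simp
    show "S.Box 0 \<subseteq> D" using tx by (auto simp: S.Box_def S(1,2) A0_def B0_def assms(1))
    show "D \<subseteq> Q_cyl" using r by (auto simp: assms(1) Q_cyl_def)
    show "open D" unfolding assms(1) by (intro open_Times) auto
  qed
  \<comment> \<open>The cutoff ends at \<open>t2 / 2\<close>, strictly between \<open>t2\<close> and
    0, which keeps the support away from the top of \<open>Q_cyl\<close>.\<close>
  obtain \<eta>1 where \<eta>1: "smooth1 \<eta>1" "\<And>t. t \<notin> {- 1 / 2<..<t2 / 2} \<Longrightarrow> \<eta>1 t = 0" "\<And>t. t \<in> {t1..t2} \<Longrightarrow> \<eta>1 t = 1"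
    using smooth1_cutoff[of "- 1 / 2" t1 t2 "t2 / 2"] r tx by auto
  obtain \<eta>2 where \<eta>2: "smooth1 \<eta>2" "\<And>x. x \<notin> {- 3 / 4<..<3 / 4} \<Longrightarrow> \<eta>2 x = 0" "\<And>x. x \<in> {x1..x2} \<Longrightarrow> \<eta>2 x = 1"
    using smooth1_cutoff[of "- 3 / 4" x1 x2 "3 / 4"] r tx by auto
  have third: "\<exists>\<phi> :: nat \<Rightarrow> real \<times> real \<Rightarrow> real. \<exists>c>0. \<exists>N>0. \<forall>j\<ge>1.
         \<phi> j \<in> test_functions Q_cyl \<and>
         Linf_norm Q_cyl (\<phi> j) + Linf_norm Q_cyl (pd_x (\<phi> j)) +
           Lp_norm p Q_cyl (\<lambda>z. pd_t (\<phi> j) z - S.a z * pd_x (pd_x (\<phi> j)) z) \<le> ennreal N \<and>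
         (\<integral>z. \<bar>pd_x (pd_x (\<phi> j)) z\<bar> powr p \<partial>lebesgue_on D) \<ge> c * ln (real j)"
  proof (rule S.test_sequence[OF \<eta>1(1) \<eta>2(1)])
    show "\<eta>1 t = 0" if "t \<notin> {- 1 / 2..t2 / 2}" for t using \<eta>1(2)[of t] that by auto
    show "\<eta>2 x = 0" if "x \<notin> {- 3 / 4..3 / 4}" for x using \<eta>2(2)[of x] that by auto
    show "D = {t1<..<t2} \<times> {x1<..<x2}" by (fact assms(1))
  qed (use \<eta>1 \<eta>2 r in auto)
  have AE: "AE z in lebesgue_on Q_cyl. z \<notin> S.Sing"
    using S.AE_off_Sing Q_cyl_facts(3) by (simp add: fmeasurableD)
  show ?thesis
  proof (rule exI[of _ S.a], rule exI[of _ S.u], rule exI[of _ S.ut], rule exI[of _ S.ux], rule exI[of _ S.uxx],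
      rule exI[of _ S.Sing], intro conjI)
    show "S.a \<in> borel_measurable (restrict_space borel Q_cyl)"
      using S.measurables(9) by (rule measurable_restrict_space1)
    show "\<forall>z\<in>Q_cyl. \<kappa> \<le> S.a z \<and> S.a z \<le> 1 / \<kappa>" using S.a_bounds by blast
    show "W122_on Q_cyl S.u S.ut S.ux S.uxx" by (rule S.W122_u)
    show "compact S.Sing" "S.Sing \<in> null_sets lebesgue" by (fact S.compact_Sing S.Sing_null)+
    show "S.Sing \<subseteq> D" using S.Sing_subset S.Box_D by blast
    show "smooth_on (Q_cyl - S.Sing) S.a" "smooth_on (Q_cyl - S.Sing) S.u"
      using smooth_on_subset[OF S.smooth_off_Sing(1)] smooth_on_subset[OF S.smooth_off_Sing(2)] by blast+
    show "AE z in lebesgue_on Q_cyl. S.ut z - S.a z * S.uxx z = 0"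
      using AE by eventually_elim (rule S.equation)
    show "bounded (S.u ` Q_cyl)" "bounded (S.ux ` Q_cyl)"
      unfolding bounded_real using S.u_bounded_Q by blast+
    show "continuous_on Q_cyl S.u" "continuous_on Q_cyl S.ux"
      using continuous_on_subset[OF S.continuous_limits(1)] continuous_on_subset[OF S.continuous_limits(2)] by blast+
    show "\<forall>(t, x)\<in>Q_cyl. ((\<lambda>y. S.u (t, y)) has_real_derivative S.ux (t, x)) (at x)"
      using S.u_DERIV by blast
    show "weak_Lp_on p D S.ut" "weak_Lp_on p D S.uxx" "\<not> Lp_on p D S.ut" "\<not> Lp_on p D S.uxx"
      by (fact S.profile_weak_Lp[OF S.profiles(1)] S.profile_weak_Lp[OF S.profiles(2)]
          S.profile_not_Lp[OF S.profiles(1)] S.profile_not_Lp[OF S.profiles(2)])+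
  qed (fact S.profile_tail[OF S.profiles(2)] third)+
qed

end
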